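(* Let $R$ be a commutative ring, $Q$ a non-zero $R$-module, $m\ge 1$ a natural number, $\varphi:Q^{\otimes m}\to R$ an $R$-module isomorphism, and $I\subseteq\{0,\dots,m-1\}$. Then the following statements hold. (1) $S_{Q,\varphi,I}$ is a commutative $R$-subalgebra of $S_{Q,\varphi}$ if and only if $I$ is $m$-saturated. In this case $S_{Q,\varphi,I}$ is an $I$-graded $R$-algebra and $\operatorname{rk}_R(S_{Q,\varphi,I})$ divides $m$. (2) If $I$ is $m$-saturated, then there exist a finitely generated projective $R$-module $Q'$ with $\operatorname{rk}(Q')=1$, a natural number $m'\ge1$ and an $R$-module homomorphism $\varphi':Q'^{\otimes m'}\to R$ such that there is an $R$-algebra isomorphism $S_{Q,\varphi,I}\simeq S_{Q',\varphi'}$.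
   Context: All tensor products are over $R$. For a non-zero $R$-module $Q$ put $Q^{\otimes 0}=R$ and $Q^{\otimes i}=Q\otimes\cdots\otimes Q$ ($i$ factors). Given a natural number $m$ and an $R$-module homomorphism $\varphi:Q^{\otimes m}\to R$, let $S_{Q,\varphi}=\bigoplus_{i=0}^{m-1}Q^{\otimes i}$. Define an $R$-linear map $\tilde\varphi:\bigoplus_{i\ge0}Q^{\otimes i}\to S_{Q,\varphi}$ recursively by $\tilde\varphi(x)=x$ for $x\in Q^{\otimes i}$, $0\le i\le m-1$, and $\tilde\varphi(a_1\otimes\cdots\otimes a_i)=\tilde\varphi\big(\varphi(a_1\otimes\cdots\otimes a_m)\,a_{m+1}\otimes\cdots\otimes a_i\big)$ for $i\ge m$ (for $i=m$ this is $\varphi(a_1\otimes\cdots\otimes a_m)\in R$). The product on $S_{Q,\varphi}$ is $x\bullet y=\tilde\varphi(x\otimes y)$, where $x\otimes y$ is the product in the tensor algebra $\bigoplus_{i\ge0}Q^{\otimes i}$. With this product $S_{Q,\varphi}$ is called a radical extension of $R$; it contains $R=Q^{\otimes0}$ as a unital subring and is graded by the cyclic group $C_m$ of integers modulo $m$. For $I\subseteq\{0,\dots,m-1\}$, the $I$-radical extension of $R$ is the $R$-submodule $S_{Q,\varphi,I}=\bigoplus_{i\in I}Q^{\otimes i}$ of $S_{Q,\varphi}$. The set $I$ is called $m$-saturated if it is closed under addition in $C_m$; that is, if $I$ viewed as a subset of $C_m$ is a subgroup. $\operatorname{rk}_R$ denotes the rank of a finitely generated projective $R$-module. *)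

theory Defs
  imports "HOL-Algebra.Module" "HOL-Algebra.QuotRing" "HOL-Algebra.Elementary_Groups"
begin

text \<open>
  Modules and algebras are records of type \<open>('r, 'a) module\<close> over a ring record \<open>R\<close>.  The fields
  \<open>mult\<close> and \<open>one\<close> are irrelevant for a record that is only used as a module, and are then left
  undefined.
\<close>

section \<open>Modules\<close>

definition ring_module :: "('r, 'z) ring_scheme \<Rightarrow> ('r, 'r) module" where
  "ring_module R = \<lparr>carrier = carrier R, monoid.mult = monoid.mult R,
     monoid.one = \<one>\<^bsub>R\<^esub>, ring.zero = \<zero>\<^bsub>R\<^esub>, ring.add = ring.add R, smult = monoid.mult R\<rparr>"

definition module_hom ::
  "('r, 'z) ring_scheme \<Rightarrow> ('r, 'a, 'x) module_scheme \<Rightarrow> ('r, 'b, 'y) module_scheme \<Rightarrow> ('a \<Rightarrow> 'b) set" where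
  "module_hom R M N = {f \<in> carrier M \<rightarrow> carrier N.
     (\<forall>x\<in>carrier M. \<forall>y\<in>carrier M. f (x \<oplus>\<^bsub>M\<^esub> y) = f x \<oplus>\<^bsub>N\<^esub> f y) \<and>
     (\<forall>r\<in>carrier R. \<forall>x\<in>carrier M. f (r \<odot>\<^bsub>M\<^esub> x) = r \<odot>\<^bsub>N\<^esub> f x)}"

definition module_iso ::
  "('r, 'z) ring_scheme \<Rightarrow> ('r, 'a, 'x) module_scheme \<Rightarrow> ('r, 'b, 'y) module_scheme \<Rightarrow> ('a \<Rightarrow> 'b) set" where
  "module_iso R M N = {f \<in> module_hom R M N. bij_betw f (carrier M) (carrier N)}"

definition generated_submodule ::
  "('r, 'z) ring_scheme \<Rightarrow> ('r, 'a, 'x) module_scheme \<Rightarrow> 'a set \<Rightarrow> 'a set" where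
  "generated_submodule R M A = \<Inter>{H. submodule H R M \<and> A \<subseteq> H}"

definition quotient_module ::
  "('r, 'a, 'x) module_scheme \<Rightarrow> 'a set \<Rightarrow> ('r, 'a set) module" where
  "quotient_module M N = \<lparr>carrier = a_rcosets\<^bsub>M\<^esub> N,
     monoid.mult = undefined, monoid.one = undefined, ring.zero = N,
     ring.add = set_add M, smult = (\<lambda>r X. \<Union>x\<in>X. N +>\<^bsub>M\<^esub> (r \<odot>\<^bsub>M\<^esub> x))\<rparr>"

text \<open>
  The external direct sum over an index set \<open>J\<close>.  Elements are families that vanish outside \<open>J\<close>, so
  the carrier for a subset of \<open>J\<close> is literally a submodule of the direct sum over \<open>J\<close>.
\<close>

definition direct_sum :: "'i set \<Rightarrow> ('i \<Rightarrow> ('r, 'a) module) \<Rightarrow> ('r, 'i \<Rightarrow> 'a) module" where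
  "direct_sum J M = \<lparr>carrier = {f. (\<forall>i\<in>J. f i \<in> carrier (M i)) \<and> (\<forall>i. i \<notin> J \<longrightarrow> f i = \<zero>\<^bsub>M i\<^esub>) \<and>
       finite {i. f i \<noteq> \<zero>\<^bsub>M i\<^esub>}},
     monoid.mult = undefined, monoid.one = undefined, ring.zero = (\<lambda>i. \<zero>\<^bsub>M i\<^esub>),
     ring.add = (\<lambda>f g i. f i \<oplus>\<^bsub>M i\<^esub> g i), smult = (\<lambda>r f i. r \<odot>\<^bsub>M i\<^esub> f i)\<rparr>"

definition ds_inject :: "('i \<Rightarrow> ('r, 'a) module) \<Rightarrow> 'i \<Rightarrow> 'a \<Rightarrow> 'i \<Rightarrow> 'a" where
  "ds_inject M i x = (\<lambda>j. \<zero>\<^bsub>M j\<^esub>)(i := x)"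

definition free_module :: "('r, 'z) ring_scheme \<Rightarrow> 'x set \<Rightarrow> ('r, 'x \<Rightarrow> 'r) module" where
  "free_module R X = direct_sum X (\<lambda>_. ring_module R)"

definition free_gen :: "('r, 'z) ring_scheme \<Rightarrow> 'x \<Rightarrow> 'x \<Rightarrow> 'r" where
  "free_gen R x = (\<lambda>y. if y = x then \<one>\<^bsub>R\<^esub> else \<zero>\<^bsub>R\<^esub>)"


section \<open>Finitely generated projective modules and their rank\<close>

definition finitely_generated :: "('r, 'z) ring_scheme \<Rightarrow> ('r, 'a, 'x) module_scheme \<Rightarrow> bool" where
  "finitely_generated R M \<longleftrightarrow>
     (\<exists>A. finite A \<and> A \<subseteq> carrier M \<and> generated_submodule R M A = carrier M)"

text \<open>
  Projective means isomorphic to a direct summand of a free module, expressed by a split injection.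
  Taking the basis \<open>X\<close> in the element type of \<open>M\<close> is no restriction: \<open>M\<close> is a quotient of the free
  module on its own carrier.
\<close>

definition projective_module :: "('r, 'z) ring_scheme \<Rightarrow> ('r, 'a, 'x) module_scheme \<Rightarrow> bool" where
  "projective_module R M \<longleftrightarrow>
     (\<exists>(X :: 'a set) \<iota> \<pi>. \<iota> \<in> module_hom R M (free_module R X) \<and> \<pi> \<in> module_hom R (free_module R X) M \<and>
        (\<forall>x\<in>carrier M. \<pi> (\<iota> x) = x))"

definition fg_projective :: "('r, 'z) ring_scheme \<Rightarrow> ('r, 'a, 'x) module_scheme \<Rightarrow> bool" where
  "fg_projective R M \<longleftrightarrow> module R M \<and> finitely_generated R M \<and> projective_module R M"

definition loc_rel ::
  "('r, 'z) ring_scheme \<Rightarrow> 'r set \<Rightarrow> ('r, 'a, 'x) module_scheme \<Rightarrow> (('a \<times> 'r) \<times> ('a \<times> 'r)) set" where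
  "loc_rel R S M = {((x, s), (y, t)). x \<in> carrier M \<and> y \<in> carrier M \<and> s \<in> S \<and> t \<in> S \<and>
     (\<exists>u\<in>S. u \<odot>\<^bsub>M\<^esub> (t \<odot>\<^bsub>M\<^esub> x) = u \<odot>\<^bsub>M\<^esub> (s \<odot>\<^bsub>M\<^esub> y))}"

definition loc_frac ::
  "('r, 'z) ring_scheme \<Rightarrow> 'r set \<Rightarrow> ('r, 'a, 'x) module_scheme \<Rightarrow> 'a \<Rightarrow> 'r \<Rightarrow> ('a \<times> 'r) set" where
  "loc_frac R S M x s = loc_rel R S M `` {(x, s)}"

text \<open>
  The localization of \<open>M\<close> at a multiplicative subset \<open>S\<close> of \<open>R\<close>, with scalars in the localization
  of \<open>R\<close> (the elements of which are the classes \<open>loc_frac R S (ring_module R) a s\<close>).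
\<close>

definition loc_module ::
  "('r, 'z) ring_scheme \<Rightarrow> 'r set \<Rightarrow> ('r, 'a, 'x) module_scheme \<Rightarrow> (('r \<times> 'r) set, ('a \<times> 'r) set) module" where
  "loc_module R S M = \<lparr>carrier = (carrier M \<times> S) // loc_rel R S M,
     monoid.mult = undefined, monoid.one = undefined, ring.zero = loc_frac R S M \<zero>\<^bsub>M\<^esub> \<one>\<^bsub>R\<^esub>,
     ring.add = (\<lambda>X Y. \<Union>(x, s)\<in>X. \<Union>(y, t)\<in>Y. loc_frac R S M (t \<odot>\<^bsub>M\<^esub> x \<oplus>\<^bsub>M\<^esub> s \<odot>\<^bsub>M\<^esub> y) (s \<otimes>\<^bsub>R\<^esub> t)),
     smult = (\<lambda>A Y. \<Union>(a, s)\<in>A. \<Union>(y, t)\<in>Y. loc_frac R S M (a \<odot>\<^bsub>M\<^esub> y) (s \<otimes>\<^bsub>R\<^esub> t))\<rparr>"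

definition loc_ring :: "('r, 'z) ring_scheme \<Rightarrow> 'r set \<Rightarrow> ('r \<times> 'r) set ring" where
  "loc_ring R S = (let L = loc_module R S (ring_module R) in
     \<lparr>carrier = carrier L, monoid.mult = smult L, monoid.one = loc_frac R S (ring_module R) \<one>\<^bsub>R\<^esub> \<one>\<^bsub>R\<^esub>,
      ring.zero = \<zero>\<^bsub>L\<^esub>, ring.add = ring.add L\<rparr>)"

text \<open>
  \<open>rk\<^sub>R M\<close> is the constant \<open>n\<close>: for every prime ideal \<open>P\<close>, the localization of \<open>M\<close> at \<open>P\<close> is free
  of rank \<open>n\<close> over the localization of \<open>R\<close> at \<open>P\<close>.  The number \<open>n\<close> is unique when \<open>R\<close> is not the
  zero ring.
\<close>

definition has_rank :: "('r, 'z) ring_scheme \<Rightarrow> ('r, 'a, 'x) module_scheme \<Rightarrow> nat \<Rightarrow> bool" where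
  "has_rank R M n \<longleftrightarrow> (\<forall>P. primeideal P R \<longrightarrow>
     (let S = carrier R - P; RP = loc_ring R S in
       module_iso RP (free_module RP {..<n}) (loc_module R S M) \<noteq> {}))"


section \<open>Algebras\<close>

text \<open>
  The locale \<open>algebra\<close> is that of commutative, associative, unital algebras; the second conjunct
  therefore contains that \<open>H\<close> has the unit of \<open>A\<close> and is closed under the product of \<open>A\<close>.
  \<open>A\<close> itself is not required to be commutative or associative.
\<close>

definition commutative_subalgebra ::
  "('r, 'z) ring_scheme \<Rightarrow> ('r, 'a) module \<Rightarrow> 'a set \<Rightarrow> bool" where
  "commutative_subalgebra R A H \<longleftrightarrow> submodule H R A \<and> algebra R (A\<lparr>carrier := H\<rparr>)"

definition algebra_iso ::
  "('r, 'z) ring_scheme \<Rightarrow> ('r, 'a, 'x) module_scheme \<Rightarrow> ('r, 'b, 'y) module_scheme \<Rightarrow> ('a \<Rightarrow> 'b) set" where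
  "algebra_iso R A B = ring_iso A B \<inter> module_iso R A B"

text \<open>\<open>A\<close> is the internal direct sum of the submodules \<open>C g\<close>, \<open>g \<in> G\<close>, compatibly with the product.\<close>

definition graded_algebra ::
  "('r, 'z) ring_scheme \<Rightarrow> ('g, 'w) monoid_scheme \<Rightarrow> ('r, 'a, 'x) module_scheme \<Rightarrow> ('g \<Rightarrow> 'a set) \<Rightarrow> bool" where
  "graded_algebra R G A C \<longleftrightarrow> group G \<and> algebra R A \<and>
     (\<forall>g\<in>carrier G. submodule (C g) R A) \<and>
     (\<forall>x\<in>carrier A. \<exists>!f. f \<in> (\<Pi>\<^sub>E g\<in>carrier G. C g) \<and> finite {g \<in> carrier G. f g \<noteq> \<zero>\<^bsub>A\<^esub>} \<and>
        x = (\<Oplus>\<^bsub>A\<^esub>g\<in>{g \<in> carrier G. f g \<noteq> \<zero>\<^bsub>A\<^esub>}. f g)) \<and>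
     \<one>\<^bsub>A\<^esub> \<in> C \<one>\<^bsub>G\<^esub> \<and>
     (\<forall>g\<in>carrier G. \<forall>h\<in>carrier G. \<forall>x\<in>C g. \<forall>y\<in>C h. x \<otimes>\<^bsub>A\<^esub> y \<in> C (g \<otimes>\<^bsub>G\<^esub> h))"


section \<open>Tensor powers and the tensor algebra\<close>

text \<open>
  The \<open>i\<close>-fold tensor power of \<open>Q\<close> is the free module on words of length \<open>i\<close> over \<open>Q\<close> modulo the
  relations of multilinearity.  There are no relations for \<open>i = 0\<close>, and the tensor power is then the
  free module on the empty word, that is, \<open>R\<close>.
\<close>

definition words :: "('r, 'q, 'x) module_scheme \<Rightarrow> nat \<Rightarrow> 'q list set" where
  "words Q i = {w \<in> lists (carrier Q). length w = i}"

definition multilin_rel ::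
  "('r, 'z) ring_scheme \<Rightarrow> ('r, 'q, 'x) module_scheme \<Rightarrow> nat \<Rightarrow> ('q list \<Rightarrow> 'r) set" where
  "multilin_rel R Q i = (let F = free_module R (words Q i); e = free_gen R in
     generated_submodule R F
      ({e (u @ [a \<oplus>\<^bsub>Q\<^esub> b] @ v) \<ominus>\<^bsub>F\<^esub> (e (u @ [a] @ v) \<oplus>\<^bsub>F\<^esub> e (u @ [b] @ v)) | u v a b.
          a \<in> carrier Q \<and> b \<in> carrier Q \<and> u \<in> lists (carrier Q) \<and> v \<in> lists (carrier Q) \<and>
          length u + 1 + length v = i} \<union>
       {e (u @ [r \<odot>\<^bsub>Q\<^esub> a] @ v) \<ominus>\<^bsub>F\<^esub> r \<odot>\<^bsub>F\<^esub> e (u @ [a] @ v) | u v a r.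
          r \<in> carrier R \<and> a \<in> carrier Q \<and> u \<in> lists (carrier Q) \<and> v \<in> lists (carrier Q) \<and>
          length u + 1 + length v = i}))"

definition tensor_power ::
  "('r, 'z) ring_scheme \<Rightarrow> ('r, 'q, 'x) module_scheme \<Rightarrow> nat \<Rightarrow> ('r, ('q list \<Rightarrow> 'r) set) module" where
  "tensor_power R Q i = quotient_module (free_module R (words Q i)) (multilin_rel R Q i)"

text \<open>The pure tensor \<open>a\<^sub>1 \<otimes> \<cdots> \<otimes> a\<^sub>i\<close> for \<open>w = [a\<^sub>1, \<dots>, a\<^sub>i]\<close>.\<close>

definition pure_tensor ::
  "('r, 'z) ring_scheme \<Rightarrow> ('r, 'q, 'x) module_scheme \<Rightarrow> 'q list \<Rightarrow> ('q list \<Rightarrow> 'r) set" where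
  "pure_tensor R Q w =
     multilin_rel R Q (length w) +>\<^bsub>free_module R (words Q (length w))\<^esub> free_gen R w"

text \<open>
  The linear map from a tensor power to \<open>N\<close> that sends each pure tensor \<open>w\<close> to \<open>g w\<close>; meaningful
  for multilinear \<open>g\<close> only, when the value does not depend on the representative \<open>p\<close> of the class.
\<close>

definition tensor_lift ::
  "('r, 'z) ring_scheme \<Rightarrow> ('r, 'b, 'y) module_scheme \<Rightarrow> ('q list \<Rightarrow> 'b) \<Rightarrow> ('q list \<Rightarrow> 'r) set \<Rightarrow> 'b" where
  "tensor_lift R N g X =
     the_elem ((\<lambda>p. \<Oplus>\<^bsub>N\<^esub>w\<in>{w. p w \<noteq> \<zero>\<^bsub>R\<^esub>}. p w \<odot>\<^bsub>N\<^esub> g w) ` X)"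

text \<open>
  The product of homogeneous tensors of degrees \<open>i\<close> and \<open>j\<close>.  On representatives it is the bilinear
  extension of the concatenation of words: a word of length \<open>i + j\<close> is in a unique way the
  concatenation of words of lengths \<open>i\<close> and \<open>j\<close>, and the coefficients vanish on all other words.
\<close>

definition tensor_prod ::
  "('r, 'z) ring_scheme \<Rightarrow> ('r, 'q, 'x) module_scheme \<Rightarrow> nat \<Rightarrow> nat \<Rightarrow>
     ('q list \<Rightarrow> 'r) set \<Rightarrow> ('q list \<Rightarrow> 'r) set \<Rightarrow> ('q list \<Rightarrow> 'r) set" where
  "tensor_prod R Q i j X Y = (\<Union>p\<in>X. \<Union>q\<in>Y. multilin_rel R Q (i + j)
     +>\<^bsub>free_module R (words Q (i + j))\<^esub> (\<lambda>w. p (take i w) \<otimes>\<^bsub>R\<^esub> q (drop i w)))"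

definition tensor_algebra ::
  "('r, 'z) ring_scheme \<Rightarrow> ('r, 'q, 'x) module_scheme \<Rightarrow> ('r, nat \<Rightarrow> ('q list \<Rightarrow> 'r) set) module" where
  "tensor_algebra R Q = (direct_sum UNIV (tensor_power R Q))
     \<lparr>monoid.mult := (\<lambda>x y k. \<Oplus>\<^bsub>tensor_power R Q k\<^esub>i\<in>{..k}. tensor_prod R Q i (k - i) (x i) (y (k - i))),
      monoid.one := ds_inject (tensor_power R Q) 0 (pure_tensor R Q [])\<rparr>"


section \<open>Radical extensions\<close>

text \<open>
  \<open>a\<^sub>1 \<otimes> \<cdots> \<otimes> a\<^sub>i \<mapsto> \<phi>(a\<^sub>1 \<otimes> \<cdots> \<otimes> a\<^sub>m) a\<^sub>m\<^sub>+\<^sub>1 \<otimes> \<cdots> \<otimes> a\<^sub>i\<close> for \<open>i \<ge> m\<close>; for \<open>i = m\<close> the value lies in the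
  tensor power of degree \<open>0\<close>.
\<close>

definition contract ::
  "('r, 'z) ring_scheme \<Rightarrow> ('r, 'q, 'x) module_scheme \<Rightarrow> nat \<Rightarrow> (('q list \<Rightarrow> 'r) set \<Rightarrow> 'r) \<Rightarrow>
     nat \<Rightarrow> ('q list \<Rightarrow> 'r) set \<Rightarrow> ('q list \<Rightarrow> 'r) set" where
  "contract R Q m \<phi> i = tensor_lift R (tensor_power R Q (i - m))
     (\<lambda>w. \<phi> (pure_tensor R Q (take m w)) \<odot>\<^bsub>tensor_power R Q (i - m)\<^esub> pure_tensor R Q (drop m w))"

text \<open>The restriction of \<open>\<phi>\<close>-tilde to degree \<open>i\<close>. The case \<open>m = 0\<close> is excluded for termination only.\<close>

function reduce_deg ::
  "('r, 'z) ring_scheme \<Rightarrow> ('r, 'q, 'x) module_scheme \<Rightarrow> nat \<Rightarrow> (('q list \<Rightarrow> 'r) set \<Rightarrow> 'r) \<Rightarrow>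
     nat \<Rightarrow> ('q list \<Rightarrow> 'r) set \<Rightarrow> nat \<Rightarrow> ('q list \<Rightarrow> 'r) set" where
  "reduce_deg R Q m \<phi> i X =
     (if m = 0 \<or> i < m then ds_inject (tensor_power R Q) i X
      else reduce_deg R Q m \<phi> (i - m) (contract R Q m \<phi> i X))"
  by pat_completeness auto
termination
  by (relation "measure (\<lambda>(R, Q, m, \<phi>, i, X). i)") auto

declare reduce_deg.simps [simp del]

definition phi_tilde ::
  "('r, 'z) ring_scheme \<Rightarrow> ('r, 'q, 'x) module_scheme \<Rightarrow> nat \<Rightarrow> (('q list \<Rightarrow> 'r) set \<Rightarrow> 'r) \<Rightarrow>
     (nat \<Rightarrow> ('q list \<Rightarrow> 'r) set) \<Rightarrow> nat \<Rightarrow> ('q list \<Rightarrow> 'r) set" where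
  "phi_tilde R Q m \<phi> x = (\<Oplus>\<^bsub>direct_sum {..<m} (tensor_power R Q)\<^esub>
     i\<in>{i. x i \<noteq> \<zero>\<^bsub>tensor_power R Q i\<^esub>}. reduce_deg R Q m \<phi> i (x i))"

definition radical_ext ::
  "('r, 'z) ring_scheme \<Rightarrow> ('r, 'q, 'x) module_scheme \<Rightarrow> nat \<Rightarrow> (('q list \<Rightarrow> 'r) set \<Rightarrow> 'r) \<Rightarrow>
     ('r, nat \<Rightarrow> ('q list \<Rightarrow> 'r) set) module" where
  "radical_ext R Q m \<phi> = (direct_sum {..<m} (tensor_power R Q))
     \<lparr>monoid.mult := (\<lambda>x y. phi_tilde R Q m \<phi> (x \<otimes>\<^bsub>tensor_algebra R Q\<^esub> y)),
      monoid.one := \<one>\<^bsub>tensor_algebra R Q\<^esub>\<rparr>"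

definition I_radical_carrier ::
  "('r, 'z) ring_scheme \<Rightarrow> ('r, 'q, 'x) module_scheme \<Rightarrow> nat set \<Rightarrow> (nat \<Rightarrow> ('q list \<Rightarrow> 'r) set) set" where
  "I_radical_carrier R Q I = carrier (direct_sum I (tensor_power R Q))"

definition I_radical_ext ::
  "('r, 'z) ring_scheme \<Rightarrow> ('r, 'q, 'x) module_scheme \<Rightarrow> nat \<Rightarrow> (('q list \<Rightarrow> 'r) set \<Rightarrow> 'r) \<Rightarrow> nat set \<Rightarrow>
     ('r, nat \<Rightarrow> ('q list \<Rightarrow> 'r) set) module" where
  "I_radical_ext R Q m \<phi> I = (radical_ext R Q m \<phi>)\<lparr>carrier := I_radical_carrier R Q I\<rparr>"

text \<open>
  The cyclic group of integers modulo \<open>m\<close> is \<open>integer_mod_group m\<close>, with carrier \<open>{0..<int m}\<close>.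
  Saturated sets are subgroups; in particular the empty set is not saturated.
\<close>

definition saturated :: "nat \<Rightarrow> nat set \<Rightarrow> bool" where
  "saturated m I \<longleftrightarrow> subgroup (int ` I) (integer_mod_group m)"

end

theory Submission
  imports Defs "HOL-Library.Multiset"
begin

text \<open>
  The isomorphism \<open>\<phi>\<close> makes \<open>Q\<close> an invertible module, and everything follows from computing with the
  tensor \<open>\<epsilon>\<close> of degree \<open>m\<close> that has \<open>\<phi>(\<epsilon>) = 1\<close>.  A tensor \<open>w\<close> of degree \<open>m\<close> is \<open>\<phi>(w) \<epsilon>\<close>.  Hence contracting the
  first \<open>m\<close> factors by \<open>\<phi>\<close> is inverse to multiplication by \<open>\<epsilon>\<close> (\<open>contract_tp\<close>, \<open>eps_contract\<close>), and reduction to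
  degrees below \<open>m\<close> means cancelling powers of \<open>\<epsilon>\<close>.

  Why the tensor algebra is commutative.  As \<open>\<epsilon>\<close> is a linear combination of pure tensors \<open>w\<close>, the values
  \<open>\<phi>(w)\<close> generate the unit ideal, and an identity may be checked after multiplication by a power of each
  \<open>\<phi>(w)\<close> (\<open>eq_if_locally_eq\<close>).  Let \<open>w = a \<otimes> b\<close> with \<open>a\<close> in \<open>Q\<close>.  On the one hand \<open>a \<otimes> b \<otimes> x\<close> contracts to
  \<open>\<phi>(w) x\<close>; on the other hand \<open>b \<otimes> x = \<phi>(b \<otimes> x) \<epsilon>\<close>, so that \<open>\<phi>(w) x\<close> is a multiple of one and the same
  element for all \<open>x\<close> in \<open>Q\<close> (\<open>locally_cyclic\<close>).  Then \<open>\<phi>(w)\<^sup>2 x \<otimes> y\<close> is symmetric in \<open>x\<close> and \<open>y\<close>, neighbouring factors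
  commute (\<open>pt_swap\<close>), and so do all tensors (\<open>tp_comm\<close>).  Consequently powers of \<open>\<epsilon>\<close> can be cancelled from
  either factor of a product (\<open>red_tp_left\<close>, \<open>red_tp_right\<close>), and the radical extension is associative and
  commutative (\<open>radical_mult_assoc\<close>, \<open>radical_mult_comm\<close>).

  Why subalgebras correspond to saturated sets.  Products of degrees \<open>i\<close> and \<open>j\<close> lie in degree \<open>(i + j) mod m\<close>,
  which gives one direction.  For the other, reduction is injective and no tensor power vanishes, as
  powers of \<open>\<epsilon>\<close> reduce to \<open>1\<close>; so some product of degrees \<open>i\<close> and \<open>j\<close> is not zero (\<open>closed_if_algebra\<close>).

  Why the rank divides \<open>m\<close>.  Split a word \<open>w\<close> of length \<open>m\<close> into \<open>u\<close> of length \<open>i\<close> and \<open>v\<close>.  By commutativity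
  \<open>\<phi>(w) x = \<phi>(x \<otimes> v) u\<close> for \<open>x\<close> of degree \<open>i\<close> (\<open>coord_expand\<close>).  This yields finite dual bases of the tensor
  powers, and a basis \<open>u\<close> wherever \<open>\<phi>(w)\<close> is invertible.  So the part with degrees in \<open>I\<close> is projective of
  rank \<open>card I\<close>.  If \<open>I\<close> is saturated, it consists of the multiples of some \<open>d\<close> with \<open>d * card I = m\<close>
  (\<open>saturated_multiples\<close>).

  For this \<open>d\<close>, the module \<open>Q' = Q\<^sup>\<otimes>\<^sup>d\<close> and the exponent \<open>m' = card I\<close> solve the second part, with \<open>\<phi>'\<close> the
  composition of \<open>\<phi>\<close> and the flattening \<open>Q'\<^sup>\<otimes>\<^sup>m\<^sup>' \<rightarrow> Q\<^sup>\<otimes>\<^sup>m\<close>.  Flattening respects products and reduction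
  (\<open>flatten_tp\<close>, \<open>flatten_red\<close>).  It is onto because words can be cut into pieces of length \<open>d\<close>, and it is
  injective because it is so locally, where all tensor powers are cyclic (\<open>flatten_inj\<close>).
\<close>

section \<open>Linear maps\<close>

lemma module_homI:
  assumes "\<And>x. x \<in> carrier M \<Longrightarrow> f x \<in> carrier N"
    and "\<And>x y. x \<in> carrier M \<Longrightarrow> y \<in> carrier M \<Longrightarrow> f (x \<oplus>\<^bsub>M\<^esub> y) = f x \<oplus>\<^bsub>N\<^esub> f y"
    and "\<And>r x. r \<in> carrier R \<Longrightarrow> x \<in> carrier M \<Longrightarrow> f (r \<odot>\<^bsub>M\<^esub> x) = r \<odot>\<^bsub>N\<^esub> f x"
  shows "f \<in> module_hom R M N"
  using assms by (auto simp: module_hom_def)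

lemma module_hom_closed: "f \<in> module_hom R M N \<Longrightarrow> x \<in> carrier M \<Longrightarrow> f x \<in> carrier N"
  by (auto simp: module_hom_def)

lemma module_hom_add: "f \<in> module_hom R M N \<Longrightarrow> x \<in> carrier M \<Longrightarrow> y \<in> carrier M \<Longrightarrow>
    f (x \<oplus>\<^bsub>M\<^esub> y) = f x \<oplus>\<^bsub>N\<^esub> f y"
  by (auto simp: module_hom_def)

lemma module_hom_smult: "f \<in> module_hom R M N \<Longrightarrow> r \<in> carrier R \<Longrightarrow> x \<in> carrier M \<Longrightarrow>
    f (r \<odot>\<^bsub>M\<^esub> x) = r \<odot>\<^bsub>N\<^esub> f x"
  by (auto simp: module_hom_def)

lemma module_hom_comp:
  "f \<in> module_hom R M N \<Longrightarrow> g \<in> module_hom R N K \<Longrightarrow> (\<lambda>x. g (f x)) \<in> module_hom R M K"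
  by (auto simp: module_hom_def Pi_def)

lemma module_hom_zero:
  assumes "module R M" "module R N" "f \<in> module_hom R M N"
  shows "f \<zero>\<^bsub>M\<^esub> = \<zero>\<^bsub>N\<^esub>"
proof -
  interpret M: module R M by fact
  interpret N: module R N by fact
  have "f (\<zero>\<^bsub>R\<^esub> \<odot>\<^bsub>M\<^esub> \<zero>\<^bsub>M\<^esub>) = \<zero>\<^bsub>R\<^esub> \<odot>\<^bsub>N\<^esub> f \<zero>\<^bsub>M\<^esub>"
    by (rule module_hom_smult[OF assms(3)]) simp_all
  then show ?thesis using module_hom_closed[OF assms(3)] by simp
qed

lemma module_hom_finsum:
  assumes "module R M" "module R N" "f \<in> module_hom R M N" "g \<in> A \<rightarrow> carrier M"
  shows "f (\<Oplus>\<^bsub>M\<^esub>i\<in>A. g i) = (\<Oplus>\<^bsub>N\<^esub>i\<in>A. f (g i))"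
proof -
  interpret M: module R M by fact
  interpret N: module R N by fact
  show ?thesis
  proof (cases "finite A")
    case True
    then show ?thesis using assms(4)
    proof induction
      case empty
      then show ?case using module_hom_zero[OF assms(1-3)] by simp
    next
      case (insert a A)
      then have c: "g a \<in> carrier M" "g \<in> A \<rightarrow> carrier M" "(\<lambda>i. f (g i)) \<in> A \<rightarrow> carrier N"
          "f (g a) \<in> carrier N"
        using module_hom_closed[OF assms(3)] by auto
      then show ?case
        using insert by (simp add: M.finsum_insert N.finsum_insert module_hom_add[OF assms(3)])
    qed
  next
    case False
    then show ?thesis
      using module_hom_zero[OF assms(1-3)] by (simp add: M.finsum_infinite N.finsum_infinite)
  qed
qed

lemma module_hom_minus:
  assumes "module R M" "module R N" "f \<in> module_hom R M N" "x \<in> carrier M" "y \<in> carrier M"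
  shows "f (x \<ominus>\<^bsub>M\<^esub> y) = f x \<ominus>\<^bsub>N\<^esub> f y"
proof -
  interpret M: module R M by fact
  interpret N: module R N by fact
  note h = assms(3)
  have "f (\<ominus>\<^bsub>M\<^esub> y) = f ((\<ominus>\<^bsub>R\<^esub> \<one>\<^bsub>R\<^esub>) \<odot>\<^bsub>M\<^esub> y)" using assms(5) by (simp add: M.smult_l_minus)
  also have "\<dots> = (\<ominus>\<^bsub>R\<^esub> \<one>\<^bsub>R\<^esub>) \<odot>\<^bsub>N\<^esub> f y" by (rule module_hom_smult[OF h _ assms(5)]) simp
  also have "\<dots> = \<ominus>\<^bsub>N\<^esub> f y" using module_hom_closed[OF h assms(5)] by (simp add: N.smult_l_minus)
  finally show ?thesis using assms(4,5) by (simp add: a_minus_def module_hom_add[OF h])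
qed

lemma smult_left_hom: "module R M \<Longrightarrow> r \<in> carrier R \<Longrightarrow> (\<lambda>x. r \<odot>\<^bsub>M\<^esub> x) \<in> module_hom R M M"
proof -
  assume "module R M" and r: "r \<in> carrier R"
  then interpret M: module R M by simp
  show ?thesis using r
    by (intro module_homI) (simp_all add: M.smult_r_distr M.smult_assoc1[symmetric] M.R.m_comm)
qed

lemma module_hom_sum:
  assumes "module R M" "module R N" "finite A" "\<And>i. i \<in> A \<Longrightarrow> h i \<in> module_hom R M N"
  shows "(\<lambda>x. \<Oplus>\<^bsub>N\<^esub>i\<in>A. h i x) \<in> module_hom R M N"
  using assms(3,4)
proof induction
  case empty
  interpret N: module R N by fact
  show ?case by (rule module_homI) simp_all
next
  case (insert a A)
  interpret M: module R M by fact
  interpret N: module R N by fact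
  have IH: "(\<lambda>x. \<Oplus>\<^bsub>N\<^esub>i\<in>A. h i x) \<in> module_hom R M N" and ha: "h a \<in> module_hom R M N"
    using insert by auto
  have e: "(\<Oplus>\<^bsub>N\<^esub>i\<in>insert a A. h i x) = h a x \<oplus>\<^bsub>N\<^esub> (\<Oplus>\<^bsub>N\<^esub>i\<in>A. h i x)" if "x \<in> carrier M" for x
    by (rule N.finsum_insert[OF insert.hyps Pi_I])
      (rule module_hom_closed[OF insert.prems that], simp)+
  show ?case
  proof (rule module_homI)
    fix x assume x: "x \<in> carrier M"
    note c = module_hom_closed[OF ha] module_hom_closed[OF IH]
    show "(\<Oplus>\<^bsub>N\<^esub>i\<in>insert a A. h i x) \<in> carrier N" using x c by (simp add: e)
    show "(\<Oplus>\<^bsub>N\<^esub>i\<in>insert a A. h i (x \<oplus>\<^bsub>M\<^esub> y)) =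
        (\<Oplus>\<^bsub>N\<^esub>i\<in>insert a A. h i x) \<oplus>\<^bsub>N\<^esub> (\<Oplus>\<^bsub>N\<^esub>i\<in>insert a A. h i y)" if "y \<in> carrier M" for y
      using x that c by (simp add: e module_hom_add[OF ha] module_hom_add[OF IH] N.a_ac)
    show "(\<Oplus>\<^bsub>N\<^esub>i\<in>insert a A. h i (r \<odot>\<^bsub>M\<^esub> x)) = r \<odot>\<^bsub>N\<^esub> (\<Oplus>\<^bsub>N\<^esub>i\<in>insert a A. h i x)"
      if "r \<in> carrier R" for r
      using x that c by (simp add: e module_hom_smult[OF ha] module_hom_smult[OF IH] N.smult_r_distr)
  qed
qed

text \<open>Only closure of the domain is assumed, so that the lemma applies to localizations directly.\<close>

lemma module_iso_inverse:
  assumes f: "f \<in> module_iso R M N"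
    and add: "\<And>x y. x \<in> carrier M \<Longrightarrow> y \<in> carrier M \<Longrightarrow> x \<oplus>\<^bsub>M\<^esub> y \<in> carrier M"
    and smult: "\<And>r x. r \<in> carrier R \<Longrightarrow> x \<in> carrier M \<Longrightarrow> r \<odot>\<^bsub>M\<^esub> x \<in> carrier M"
  shows "inv_into (carrier M) f \<in> module_iso R N M"
proof -
  have b: "bij_betw f (carrier M) (carrier N)" and h: "f \<in> module_hom R M N"
    using f by (auto simp: module_iso_def)
  let ?g = "inv_into (carrier M) f"
  have gc: "?g y \<in> carrier M" and fg: "f (?g y) = y" if "y \<in> carrier N" for y
    using b that by (auto simp: bij_betw_def inv_into_into f_inv_into_f)
  have gf: "?g (f x) = x" if "x \<in> carrier M" for x
    using b that by (simp add: bij_betw_def)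
  have "?g \<in> module_hom R N M"
  proof (rule module_homI)
    fix x y assume "x \<in> carrier N" "y \<in> carrier N"
    then show "?g (x \<oplus>\<^bsub>N\<^esub> y) = ?g x \<oplus>\<^bsub>M\<^esub> ?g y"
      using gf[OF add[OF gc gc]] by (simp add: module_hom_add[OF h] gc fg)
  next
    fix r x assume "r \<in> carrier R" "x \<in> carrier N"
    then show "?g (r \<odot>\<^bsub>N\<^esub> x) = r \<odot>\<^bsub>M\<^esub> ?g x"
      using gf[OF smult[OF _ gc]] by (simp add: module_hom_smult[OF h] gc fg)
  qed (rule gc)
  then show ?thesis using b by (simp add: module_iso_def bij_betw_inv_into)
qed

lemma (in abelian_monoid) finsum_Times:
  assumes "finite A" "finite B" "t \<in> A \<times> B \<rightarrow> carrier G"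
  shows "(\<Oplus>p\<in>A \<times> B. t p) = (\<Oplus>a\<in>A. \<Oplus>b\<in>B. t (a, b))"
proof -
  have "(\<Oplus>p\<in>A \<times> B. t p) = (\<Oplus>p\<in>(\<Union>a\<in>A. Pair a ` B). t p)"
    by (rule arg_cong[where f = "finsum G t"]) auto
  also have "\<dots> = (\<Oplus>a\<in>A. \<Oplus>p\<in>Pair a ` B. t p)"
    by (rule add.finprod_UN_disjoint) (use assms in \<open>auto simp: pairwise_def disjnt_def\<close>)
  also have "\<dots> = (\<Oplus>a\<in>A. \<Oplus>b\<in>B. t (a, b))"
  proof (rule finsum_cong')
    show "(\<lambda>a. \<Oplus>b\<in>B. t (a, b)) \<in> A \<rightarrow> carrier G"
      using assms by (intro Pi_I finsum_closed) auto
    fix a assume "a \<in> A"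
    then show "(\<Oplus>p\<in>Pair a ` B. t p) = (\<Oplus>b\<in>B. t (a, b))"
      using assms by (intro finsum_reindex) (auto simp: inj_on_def)
  qed simp
  finally show ?thesis .
qed

lemma submodule_zero: "module R M \<Longrightarrow> submodule H R M \<Longrightarrow> \<zero>\<^bsub>M\<^esub> \<in> H"
  using subgroup.one_closed[OF submodule.axioms(1)] by fastforce

lemma submodule_finsum:
  assumes "module R M" "submodule H R M" "g \<in> A \<rightarrow> H"
  shows "(\<Oplus>\<^bsub>M\<^esub>i\<in>A. g i) \<in> H"
proof -
  interpret M: module R M by fact
  note E = M.submoduleE[OF assms(2)]
  show ?thesis
  proof (cases "finite A")
    case True
    then show ?thesis using assms(3)
    proof induction
      case (insert a A)
      then have "g a \<in> carrier M" "g \<in> A \<rightarrow> carrier M" using E(1) by auto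
      then show ?case using insert E(5) by (simp add: M.finsum_insert)
    qed (simp add: submodule_zero[OF assms(1,2)])
  qed (simp add: M.finsum_infinite submodule_zero[OF assms(1,2)])
qed

text \<open>
  With \<open>H\<close> the zero submodule this is the kernel.  Relations between generators are checked through it: a
  linear map sends a generated submodule into \<open>H\<close> as soon as it sends the generators there.
\<close>

lemma submodule_kernel:
  assumes "module R M" "module R N" "f \<in> module_hom R M N" "submodule H R N"
  shows "submodule {x \<in> carrier M. f x \<in> H} R M"
proof -
  interpret M: module R M by fact
  interpret N: module R N by fact
  note E = N.submoduleE[OF assms(4)]
  have neg: "f (\<ominus>\<^bsub>M\<^esub> x) = \<ominus>\<^bsub>N\<^esub> f x" if "x \<in> carrier M" for x
    using module_hom_smult[OF assms(3), of "\<ominus>\<^bsub>R\<^esub> \<one>\<^bsub>R\<^esub>" x] that module_hom_closed[OF assms(3) that]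
    by (simp add: M.smult_l_minus N.smult_l_minus)
  show ?thesis
    by (rule M.submoduleI)
      (auto simp: module_hom_zero[OF assms(1-3)] submodule_zero[OF assms(2,4)] neg E
        module_hom_add[OF assms(3)] module_hom_smult[OF assms(3)])
qed

section \<open>Generated submodules and quotients\<close>

lemma generated_submodule_subset: "A \<subseteq> generated_submodule R M A"
  by (auto simp: generated_submodule_def)

lemma generated_submodule_minimal:
  "submodule H R M \<Longrightarrow> A \<subseteq> H \<Longrightarrow> generated_submodule R M A \<subseteq> H"
  by (auto simp: generated_submodule_def)

lemma submodule_generated:
  assumes "module R M" "A \<subseteq> carrier M"
  shows "submodule (generated_submodule R M A) R M"
proof -
  interpret M: module R M by fact
  show ?thesis
    unfolding generated_submodule_def
  proof (rule M.submoduleI)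
    show "\<Inter>{H. submodule H R M \<and> A \<subseteq> H} \<subseteq> carrier M"
      using M.carrier_is_submodule assms(2) by blast
  qed (auto simp: M.submoduleE submodule_zero[OF assms(1)])
qed

text \<open>A surjection that is compatible with the operations transports the module axioms.\<close>

lemma module_surjective_image:
  assumes "module R M"
    and surj: "\<pi> ` carrier M = carrier N"
    and add: "\<And>x y. x \<in> carrier M \<Longrightarrow> y \<in> carrier M \<Longrightarrow> \<pi> x \<oplus>\<^bsub>N\<^esub> \<pi> y = \<pi> (x \<oplus>\<^bsub>M\<^esub> y)"
    and smult: "\<And>r x. r \<in> carrier R \<Longrightarrow> x \<in> carrier M \<Longrightarrow> r \<odot>\<^bsub>N\<^esub> \<pi> x = \<pi> (r \<odot>\<^bsub>M\<^esub> x)"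
    and zero: "\<zero>\<^bsub>N\<^esub> = \<pi> \<zero>\<^bsub>M\<^esub>"
  shows "module R N"
proof -
  interpret M: module R M by fact
  have ex: "\<exists>x\<in>carrier M. y = \<pi> x" if "y \<in> carrier N" for y using surj that by auto
  have cl: "\<pi> x \<in> carrier N" if "x \<in> carrier M" for x using surj that by auto
  show ?thesis
  proof (rule moduleI)
    show "cring R" by (rule M.is_cring)
    show "abelian_group N"
    proof (rule abelian_groupI)
      fix x assume "x \<in> carrier N"
      then obtain a where a: "a \<in> carrier M" "x = \<pi> a" using ex by blast
      then show "\<exists>y\<in>carrier N. y \<oplus>\<^bsub>N\<^esub> x = \<zero>\<^bsub>N\<^esub>"
        using cl[of "\<ominus>\<^bsub>M\<^esub> a"] add[of "\<ominus>\<^bsub>M\<^esub> a" a] by (auto simp: zero M.l_neg)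
    qed (auto dest!: ex simp: add smult zero cl M.a_ac)
  qed (auto dest!: ex simp: add smult zero cl M.smult_l_distr M.smult_r_distr M.smult_assoc1)
qed

lemma module_cong:
  assumes "module R M" "carrier N = carrier M" "\<zero>\<^bsub>N\<^esub> = \<zero>\<^bsub>M\<^esub>"
    "\<And>x y. x \<oplus>\<^bsub>N\<^esub> y = x \<oplus>\<^bsub>M\<^esub> y" "\<And>r x. r \<odot>\<^bsub>N\<^esub> x = r \<odot>\<^bsub>M\<^esub> x"
  shows "module R N"
  by (rule module_surjective_image[OF assms(1), where \<pi> = "\<lambda>x. x"]) (simp_all add: assms(2-))

context
  fixes R :: "('r, 'z) ring_scheme" and M :: "('r, 'a) module" and N :: "'a set"
  assumes M: "module R M" and N: "submodule N R M"
begin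

interpretation M: module R M by (rule M)

lemma submodule_abelian_subgroup: "abelian_subgroup N M"
proof (rule abelian_subgroupI3)
  show "abelian_group M" ..
  show "additive_subgroup N M"
    using submodule.axioms(1)[OF N] by (simp add: additive_subgroup_def)
qed

interpretation N: abelian_subgroup N M by (rule submodule_abelian_subgroup)

lemma coset_eq_iff:
  assumes "x \<in> carrier M" "y \<in> carrier M"
  shows "N +>\<^bsub>M\<^esub> x = N +>\<^bsub>M\<^esub> y \<longleftrightarrow> x \<ominus>\<^bsub>M\<^esub> y \<in> N"
proof -
  have "x \<in> N +>\<^bsub>M\<^esub> y \<longleftrightarrow> x \<ominus>\<^bsub>M\<^esub> y \<in> N"
    using assms N.a_rcos_module by (simp add: M.minus_eq)
  then show ?thesis using assms N.a_repr_independence' N.a_rcos_self by metis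
qed

lemma coset_mem: "x \<in> carrier M \<Longrightarrow> y \<in> N +>\<^bsub>M\<^esub> x \<Longrightarrow> y \<in> carrier M \<and> N +>\<^bsub>M\<^esub> y = N +>\<^bsub>M\<^esub> x"
  using N.a_repr_independence' N.a_elemrcos_carrier by (metis N.a_rcos_self)

lemma quotient_add:
  "x \<in> carrier M \<Longrightarrow> y \<in> carrier M \<Longrightarrow>
    (N +>\<^bsub>M\<^esub> x) \<oplus>\<^bsub>quotient_module M N\<^esub> (N +>\<^bsub>M\<^esub> y) = N +>\<^bsub>M\<^esub> (x \<oplus>\<^bsub>M\<^esub> y)"
  by (simp add: quotient_module_def N.a_rcos_sum)

lemma quotient_zero: "\<zero>\<^bsub>quotient_module M N\<^esub> = N +>\<^bsub>M\<^esub> \<zero>\<^bsub>M\<^esub>"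
  using M.submoduleE(1)[OF N] by (simp add: quotient_module_def M.a_coset_add_zero)

lemma quotient_smult:
  assumes "r \<in> carrier R" "x \<in> carrier M"
  shows "r \<odot>\<^bsub>quotient_module M N\<^esub> (N +>\<^bsub>M\<^esub> x) = N +>\<^bsub>M\<^esub> (r \<odot>\<^bsub>M\<^esub> x)"
proof -
  have "N +>\<^bsub>M\<^esub> (r \<odot>\<^bsub>M\<^esub> y) = N +>\<^bsub>M\<^esub> (r \<odot>\<^bsub>M\<^esub> x)" if "y \<in> N +>\<^bsub>M\<^esub> x" for y
  proof -
    have y: "y \<in> carrier M" "y \<ominus>\<^bsub>M\<^esub> x \<in> N" using coset_mem[OF assms(2) that] coset_eq_iff assms by auto
    have "r \<odot>\<^bsub>M\<^esub> y \<ominus>\<^bsub>M\<^esub> r \<odot>\<^bsub>M\<^esub> x = r \<odot>\<^bsub>M\<^esub> (y \<ominus>\<^bsub>M\<^esub> x)"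
      using assms y by (simp add: M.minus_eq M.smult_r_distr M.smult_r_minus)
    then show ?thesis using assms y M.submoduleE(4)[OF N] by (simp add: coset_eq_iff)
  qed
  moreover have "N +>\<^bsub>M\<^esub> x \<noteq> {}" using assms N.a_rcos_self by blast
  ultimately have "(\<Union>y\<in>N +>\<^bsub>M\<^esub> x. N +>\<^bsub>M\<^esub> (r \<odot>\<^bsub>M\<^esub> y)) = N +>\<^bsub>M\<^esub> (r \<odot>\<^bsub>M\<^esub> x)"
    by (intro SUP_eq_const)
  then show ?thesis by (simp only: quotient_module_def module.simps)
qed

lemma quotient_carrier: "carrier (quotient_module M N) = (\<lambda>x. N +>\<^bsub>M\<^esub> x) ` carrier M"
  by (auto simp: quotient_module_def A_RCOSETS_def RCOSETS_def a_r_coset_def)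

lemma module_quotient: "module R (quotient_module M N)"
  by (rule module_surjective_image[OF M, where \<pi> = "\<lambda>x. N +>\<^bsub>M\<^esub> x"])
    (simp_all add: quotient_carrier quotient_add quotient_smult quotient_zero)

end

section \<open>Direct sums and free modules\<close>

lemma direct_sum_simps [simp]:
  "\<zero>\<^bsub>direct_sum J M\<^esub> = (\<lambda>i. \<zero>\<^bsub>M i\<^esub>)"
  "f \<oplus>\<^bsub>direct_sum J M\<^esub> g = (\<lambda>i. f i \<oplus>\<^bsub>M i\<^esub> g i)"
  "r \<odot>\<^bsub>direct_sum J M\<^esub> f = (\<lambda>i. r \<odot>\<^bsub>M i\<^esub> f i)"
  by (simp_all add: direct_sum_def)

lemma direct_sum_carrier:
  "f \<in> carrier (direct_sum J M) \<longleftrightarrow> (\<forall>i\<in>J. f i \<in> carrier (M i)) \<and> (\<forall>i. i \<notin> J \<longrightarrow> f i = \<zero>\<^bsub>M i\<^esub>) \<and>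
    finite {i. f i \<noteq> \<zero>\<^bsub>M i\<^esub>}"
  by (simp add: direct_sum_def)

lemma ds_inject_apply: "ds_inject M i x j = (if j = i then x else \<zero>\<^bsub>M j\<^esub>)"
  by (simp add: ds_inject_def)

lemma ds_inject_same [simp]: "ds_inject M i x i = x"
  by (simp add: ds_inject_def)

lemma support_subset:
  "(\<And>i. P i \<Longrightarrow> Q i \<Longrightarrow> S i) \<Longrightarrow> {i. \<not> S i} \<subseteq> {i. \<not> P i} \<union> {i. \<not> Q i}"
  by blast

context
  fixes R :: "('r, 'z) ring_scheme" and M :: "'i \<Rightarrow> ('r, 'a) module"
  assumes R: "cring R" and M: "\<And>i. module R (M i)"
begin

interpretation R: cring R by (rule R)
interpretation M: module R "M i" for i by (rule M)

lemma direct_sum_component: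
  assumes "f \<in> carrier (direct_sum J M)"
  shows "f i \<in> carrier (M i)"
proof (cases "i \<in> J")
  case True
  then show ?thesis using assms unfolding direct_sum_carrier by blast
next
  case False
  then have "f i = \<zero>\<^bsub>M i\<^esub>" using assms unfolding direct_sum_carrier by blast
  then show ?thesis by (simp only: M.zero_closed)
qed

lemma module_direct_sum: "module R (direct_sum J M)"
proof (rule moduleI[OF R])
  have add: "f \<oplus>\<^bsub>direct_sum J M\<^esub> g \<in> carrier (direct_sum J M)"
    if "f \<in> carrier (direct_sum J M)" "g \<in> carrier (direct_sum J M)" for f g
  proof -
    have "{i. f i \<oplus>\<^bsub>M i\<^esub> g i \<noteq> \<zero>\<^bsub>M i\<^esub>} \<subseteq> {i. f i \<noteq> \<zero>\<^bsub>M i\<^esub>} \<union> {i. g i \<noteq> \<zero>\<^bsub>M i\<^esub>}"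
      by (rule support_subset) simp
    then have "finite {i. f i \<oplus>\<^bsub>M i\<^esub> g i \<noteq> \<zero>\<^bsub>M i\<^esub>}"
      using that unfolding direct_sum_carrier by (blast intro: finite_subset)
    then show ?thesis using that by (simp add: direct_sum_carrier)
  qed
  have smult: "r \<odot>\<^bsub>direct_sum J M\<^esub> f \<in> carrier (direct_sum J M)"
    if "r \<in> carrier R" "f \<in> carrier (direct_sum J M)" for r f
  proof -
    have "{i. r \<odot>\<^bsub>M i\<^esub> f i \<noteq> \<zero>\<^bsub>M i\<^esub>} \<subseteq> {i. f i \<noteq> \<zero>\<^bsub>M i\<^esub>}"
      using that by (intro subsetI CollectI notI) simp
    then have "finite {i. r \<odot>\<^bsub>M i\<^esub> f i \<noteq> \<zero>\<^bsub>M i\<^esub>}"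
      using that unfolding direct_sum_carrier by (blast intro: finite_subset)
    then show ?thesis using that by (simp add: direct_sum_carrier)
  qed
  note c = direct_sum_component
  show "abelian_group (direct_sum J M)"
  proof (rule abelian_groupI)
    fix f assume f: "f \<in> carrier (direct_sum J M)"
    have "(\<ominus>\<^bsub>R\<^esub> \<one>\<^bsub>R\<^esub>) \<odot>\<^bsub>direct_sum J M\<^esub> f \<in> carrier (direct_sum J M)"
      by (rule smult[OF _ f]) simp
    moreover have "(\<ominus>\<^bsub>R\<^esub> \<one>\<^bsub>R\<^esub>) \<odot>\<^bsub>direct_sum J M\<^esub> f \<oplus>\<^bsub>direct_sum J M\<^esub> f = \<zero>\<^bsub>direct_sum J M\<^esub>"
      using c[OF f] by (simp add: M.smult_l_minus M.l_neg)
    ultimately show "\<exists>g\<in>carrier (direct_sum J M). g \<oplus>\<^bsub>direct_sum J M\<^esub> f = \<zero>\<^bsub>direct_sum J M\<^esub>"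
      by (intro bexI)
  next
    show "\<zero>\<^bsub>direct_sum J M\<^esub> \<in> carrier (direct_sum J M)" by (simp add: direct_sum_carrier)
  next
    fix f g assume fg: "f \<in> carrier (direct_sum J M)" "g \<in> carrier (direct_sum J M)"
    then show "f \<oplus>\<^bsub>direct_sum J M\<^esub> g \<in> carrier (direct_sum J M)" by (rule add)
    show "f \<oplus>\<^bsub>direct_sum J M\<^esub> g = g \<oplus>\<^bsub>direct_sum J M\<^esub> f"
      using c[OF fg(1)] c[OF fg(2)] by (simp add: fun_eq_iff M.a_comm)
    fix h assume h: "h \<in> carrier (direct_sum J M)"
    show "f \<oplus>\<^bsub>direct_sum J M\<^esub> g \<oplus>\<^bsub>direct_sum J M\<^esub> h =
        f \<oplus>\<^bsub>direct_sum J M\<^esub> (g \<oplus>\<^bsub>direct_sum J M\<^esub> h)"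
      using c[OF fg(1)] c[OF fg(2)] c[OF h] by (simp add: fun_eq_iff M.a_assoc)
  next
    fix f assume "f \<in> carrier (direct_sum J M)"
    from c[OF this] show "\<zero>\<^bsub>direct_sum J M\<^esub> \<oplus>\<^bsub>direct_sum J M\<^esub> f = f" by simp
  qed
  show "r \<odot>\<^bsub>direct_sum J M\<^esub> f \<in> carrier (direct_sum J M)"
    if "r \<in> carrier R" "f \<in> carrier (direct_sum J M)" for r f by (rule smult[OF that])
  fix f assume f: "f \<in> carrier (direct_sum J M)"
  show "\<one>\<^bsub>R\<^esub> \<odot>\<^bsub>direct_sum J M\<^esub> f = f" using c[OF f] by simp
  fix r assume r: "r \<in> carrier R"
  show "r \<odot>\<^bsub>direct_sum J M\<^esub> (f \<oplus>\<^bsub>direct_sum J M\<^esub> g) =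
      r \<odot>\<^bsub>direct_sum J M\<^esub> f \<oplus>\<^bsub>direct_sum J M\<^esub> r \<odot>\<^bsub>direct_sum J M\<^esub> g"
    if "g \<in> carrier (direct_sum J M)" for g
    using c[OF f] c[OF that] r by (simp add: M.smult_r_distr)
  fix t assume t: "t \<in> carrier R"
  show "(r \<oplus>\<^bsub>R\<^esub> t) \<odot>\<^bsub>direct_sum J M\<^esub> f =
      r \<odot>\<^bsub>direct_sum J M\<^esub> f \<oplus>\<^bsub>direct_sum J M\<^esub> t \<odot>\<^bsub>direct_sum J M\<^esub> f"
    using c[OF f] r t by (simp add: M.smult_l_distr)
  show "(r \<otimes>\<^bsub>R\<^esub> t) \<odot>\<^bsub>direct_sum J M\<^esub> f =
      r \<odot>\<^bsub>direct_sum J M\<^esub> (t \<odot>\<^bsub>direct_sum J M\<^esub> f)"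
    using c[OF f] r t by (simp add: M.smult_assoc1)
qed

lemma ds_inject_hom: "i \<in> J \<Longrightarrow> ds_inject M i \<in> module_hom R (M i) (direct_sum J M)"
  by (rule module_homI) (auto simp: direct_sum_carrier ds_inject_apply fun_eq_iff)

lemma ds_component_hom: "(\<lambda>f. f i) \<in> module_hom R (direct_sum J M) (M i)"
  by (rule module_homI) (auto intro: direct_sum_component)

lemma hom_into_direct_sum:
  assumes "\<And>x. x \<in> carrier K \<Longrightarrow> f x \<in> carrier (direct_sum J M)"
    and "\<And>i. (\<lambda>x. f x i) \<in> module_hom R K (M i)"
  shows "f \<in> module_hom R K (direct_sum J M)"
  by (rule module_homI[OF assms(1)])
    (simp_all add: fun_eq_iff module_hom_add[OF assms(2)] module_hom_smult[OF assms(2)])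

text \<open>
  Finite support makes every family a finite sum of homogeneous ones; the induction removes one index
  of the support at a time.
\<close>

lemma direct_sum_induct:
  assumes f: "f \<in> carrier (direct_sum J M)"
    and zero: "P (\<lambda>i. \<zero>\<^bsub>M i\<^esub>)"
    and add: "\<And>f g. f \<in> carrier (direct_sum J M) \<Longrightarrow> g \<in> carrier (direct_sum J M) \<Longrightarrow> P f \<Longrightarrow> P g \<Longrightarrow>
      P (f \<oplus>\<^bsub>direct_sum J M\<^esub> g)"
    and inject: "\<And>i x. i \<in> J \<Longrightarrow> x \<in> carrier (M i) \<Longrightarrow> P (ds_inject M i x)"
  shows "P f"
proof -
  have "P f" if "finite A" "{i. f i \<noteq> \<zero>\<^bsub>M i\<^esub>} \<subseteq> A" "f \<in> carrier (direct_sum J M)" for A f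
    using that
  proof (induction A arbitrary: f)
    case empty
    then have "f = (\<lambda>i. \<zero>\<^bsub>M i\<^esub>)" by auto
    then show ?case using zero by simp
  next
    case (insert a A)
    show ?case
    proof (cases "f a = \<zero>\<^bsub>M a\<^esub>")
      case True
      then show ?thesis using insert by auto
    next
      case False
      let ?g = "f(a := \<zero>\<^bsub>M a\<^esub>)"
      have a: "a \<in> J" using False insert.prems by (auto simp: direct_sum_carrier)
      have "{i. ?g i \<noteq> \<zero>\<^bsub>M i\<^esub>} \<subseteq> {i. f i \<noteq> \<zero>\<^bsub>M i\<^esub>}" by auto
      then have "finite {i. ?g i \<noteq> \<zero>\<^bsub>M i\<^esub>}"
        using insert.prems(2) finite_subset unfolding direct_sum_carrier by blast
      then have g: "?g \<in> carrier (direct_sum J M)"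
        using insert.prems by (auto simp: direct_sum_carrier)
      have "P ?g" using insert.prems(1) by (intro insert.IH[OF _ g]) auto
      moreover have "P (ds_inject M a (f a))"
        using insert.prems a by (intro inject) (auto simp: direct_sum_component)
      moreover have "ds_inject M a (f a) \<in> carrier (direct_sum J M)"
        by (rule module_hom_closed[OF ds_inject_hom[OF a] direct_sum_component[OF insert.prems(2)]])
      ultimately have "P (ds_inject M a (f a) \<oplus>\<^bsub>direct_sum J M\<^esub> ?g)" using g add by blast
      moreover have "ds_inject M a (f a) \<oplus>\<^bsub>direct_sum J M\<^esub> ?g = f"
        using direct_sum_component[OF insert.prems(2)] by (auto simp: ds_inject_apply fun_eq_iff)
      ultimately show ?thesis by simp
    qed
  qed
  then show ?thesis using f by (auto simp: direct_sum_carrier)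
qed

lemma ds_hom_eq:
  assumes N: "module R N" and "f \<in> module_hom R (direct_sum J M) N" "g \<in> module_hom R (direct_sum J M) N"
    and "\<And>i x. i \<in> J \<Longrightarrow> x \<in> carrier (M i) \<Longrightarrow> f (ds_inject M i x) = g (ds_inject M i x)"
    and "z \<in> carrier (direct_sum J M)"
  shows "f z = g z"
proof (rule direct_sum_induct[OF assms(5)])
  show "f (\<lambda>i. \<zero>\<^bsub>M i\<^esub>) = g (\<lambda>i. \<zero>\<^bsub>M i\<^esub>)"
    using module_hom_zero[OF module_direct_sum N assms(2)]
      module_hom_zero[OF module_direct_sum N assms(3)] by simp
next
  fix x y assume "x \<in> carrier (direct_sum J M)" "y \<in> carrier (direct_sum J M)" "f x = g x" "f y = g y"
  then show "f (x \<oplus>\<^bsub>direct_sum J M\<^esub> y) = g (x \<oplus>\<^bsub>direct_sum J M\<^esub> y)"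
    by (simp only: module_hom_add[OF assms(2)] module_hom_add[OF assms(3)])
qed (rule assms(4))

text \<open>
  Both sides are linear in \<open>x\<close>, so that homogeneous families suffice, and for these at most one summand
  is not zero.
\<close>

lemma direct_sum_expand:
  assumes J: "finite J" and x: "x \<in> carrier (direct_sum J M)"
  shows "(\<Oplus>\<^bsub>direct_sum J M\<^esub>i\<in>J. ds_inject M i (x i)) = x"
proof (rule ds_hom_eq[OF module_direct_sum _ _ _ x])
  interpret D: module R "direct_sum J M" by (rule module_direct_sum)
  show "(\<lambda>x. \<Oplus>\<^bsub>direct_sum J M\<^esub>i\<in>J. ds_inject M i (x i)) \<in> module_hom R (direct_sum J M) (direct_sum J M)"
    by (rule module_hom_sum[OF module_direct_sum module_direct_sum J])
      (rule module_hom_comp[OF ds_component_hom ds_inject_hom])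
  show "(\<lambda>x. x) \<in> module_hom R (direct_sum J M) (direct_sum J M)" by (simp add: module_hom_def)
  fix j a assume j: "j \<in> J" and a: "a \<in> carrier (M j)"
  have ja: "ds_inject M j a \<in> carrier (direct_sum J M)" by (rule module_hom_closed[OF ds_inject_hom[OF j] a])
  have "(\<Oplus>\<^bsub>direct_sum J M\<^esub>i\<in>J. ds_inject M i (ds_inject M j a i)) =
      (\<Oplus>\<^bsub>direct_sum J M\<^esub>i\<in>J. if j = i then ds_inject M j a else \<zero>\<^bsub>direct_sum J M\<^esub>)"
  proof (rule D.finsum_cong')
    show "ds_inject M i (ds_inject M j a i) = (if j = i then ds_inject M j a else \<zero>\<^bsub>direct_sum J M\<^esub>)" for i
      by (simp add: ds_inject_apply fun_eq_iff)
  next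
    show "(\<lambda>i. if j = i then ds_inject M j a else \<zero>\<^bsub>direct_sum J M\<^esub>) \<in> J \<rightarrow> carrier (direct_sum J M)"
      by (rule Pi_I) (simp only: ja D.zero_closed split: if_split, simp)
  qed (rule refl)
  also have "\<dots> = ds_inject M j a" by (rule D.finsum_singleton[OF j J Pi_I]) (rule ja)
  finally show "(\<Oplus>\<^bsub>direct_sum J M\<^esub>i\<in>J. ds_inject M i (ds_inject M j a i)) = ds_inject M j a" .
qed

end

text \<open>The linear map out of a direct sum that is given by linear maps on the summands.\<close>

definition ds_lift ::
  "('i \<Rightarrow> ('r, 'a) module) \<Rightarrow> ('r, 'b, 'y) module_scheme \<Rightarrow> ('i \<Rightarrow> 'a \<Rightarrow> 'b) \<Rightarrow> ('i \<Rightarrow> 'a) \<Rightarrow> 'b" where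
  "ds_lift M N h f = (\<Oplus>\<^bsub>N\<^esub>i\<in>{i. f i \<noteq> \<zero>\<^bsub>M i\<^esub>}. h i (f i))"

context
  fixes R :: "('r, 'z) ring_scheme" and M :: "'i \<Rightarrow> ('r, 'a) module" and J :: "'i set"
    and N :: "('r, 'b, 'y) module_scheme" and h :: "'i \<Rightarrow> 'a \<Rightarrow> 'b"
  assumes R: "cring R" and M: "\<And>i. module R (M i)" and N: "module R N"
    and h: "\<And>i. i \<in> J \<Longrightarrow> h i \<in> module_hom R (M i) N"
begin

interpretation N: module R N by (rule N)

lemma ds_lift_term_closed:
  "f \<in> carrier (direct_sum J M) \<Longrightarrow> A \<subseteq> J \<Longrightarrow> (\<lambda>i. h i (f i)) \<in> A \<rightarrow> carrier N"
  using direct_sum_component[where M = M, OF R M] module_hom_closed[OF h] by blast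

text \<open>
  The defining sum runs over the support of \<open>f\<close>, which changes with \<open>f\<close>; for comparing the values at
  different families it has to run over a common finite set.
\<close>

lemma ds_lift_superset:
  assumes f: "f \<in> carrier (direct_sum J M)" and A: "finite A" "A \<subseteq> J" "{i. f i \<noteq> \<zero>\<^bsub>M i\<^esub>} \<subseteq> A"
  shows "ds_lift M N h f = (\<Oplus>\<^bsub>N\<^esub>i\<in>A. h i (f i))"
proof -
  have "h i (f i) = \<zero>\<^bsub>N\<^esub>" if i: "i \<in> A - {i. f i \<noteq> \<zero>\<^bsub>M i\<^esub>}" for i
  proof -
    have "i \<in> J" "f i = \<zero>\<^bsub>M i\<^esub>" using i A by auto
    then show ?thesis using module_hom_zero[OF M N h] by simp
  qed
  then show ?thesis
    unfolding ds_lift_def using A ds_lift_term_closed[OF f]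
    by (intro N.add.finprod_mono_neutral_cong_left) auto
qed

lemma ds_lift_hom: "ds_lift M N h \<in> module_hom R (direct_sum J M) N"
proof (rule module_homI)
  interpret D: module R "direct_sum J M" by (rule module_direct_sum[OF R M])
  let ?S = "\<lambda>f. {i. f i \<noteq> \<zero>\<^bsub>M i\<^esub>}"
  have S: "finite (?S f)" "?S f \<subseteq> J" if "f \<in> carrier (direct_sum J M)" for f
    using that by (auto simp: direct_sum_carrier)
  note t = ds_lift_term_closed and c = direct_sum_component[where M = M, OF R M]
  show "ds_lift M N h f \<in> carrier N" if f: "f \<in> carrier (direct_sum J M)" for f
    unfolding ds_lift_def using t[OF f S(2)[OF f]] by (rule N.finsum_closed)
  show "ds_lift M N h (f \<oplus>\<^bsub>direct_sum J M\<^esub> g) = ds_lift M N h f \<oplus>\<^bsub>N\<^esub> ds_lift M N h g"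
    if f: "f \<in> carrier (direct_sum J M)" and g: "g \<in> carrier (direct_sum J M)" for f g
  proof -
    let ?fg = "f \<oplus>\<^bsub>direct_sum J M\<^esub> g" and ?A = "?S f \<union> ?S g \<union> ?S (f \<oplus>\<^bsub>direct_sum J M\<^esub> g)"
    have fg: "?fg \<in> carrier (direct_sum J M)" using f g by (rule D.a_closed)
    have A: "finite ?A" "?A \<subseteq> J" using S[OF f] S[OF g] S[OF fg] by auto
    have "ds_lift M N h ?fg = (\<Oplus>\<^bsub>N\<^esub>i\<in>?A. h i (?fg i))"
      by (rule ds_lift_superset[OF fg A]) auto
    also have "\<dots> = (\<Oplus>\<^bsub>N\<^esub>i\<in>?A. h i (f i) \<oplus>\<^bsub>N\<^esub> h i (g i))"
    proof (rule N.finsum_cong')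
      fix i assume "i \<in> ?A"
      then have "i \<in> J" using A by blast
      then show "h i (?fg i) = h i (f i) \<oplus>\<^bsub>N\<^esub> h i (g i)"
        using module_hom_add[OF h] c[OF f] c[OF g] by simp
    qed (use t[OF f A(2)] t[OF g A(2)] in auto)
    also have "\<dots> = (\<Oplus>\<^bsub>N\<^esub>i\<in>?A. h i (f i)) \<oplus>\<^bsub>N\<^esub> (\<Oplus>\<^bsub>N\<^esub>i\<in>?A. h i (g i))"
      using t[OF f A(2)] t[OF g A(2)] by (intro N.finsum_addf)
    also have "(\<Oplus>\<^bsub>N\<^esub>i\<in>?A. h i (f i)) = ds_lift M N h f"
      by (rule ds_lift_superset[OF f A, symmetric]) auto
    also have "(\<Oplus>\<^bsub>N\<^esub>i\<in>?A. h i (g i)) = ds_lift M N h g"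
      by (rule ds_lift_superset[OF g A, symmetric]) auto
    finally show ?thesis .
  qed
  show "ds_lift M N h (r \<odot>\<^bsub>direct_sum J M\<^esub> f) = r \<odot>\<^bsub>N\<^esub> ds_lift M N h f"
    if r: "r \<in> carrier R" and f: "f \<in> carrier (direct_sum J M)" for r f
  proof -
    let ?rf = "r \<odot>\<^bsub>direct_sum J M\<^esub> f" and ?A = "?S f \<union> ?S (r \<odot>\<^bsub>direct_sum J M\<^esub> f)"
    have rf: "?rf \<in> carrier (direct_sum J M)" using r f by (rule D.smult_closed)
    have A: "finite ?A" "?A \<subseteq> J" using S[OF f] S[OF rf] by auto
    have "ds_lift M N h ?rf = (\<Oplus>\<^bsub>N\<^esub>i\<in>?A. h i (?rf i))"
      by (rule ds_lift_superset[OF rf A]) auto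
    also have "\<dots> = (\<Oplus>\<^bsub>N\<^esub>i\<in>?A. r \<odot>\<^bsub>N\<^esub> h i (f i))"
    proof (rule N.finsum_cong')
      fix i assume "i \<in> ?A"
      then have "i \<in> J" using A by blast
      then show "h i (?rf i) = r \<odot>\<^bsub>N\<^esub> h i (f i)"
        using module_hom_smult[OF h r c[OF f]] by simp
    qed (use t[OF f A(2)] r in auto)
    also have "\<dots> = r \<odot>\<^bsub>N\<^esub> (\<Oplus>\<^bsub>N\<^esub>i\<in>?A. h i (f i))"
      using A(1) r t[OF f A(2)] by (rule N.finsum_smult_ldistr[symmetric])
    also have "(\<Oplus>\<^bsub>N\<^esub>i\<in>?A. h i (f i)) = ds_lift M N h f"
      by (rule ds_lift_superset[OF f A, symmetric]) auto
    finally show ?thesis .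
  qed
qed

lemma ds_lift_inject:
  assumes i: "i \<in> J" and x: "x \<in> carrier (M i)"
  shows "ds_lift M N h (ds_inject M i x) = h i x"
proof -
  have "ds_lift M N h (ds_inject M i x) = (\<Oplus>\<^bsub>N\<^esub>j\<in>{i}. h j (ds_inject M i x j))"
    by (rule ds_lift_superset[OF module_hom_closed[OF ds_inject_hom[where M = M, OF R M i] x]])
      (use i in \<open>auto simp: ds_inject_apply\<close>)
  also have "\<dots> = h i x" using module_hom_closed[OF h[OF i] x] by simp
  finally show ?thesis .
qed

end

lemma ring_module_simps [simp]:
  "carrier (ring_module R) = carrier R" "\<zero>\<^bsub>ring_module R\<^esub> = \<zero>\<^bsub>R\<^esub>" "\<one>\<^bsub>ring_module R\<^esub> = \<one>\<^bsub>R\<^esub>"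
  "x \<oplus>\<^bsub>ring_module R\<^esub> y = x \<oplus>\<^bsub>R\<^esub> y" "x \<odot>\<^bsub>ring_module R\<^esub> y = x \<otimes>\<^bsub>R\<^esub> y"
  by (simp_all add: ring_module_def)

lemma module_ring_module:
  assumes "cring R"
  shows "module R (ring_module R)"
proof -
  interpret cring R by fact
  show ?thesis
  proof (rule moduleI)
    show "abelian_group (ring_module R)"
      by (rule abelian_groupI) (auto simp: a_ac intro: l_neg)
  qed (auto simp: assms l_distr r_distr m_assoc)
qed

lemma finsum_ring_module: "finsum (ring_module R) f A = finsum R f A"
  by (simp add: finsum_def finprod_def ring_module_def)

lemma smult_right_hom:
  assumes "module R M" "x \<in> carrier M"
  shows "(\<lambda>r. r \<odot>\<^bsub>M\<^esub> x) \<in> module_hom R (ring_module R) M"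
proof -
  interpret M: module R M by fact
  show ?thesis using assms(2) by (intro module_homI) (simp_all add: M.smult_l_distr M.smult_assoc1)
qed

lemma finsum_smult_left:
  assumes "module R M" "x \<in> carrier M" "s \<in> A \<rightarrow> carrier R"
  shows "(\<Oplus>\<^bsub>R\<^esub>k\<in>A. s k) \<odot>\<^bsub>M\<^esub> x = (\<Oplus>\<^bsub>M\<^esub>k\<in>A. s k \<odot>\<^bsub>M\<^esub> x)"
proof -
  interpret M: module R M by fact
  from module_hom_finsum[OF module_ring_module[OF M.is_cring] assms(1) smult_right_hom[OF assms(1,2)], of s A]
  show ?thesis using assms(3) by (simp add: finsum_ring_module)
qed

lemma free_module_simps:
  "f \<in> carrier (free_module R X) \<longleftrightarrow>
    (\<forall>x\<in>X. f x \<in> carrier R) \<and> (\<forall>x. x \<notin> X \<longrightarrow> f x = \<zero>\<^bsub>R\<^esub>) \<and> finite {x. f x \<noteq> \<zero>\<^bsub>R\<^esub>}"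
  "f \<oplus>\<^bsub>free_module R X\<^esub> g = (\<lambda>x. f x \<oplus>\<^bsub>R\<^esub> g x)"
  "r \<odot>\<^bsub>free_module R X\<^esub> f = (\<lambda>x. r \<otimes>\<^bsub>R\<^esub> f x)"
  "\<zero>\<^bsub>free_module R X\<^esub> = (\<lambda>x. \<zero>\<^bsub>R\<^esub>)"
  by (simp_all add: free_module_def direct_sum_carrier)

text \<open>
  The case of \<open>ds_lift\<close> in which all summands are \<open>R\<close>: the evaluation of a formal linear combination.
  It is the sum in the definition of \<open>tensor_lift\<close>.
\<close>

definition free_lift ::
  "('r, 'z) ring_scheme \<Rightarrow> ('r, 'b, 'y) module_scheme \<Rightarrow> ('x \<Rightarrow> 'b) \<Rightarrow> ('x \<Rightarrow> 'r) \<Rightarrow> 'b" where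
  "free_lift R N g p = (\<Oplus>\<^bsub>N\<^esub>w\<in>{w. p w \<noteq> \<zero>\<^bsub>R\<^esub>}. p w \<odot>\<^bsub>N\<^esub> g w)"

context
  fixes R :: "('r, 'z) ring_scheme" and X :: "'x set"
  assumes R: "cring R"
begin

interpretation R: cring R by (rule R)

lemma module_free: "module R (free_module R X)"
  unfolding free_module_def by (rule module_direct_sum[OF R module_ring_module[OF R]])

lemma free_module_component: "p \<in> carrier (free_module R X) \<Longrightarrow> p w \<in> carrier R"
  by (cases "w \<in> X") (auto simp: free_module_simps)

lemma free_gen_closed: "x \<in> X \<Longrightarrow> free_gen R x \<in> carrier (free_module R X)"
  by (auto simp: free_module_simps free_gen_def)

lemma free_module_induct:
  assumes f: "f \<in> carrier (free_module R X)"
    and "P \<zero>\<^bsub>free_module R X\<^esub>"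
    and "\<And>f g. f \<in> carrier (free_module R X) \<Longrightarrow> g \<in> carrier (free_module R X) \<Longrightarrow> P f \<Longrightarrow> P g \<Longrightarrow>
      P (f \<oplus>\<^bsub>free_module R X\<^esub> g)"
    and gen: "\<And>r x. r \<in> carrier R \<Longrightarrow> x \<in> X \<Longrightarrow> P (r \<odot>\<^bsub>free_module R X\<^esub> free_gen R x)"
  shows "P f"
proof (rule direct_sum_induct[OF R module_ring_module[OF R] f[unfolded free_module_def]])
  show "P (ds_inject (\<lambda>_. ring_module R) x r)" if "x \<in> X" "r \<in> carrier (ring_module R)" for x r
  proof -
    have "ds_inject (\<lambda>_. ring_module R) x r = r \<odot>\<^bsub>free_module R X\<^esub> free_gen R x"
      using that by (auto simp: fun_eq_iff ds_inject_apply free_module_simps free_gen_def)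
    then show ?thesis using gen that by simp
  qed
qed (use assms in \<open>simp_all add: free_module_def\<close>)

context
  fixes N :: "('r, 'b, 'y) module_scheme" and g :: "'x \<Rightarrow> 'b"
  assumes N: "module R N" and g: "g \<in> X \<rightarrow> carrier N"
begin

interpretation N: module R N by (rule N)

lemma free_lift_ds_lift: "free_lift R N g = ds_lift (\<lambda>_. ring_module R) N (\<lambda>w r. r \<odot>\<^bsub>N\<^esub> g w)"
  by (simp add: fun_eq_iff free_lift_def ds_lift_def)

lemma free_lift_summand_hom: "w \<in> X \<Longrightarrow> (\<lambda>r. r \<odot>\<^bsub>N\<^esub> g w) \<in> module_hom R (ring_module R) N"
  using g by (intro smult_right_hom[OF N]) auto

lemma free_lift_hom: "free_lift R N g \<in> module_hom R (free_module R X) N"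
  unfolding free_lift_ds_lift free_module_def
  by (rule ds_lift_hom[OF R module_ring_module[OF R] N free_lift_summand_hom])

lemma free_lift_gen:
  assumes "x \<in> X"
  shows "free_lift R N g (free_gen R x) = g x"
proof -
  have "free_gen R x = ds_inject (\<lambda>_. ring_module R) x \<one>\<^bsub>R\<^esub>"
    by (simp add: fun_eq_iff ds_inject_apply free_gen_def)
  then show ?thesis
    using ds_lift_inject[OF R module_ring_module[OF R] N free_lift_summand_hom assms, where x = "\<one>\<^bsub>R\<^esub>"] assms g
    by (auto simp: free_lift_ds_lift Pi_def)
qed

end
end

section \<open>Vanishing can be tested locally\<close>

text \<open>
  If the \<open>s k\<close> generate the unit ideal, an element killed by a power of each \<open>s k\<close> is zero.  Instead
  of taking a large power of \<open>\<Sum>k. s k = 1\<close>, the exponents are lowered to one index by index: if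
  \<open>s j\<^sup>n\<^sup>+\<^sup>1 x = 0\<close>, then the statement applies to \<open>s j\<^sup>n x\<close>.
\<close>

lemma zero_if_locally_zero:
  fixes R (structure) and M (structure)
  assumes "module R M" "finite K" "s \<in> K \<rightarrow> carrier R" "(\<Oplus>\<^bsub>R\<^esub>k\<in>K. s k) = \<one>\<^bsub>R\<^esub>"
    and "x \<in> carrier M" "\<And>k. k \<in> K \<Longrightarrow> \<exists>n::nat. (s k [^]\<^bsub>R\<^esub> n) \<odot>\<^bsub>M\<^esub> x = \<zero>\<^bsub>M\<^esub>"
  shows "x = \<zero>\<^bsub>M\<^esub>"
proof -
  interpret M: module R M by fact
  have "x = \<zero>\<^bsub>M\<^esub>" if "finite A" "A \<subseteq> K" "x \<in> carrier M"
    "\<And>k. k \<in> A \<Longrightarrow> \<exists>n::nat. (s k [^]\<^bsub>R\<^esub> n) \<odot>\<^bsub>M\<^esub> x = \<zero>\<^bsub>M\<^esub>"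
    "\<And>k. k \<in> K - A \<Longrightarrow> s k \<odot>\<^bsub>M\<^esub> x = \<zero>\<^bsub>M\<^esub>" for A x
    using that
  proof (induction A arbitrary: x)
    case empty
    have "x = (\<Oplus>\<^bsub>R\<^esub>k\<in>K. s k) \<odot>\<^bsub>M\<^esub> x" using empty assms(4) by simp
    also have "\<dots> = (\<Oplus>\<^bsub>M\<^esub>k\<in>K. s k \<odot>\<^bsub>M\<^esub> x)" by (rule finsum_smult_left[OF assms(1) empty(2) assms(3)])
    also have "\<dots> = \<zero>\<^bsub>M\<^esub>" using empty(4) by (intro M.add.finprod_one_eqI) simp
    finally show ?case .
  next
    case (insert a A)
    have sa: "s a \<in> carrier R" and sK: "\<And>k. k \<in> K \<Longrightarrow> s k \<in> carrier R"
      using insert.prems assms(3) by auto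
    have comm: "r \<odot>\<^bsub>M\<^esub> (t \<odot>\<^bsub>M\<^esub> x) = t \<odot>\<^bsub>M\<^esub> (r \<odot>\<^bsub>M\<^esub> x)" if "r \<in> carrier R" "t \<in> carrier R" for r t
      using that insert.prems(2) by (metis M.R.m_comm M.smult_assoc1)
    \<comment> \<open>the exponent of \<open>s a\<close> goes down by one: the induction hypothesis applies to \<open>(s a)\<^sup>n x\<close>\<close>
    have step: "(s a [^]\<^bsub>R\<^esub> n) \<odot>\<^bsub>M\<^esub> x = \<zero>\<^bsub>M\<^esub>" if z: "(s a [^]\<^bsub>R\<^esub> Suc n) \<odot>\<^bsub>M\<^esub> x = \<zero>\<^bsub>M\<^esub>" for n :: nat
    proof (rule insert.IH)
      let ?y = "(s a [^]\<^bsub>R\<^esub> n) \<odot>\<^bsub>M\<^esub> x"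
      show "?y \<in> carrier M" using sa insert.prems by simp
      show "\<exists>l::nat. (s k [^]\<^bsub>R\<^esub> l) \<odot>\<^bsub>M\<^esub> ?y = \<zero>\<^bsub>M\<^esub>" if k: "k \<in> A" for k
      proof -
        obtain l :: nat where l: "(s k [^]\<^bsub>R\<^esub> l) \<odot>\<^bsub>M\<^esub> x = \<zero>\<^bsub>M\<^esub>"
          using insert.prems(3)[OF insertI2[OF k]] by (rule exE)
        have "s k \<in> carrier R" using sK insert.prems(1) k by blast
        then have "(s k [^]\<^bsub>R\<^esub> l) \<odot>\<^bsub>M\<^esub> ?y = \<zero>\<^bsub>M\<^esub>"
          using comm[of "s k [^]\<^bsub>R\<^esub> l" "s a [^]\<^bsub>R\<^esub> n"] sa l by simp
        then show ?thesis ..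
      qed
      show "s k \<odot>\<^bsub>M\<^esub> ?y = \<zero>\<^bsub>M\<^esub>" if "k \<in> K - A" for k
      proof (cases "k = a")
        case True
        have "s a \<odot>\<^bsub>M\<^esub> ?y = (s a [^]\<^bsub>R\<^esub> Suc n) \<odot>\<^bsub>M\<^esub> x"
          using sa insert.prems(2) by (simp add: M.smult_assoc1[symmetric] M.R.m_comm)
        then show ?thesis using z True by simp
      next
        case False
        then have "s k \<odot>\<^bsub>M\<^esub> x = \<zero>\<^bsub>M\<^esub>" using that insert.prems(4) by blast
        then show ?thesis using comm[of "s k" "s a [^]\<^bsub>R\<^esub> n"] sa sK that by simp
      qed
    qed (use insert.prems in auto)
    obtain n :: nat where "(s a [^]\<^bsub>R\<^esub> n) \<odot>\<^bsub>M\<^esub> x = \<zero>\<^bsub>M\<^esub>"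
      using insert.prems(3)[OF insertI1] by (rule exE)
    then have "(s a [^]\<^bsub>R\<^esub> (0::nat)) \<odot>\<^bsub>M\<^esub> x = \<zero>\<^bsub>M\<^esub>" 
    proof (induction n)
      case (Suc n)
      then show ?case using step by metis
    qed
    then show ?case using insert.prems(2) by simp
  qed
  from this[of K] show ?thesis using assms by auto
qed

section \<open>Dual bases\<close>

text \<open>
  The coordinates embed \<open>M\<close> into a free module on the generators \<open>a k\<close>, split by the evaluation of
  formal linear combinations.  The generators need not be distinct: the coordinate vector is a sum of
  multiples of basis elements, and the coordinates of coinciding generators add up in it.
\<close>

lemma fg_projective_dual_basis:
  fixes M :: "('r, 'a, 'x) module_scheme"
  assumes M: "module R M" and K: "finite K" and a: "a \<in> K \<rightarrow> carrier M"
    and f: "\<And>k. k \<in> K \<Longrightarrow> f k \<in> module_hom R M (ring_module R)"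
    and dual: "\<And>x. x \<in> carrier M \<Longrightarrow> x = (\<Oplus>\<^bsub>M\<^esub>k\<in>K. f k x \<odot>\<^bsub>M\<^esub> a k)"
  shows "fg_projective R M"
proof -
  interpret M: module R M by fact
  have fc: "f k x \<in> carrier R" if "k \<in> K" "x \<in> carrier M" for k x
    using module_hom_closed[OF f] that by simp
  have "finitely_generated R M"
    unfolding finitely_generated_def
  proof (intro exI conjI)
    let ?G = "generated_submodule R M (a ` K)"
    show "a ` K \<subseteq> carrier M" using a by auto
    then have G: "submodule ?G R M" by (rule submodule_generated[OF M])
    have "x \<in> ?G" if "x \<in> carrier M" for x
    proof -
      have "a k \<in> ?G" if "k \<in> K" for k using generated_submodule_subset that by fastforce
      then have "(\<Oplus>\<^bsub>M\<^esub>k\<in>K. f k x \<odot>\<^bsub>M\<^esub> a k) \<in> ?G"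
        using fc that by (intro submodule_finsum[OF M G]) (auto intro: M.submoduleE(4)[OF G])
      then show ?thesis using dual[OF that] by simp
    qed
    then show "?G = carrier M" using M.submoduleE(1)[OF G] by auto
  qed (use K in simp)
  moreover have "projective_module R M"
    unfolding projective_module_def
  proof (intro exI conjI ballI)
    let ?F = "free_module R (a ` K)"
    interpret F: module R ?F by (rule module_free[OF M.is_cring])
    let ?\<iota> = "\<lambda>x. \<Oplus>\<^bsub>?F\<^esub>k\<in>K. f k x \<odot>\<^bsub>?F\<^esub> free_gen R (a k)"
    let ?\<pi> = "free_lift R M (\<lambda>y. y)"
    have id: "(\<lambda>y. y) \<in> a ` K \<rightarrow> carrier M" using a by auto
    note \<pi> = free_lift_hom[OF M.is_cring M id]
    have gen: "free_gen R (a k) \<in> carrier ?F" if "k \<in> K" for k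
      using that by (intro free_gen_closed[OF M.is_cring]) simp
    show "?\<iota> \<in> module_hom R M ?F"
      by (intro module_hom_sum[OF M F.module_axioms K] module_hom_comp[OF f] smult_right_hom[OF F.module_axioms] gen)
    show "?\<pi> \<in> module_hom R ?F M" by (rule \<pi>)
    fix x assume x: "x \<in> carrier M"
    have t: "(\<lambda>k. f k x \<odot>\<^bsub>?F\<^esub> free_gen R (a k)) \<in> K \<rightarrow> carrier ?F" using gen fc x by auto
    have "?\<pi> (?\<iota> x) = (\<Oplus>\<^bsub>M\<^esub>k\<in>K. ?\<pi> (f k x \<odot>\<^bsub>?F\<^esub> free_gen R (a k)))"
      by (rule module_hom_finsum[OF F.module_axioms M \<pi> t])
    also have "\<dots> = (\<Oplus>\<^bsub>M\<^esub>k\<in>K. f k x \<odot>\<^bsub>M\<^esub> a k)"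
    proof (rule M.finsum_cong')
      fix k assume k: "k \<in> K"
      show "?\<pi> (f k x \<odot>\<^bsub>?F\<^esub> free_gen R (a k)) = f k x \<odot>\<^bsub>M\<^esub> a k"
        using k free_lift_gen[OF M.is_cring M id] by (simp add: module_hom_smult[OF \<pi> fc[OF k x] gen[OF k]])
    qed (use a fc x in auto)
    finally show "?\<pi> (?\<iota> x) = x" using dual[OF x] by simp
  qed
  ultimately show ?thesis using M by (simp add: fg_projective_def)
qed

section \<open>Localization and rank\<close>

context
  fixes R :: "('r, 'z) ring_scheme" (structure) and S :: "'r set"
  assumes R: "cring R" and S: "S \<subseteq> carrier R" "\<one> \<in> S"
    "\<And>s t. s \<in> S \<Longrightarrow> t \<in> S \<Longrightarrow> s \<otimes> t \<in> S"
begin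

interpretation R: cring R by (rule R)

lemma S_carrier: "s \<in> S \<Longrightarrow> s \<in> carrier R"
  using S(1) by blast

context
  fixes M :: "('r, 'a, 'x) module_scheme"
  assumes M: "module R M"
begin

interpretation M: module R M by (rule M)

lemma loc_rel_iff: "((x, s), (y, t)) \<in> loc_rel R S M \<longleftrightarrow>
    x \<in> carrier M \<and> y \<in> carrier M \<and> s \<in> S \<and> t \<in> S \<and>
    (\<exists>u\<in>S. (u \<otimes> t) \<odot>\<^bsub>M\<^esub> x = (u \<otimes> s) \<odot>\<^bsub>M\<^esub> y)"
proof -
  have "u \<odot>\<^bsub>M\<^esub> (t \<odot>\<^bsub>M\<^esub> x) = (u \<otimes> t) \<odot>\<^bsub>M\<^esub> x" if "u \<in> S" "t \<in> S" "x \<in> carrier M" for u t x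
    using that S_carrier by (simp add: M.smult_assoc1)
  then show ?thesis unfolding loc_rel_def by (auto 0 3)
qed

lemma equiv_loc_rel: "equiv (carrier M \<times> S) (loc_rel R S M)"
proof (rule equivI)
  show "loc_rel R S M \<subseteq> (carrier M \<times> S) \<times> (carrier M \<times> S)"
    by (auto simp: loc_rel_def)
  show "refl_on (carrier M \<times> S) (loc_rel R S M)"
    using S(2) by (auto simp: refl_on_def loc_rel_def)
  show "sym (loc_rel R S M)"
  proof (rule symI)
    fix p q assume "(p, q) \<in> loc_rel R S M"
    then show "(q, p) \<in> loc_rel R S M"
      by (cases p, cases q) (simp add: loc_rel_iff, metis)
  qed
  show "trans (loc_rel R S M)"
  proof (rule transI)
    fix p q r assume pq: "(p, q) \<in> loc_rel R S M" and qr: "(q, r) \<in> loc_rel R S M"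
    obtain x s y t z w where pqr: "p = (x, s)" "q = (y, t)" "r = (z, w)" by (metis surj_pair)
    obtain u where u: "u \<in> S" "(u \<otimes> t) \<odot>\<^bsub>M\<^esub> x = (u \<otimes> s) \<odot>\<^bsub>M\<^esub> y"
      and c: "x \<in> carrier M" "y \<in> carrier M" "s \<in> S" "t \<in> S"
      using pq unfolding pqr loc_rel_iff by (elim conjE bexE)
    obtain v where v: "v \<in> S" "(v \<otimes> w) \<odot>\<^bsub>M\<^esub> y = (v \<otimes> t) \<odot>\<^bsub>M\<^esub> z"
      and d: "z \<in> carrier M" "w \<in> S"
      using qr unfolding pqr loc_rel_iff by (elim conjE bexE)
    note k = u(1)[THEN S_carrier] v(1)[THEN S_carrier] c(3,4)[THEN S_carrier] d(2)[THEN S_carrier]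
    have "((u \<otimes> v \<otimes> t) \<otimes> w) \<odot>\<^bsub>M\<^esub> x = (v \<otimes> w) \<odot>\<^bsub>M\<^esub> ((u \<otimes> t) \<odot>\<^bsub>M\<^esub> x)"
      using k c d by (simp add: M.smult_assoc1[symmetric] R.m_ac)
    also have "\<dots> = (u \<otimes> s) \<odot>\<^bsub>M\<^esub> ((v \<otimes> w) \<odot>\<^bsub>M\<^esub> y)"
      unfolding u(2) using k c d by (simp add: M.smult_assoc1[symmetric] R.m_ac)
    also have "\<dots> = ((u \<otimes> v \<otimes> t) \<otimes> s) \<odot>\<^bsub>M\<^esub> z"
      unfolding v(2) using k c d by (simp add: M.smult_assoc1[symmetric] R.m_ac)
    finally show "(p, r) \<in> loc_rel R S M"
      unfolding pqr loc_rel_iff using c d S(3)[OF S(3)[OF u(1) v(1)] c(4)]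
      by (intro conjI bexI)
  qed
qed

lemma loc_frac_eq_iff:
  assumes "x \<in> carrier M" "y \<in> carrier M" "s \<in> S" "t \<in> S"
  shows "loc_frac R S M x s = loc_frac R S M y t \<longleftrightarrow>
    (\<exists>u\<in>S. (u \<otimes> t) \<odot>\<^bsub>M\<^esub> x = (u \<otimes> s) \<odot>\<^bsub>M\<^esub> y)"
  unfolding loc_frac_def using assms
  by (subst eq_equiv_class_iff[OF equiv_loc_rel]) (simp_all add: loc_rel_iff)

text \<open>
  Equality after cross-multiplication, without a further factor from \<open>S\<close>, covers the formal
  manipulations of fractions.
\<close>

lemma loc_frac_eqI:
  assumes "x \<in> carrier M" "y \<in> carrier M" "s \<in> S" "t \<in> S" "t \<odot>\<^bsub>M\<^esub> x = s \<odot>\<^bsub>M\<^esub> y"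
  shows "loc_frac R S M x s = loc_frac R S M y t"
  unfolding loc_frac_eq_iff[OF assms(1-4)]
  using S(2) assms S_carrier by (intro bexI[of _ "\<one>"]) simp_all

lemma loc_module_carrier:
  "X \<in> carrier (loc_module R S M) \<longleftrightarrow> (\<exists>x s. x \<in> carrier M \<and> s \<in> S \<and> X = loc_frac R S M x s)"
  unfolding loc_module_def quotient_def loc_frac_def by fastforce

lemma loc_add:
  assumes "x \<in> carrier M" "y \<in> carrier M" "s \<in> S" "t \<in> S"
  shows "loc_frac R S M x s \<oplus>\<^bsub>loc_module R S M\<^esub> loc_frac R S M y t =
    loc_frac R S M (t \<odot>\<^bsub>M\<^esub> x \<oplus>\<^bsub>M\<^esub> s \<odot>\<^bsub>M\<^esub> y) (s \<otimes> t)"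
proof -
  let ?f = "\<lambda>p q. loc_frac R S M (snd q \<odot>\<^bsub>M\<^esub> fst p \<oplus>\<^bsub>M\<^esub> snd p \<odot>\<^bsub>M\<^esub> fst q) (snd p \<otimes> snd q)"
  have "congruent2 (loc_rel R S M) (loc_rel R S M) ?f"
  proof (rule congruent2_commuteI[OF equiv_loc_rel])
    fix p q assume "p \<in> carrier M \<times> S" "q \<in> carrier M \<times> S"
    then show "?f p q = ?f q p" using S_carrier by (auto simp: M.a_comm R.m_comm)
  next
    fix p q q' assume "p \<in> carrier M \<times> S" and r: "(q, q') \<in> loc_rel R S M"
    then obtain x s y t y' t' where pq: "p = (x, s)" "q = (y, t)" "q' = (y', t')"
      and c: "x \<in> carrier M" "s \<in> S" by (metis SigmaE surj_pair)
    obtain v where v: "v \<in> S" "(v \<otimes> t') \<odot>\<^bsub>M\<^esub> y = (v \<otimes> t) \<odot>\<^bsub>M\<^esub> y'"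
      and d: "y \<in> carrier M" "y' \<in> carrier M" "t \<in> S" "t' \<in> S"
      using r unfolding pq loc_rel_iff by (elim conjE bexE)
    note k = v(1)[THEN S_carrier] c(2)[THEN S_carrier] d(3,4)[THEN S_carrier]
    have "(v \<otimes> (s \<otimes> t')) \<odot>\<^bsub>M\<^esub> (s \<odot>\<^bsub>M\<^esub> y) = (s \<otimes> s) \<odot>\<^bsub>M\<^esub> ((v \<otimes> t') \<odot>\<^bsub>M\<^esub> y)"
      using k d by (simp add: M.smult_assoc1[symmetric] R.m_ac)
    also have "\<dots> = (v \<otimes> (s \<otimes> t)) \<odot>\<^bsub>M\<^esub> (s \<odot>\<^bsub>M\<^esub> y')"
      unfolding v(2) using k d by (simp add: M.smult_assoc1[symmetric] R.m_ac)
    finally have "(v \<otimes> (s \<otimes> t')) \<odot>\<^bsub>M\<^esub> (t \<odot>\<^bsub>M\<^esub> x \<oplus>\<^bsub>M\<^esub> s \<odot>\<^bsub>M\<^esub> y) =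
        (v \<otimes> (s \<otimes> t)) \<odot>\<^bsub>M\<^esub> (t' \<odot>\<^bsub>M\<^esub> x \<oplus>\<^bsub>M\<^esub> s \<odot>\<^bsub>M\<^esub> y')"
      using k c d by (simp add: M.smult_r_distr M.smult_assoc1[symmetric] R.m_ac)
    then show "?f p q = ?f p q'"
      unfolding pq fst_conv snd_conv using k c d v(1) S(3)
      by (subst loc_frac_eq_iff) (simp_all, blast)
  qed
  from this[THEN UN_equiv_class2[OF equiv_loc_rel equiv_loc_rel], of "(x, s)" "(y, t)"] show ?thesis
    using assms by (simp add: loc_module_def case_prod_unfold loc_frac_def[of R S M x s] loc_frac_def[of R S M y t])
qed

end

lemma loc_smult:
  fixes M :: "('r, 'a, 'x) module_scheme"
  assumes M: "module R M"
    and a: "a \<in> carrier R" "y \<in> carrier M" "s \<in> S" "t \<in> S"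
  shows "loc_frac R S (ring_module R) a s \<odot>\<^bsub>loc_module R S M\<^esub> loc_frac R S M y t =
    loc_frac R S M (a \<odot>\<^bsub>M\<^esub> y) (s \<otimes> t)"
proof -
  interpret M: module R M by (rule M)
  note RM = module_ring_module[OF R]
  let ?f = "\<lambda>p q. loc_frac R S M (fst p \<odot>\<^bsub>M\<^esub> fst q) (snd p \<otimes> snd q)"
  have "?f p q = ?f p' q'"
    if r: "(p, p') \<in> loc_rel R S (ring_module R)" "(q, q') \<in> loc_rel R S M" for p p' q q'
  proof -
    obtain a s a' s' y t y' t' where pq: "p = (a, s)" "p' = (a', s')" "q = (y, t)" "q' = (y', t')"
      by (metis surj_pair)
    obtain u where u: "u \<in> S" "(u \<otimes> s') \<otimes> a = (u \<otimes> s) \<otimes> a'"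
      and c: "a \<in> carrier R" "a' \<in> carrier R" "s \<in> S" "s' \<in> S"
      using r(1) unfolding pq loc_rel_iff[OF RM] ring_module_simps by (elim conjE bexE)
    obtain v where v: "v \<in> S" "(v \<otimes> t') \<odot>\<^bsub>M\<^esub> y = (v \<otimes> t) \<odot>\<^bsub>M\<^esub> y'"
      and d: "y \<in> carrier M" "y' \<in> carrier M" "t \<in> S" "t' \<in> S"
      using r(2) unfolding pq loc_rel_iff[OF M] by (elim conjE bexE)
    note k = u(1)[THEN S_carrier] v(1)[THEN S_carrier] c(3,4)[THEN S_carrier] d(3,4)[THEN S_carrier]
    have "((u \<otimes> v) \<otimes> (s' \<otimes> t')) \<odot>\<^bsub>M\<^esub> (a \<odot>\<^bsub>M\<^esub> y) =
        ((u \<otimes> s') \<otimes> a) \<odot>\<^bsub>M\<^esub> ((v \<otimes> t') \<odot>\<^bsub>M\<^esub> y)"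
      using k c d by (simp add: M.smult_assoc1[symmetric] R.m_ac)
    also have "\<dots> = ((u \<otimes> v) \<otimes> (s \<otimes> t)) \<odot>\<^bsub>M\<^esub> (a' \<odot>\<^bsub>M\<^esub> y')"
      unfolding u(2) v(2) using k c d by (simp add: M.smult_assoc1[symmetric] R.m_ac)
    finally have e: "((u \<otimes> v) \<otimes> (s' \<otimes> t')) \<odot>\<^bsub>M\<^esub> (a \<odot>\<^bsub>M\<^esub> y) =
        ((u \<otimes> v) \<otimes> (s \<otimes> t)) \<odot>\<^bsub>M\<^esub> (a' \<odot>\<^bsub>M\<^esub> y')" .
    have "loc_frac R S M (a \<odot>\<^bsub>M\<^esub> y) (s \<otimes> t) = loc_frac R S M (a' \<odot>\<^bsub>M\<^esub> y') (s' \<otimes> t')"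
      by (subst loc_frac_eq_iff[OF M]) (use e k c d S(3) u(1) v(1) in \<open>auto intro!: bexI[of _ "u \<otimes> v"]\<close>)
    then show ?thesis by (simp add: pq)
  qed
  then have "congruent2 (loc_rel R S (ring_module R)) (loc_rel R S M) ?f"
    by (rule congruent2I')
  note this[THEN UN_equiv_class2[OF equiv_loc_rel[OF RM] equiv_loc_rel[OF M]]]
  from this[of "(a, s)" "(y, t)"] show ?thesis
    using a by (simp add: loc_module_def case_prod_unfold loc_frac_def[of R S M y t]
        loc_frac_def[of R S "ring_module R" a s])
qed

lemma loc_ring_simps:
  "carrier (loc_ring R S) = carrier (loc_module R S (ring_module R))"
  "\<zero>\<^bsub>loc_ring R S\<^esub> = loc_frac R S (ring_module R) \<zero> \<one>"
  "x \<oplus>\<^bsub>loc_ring R S\<^esub> y = x \<oplus>\<^bsub>loc_module R S (ring_module R)\<^esub> y"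
  "x \<otimes>\<^bsub>loc_ring R S\<^esub> y = x \<odot>\<^bsub>loc_module R S (ring_module R)\<^esub> y"
  by (simp_all add: loc_ring_def Let_def) (simp add: loc_module_def)

lemma common_multiplier:
  assumes "\<And>i. i < (n::nat) \<Longrightarrow> a i \<in> carrier R \<and> b i \<in> carrier R \<and> (\<exists>u\<in>S. u \<otimes> a i = u \<otimes> b i)"
  shows "\<exists>u\<in>S. \<forall>i<n. u \<otimes> a i = u \<otimes> b i"
  using assms
proof (induction n)
  case 0
  then show ?case using S(2) by blast
next
  case (Suc n)
  obtain u where u: "u \<in> S" "\<forall>i<n. u \<otimes> a i = u \<otimes> b i" using Suc by (metis less_Suc_eq)
  obtain v where v: "v \<in> S" "v \<otimes> a n = v \<otimes> b n" using Suc.prems by blast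
  note k = u(1)[THEN S_carrier] v(1)[THEN S_carrier]
  have "(u \<otimes> v) \<otimes> a i = (u \<otimes> v) \<otimes> b i" if i: "i < Suc n" for i
  proof -
    have c: "a i \<in> carrier R" "b i \<in> carrier R" using Suc.prems[OF i] by blast+
    have "u \<otimes> a i = u \<otimes> b i \<or> v \<otimes> a i = v \<otimes> b i"
      using i u(2) v(2) by (metis less_Suc_eq)
    then show ?thesis using c k by (metis R.m_assoc R.m_comm)
  qed
  then show ?case using S(3)[OF u(1) v(1)] by blast
qed

text \<open>Going from \<open>n\<close> to \<open>n + 1\<close> fractions multiplies the old numerators by the new denominator and conversely.\<close>

lemma common_denominator:
  assumes "\<And>i. i < (n::nat) \<Longrightarrow> f i \<in> carrier (loc_ring R S)"
  shows "\<exists>r t. t \<in> S \<and> (\<forall>i<n. r i \<in> carrier R \<and> f i = loc_frac R S (ring_module R) (r i) t)"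
  using assms
proof (induction n)
  case 0
  then show ?case using S(2) by blast
next
  case (Suc n)
  note RM = module_ring_module[OF R]
  obtain r t where rt: "t \<in> S" "\<forall>i<n. r i \<in> carrier R \<and> f i = loc_frac R S (ring_module R) (r i) t"
    using Suc by (metis less_Suc_eq)
  obtain q w where q: "q \<in> carrier R" "w \<in> S" "f n = loc_frac R S (ring_module R) q w"
    using Suc.prems[of n] by (auto simp: loc_ring_simps loc_module_carrier[OF RM])
  note k = rt(1)[THEN S_carrier] q(2)[THEN S_carrier]
  let ?r = "\<lambda>i. if i < n then w \<otimes> r i else t \<otimes> q"
  have "f i = loc_frac R S (ring_module R) (?r i) (t \<otimes> w) \<and> ?r i \<in> carrier R" if "i < Suc n" for i
  proof (cases "i < n")
    case True
    then have "r i \<in> carrier R" "f i = loc_frac R S (ring_module R) (r i) t" using rt(2) by blast+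
    moreover from this have "loc_frac R S (ring_module R) (r i) t =
        loc_frac R S (ring_module R) (w \<otimes> r i) (t \<otimes> w)"
      using k rt(1) q(2) S(3) by (intro loc_frac_eqI[OF RM]) (simp_all add: R.m_ac)
    ultimately show ?thesis using True k by simp
  next
    case False
    then have "i = n" using that by simp
    moreover have "loc_frac R S (ring_module R) q w =
        loc_frac R S (ring_module R) (t \<otimes> q) (t \<otimes> w)"
      using k rt(1) q S(3) by (intro loc_frac_eqI[OF RM]) (simp_all add: R.m_ac)
    ultimately show ?thesis using k q by simp
  qed
  then show ?case using S(3)[OF rt(1) q(2)] by (intro exI[of _ ?r] exI[of _ "t \<otimes> w"]) blast
qed

text \<open>
  If the \<open>e i\<close> become a basis after inverting \<open>s\<close>, with coordinate functions \<open>g i / s\<close>, then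
  localization at \<open>S \<ni> s\<close> is free.  The isomorphism is described in the direction of the coordinates.
\<close>

lemma localization_free:
  fixes M :: "('r, 'a, 'x) module_scheme" and n :: nat
  assumes M: "module R M" and s: "s \<in> S"
    and e: "\<And>i. i < n \<Longrightarrow> e i \<in> carrier M"
    and g: "\<And>i. i < n \<Longrightarrow> g i \<in> module_hom R M (ring_module R)"
    and ge: "\<And>i j. i < n \<Longrightarrow> j < n \<Longrightarrow> g i (e j) = (if i = j then s else \<zero>)"
    and span: "\<And>x. x \<in> carrier M \<Longrightarrow> s \<odot>\<^bsub>M\<^esub> x = (\<Oplus>\<^bsub>M\<^esub>i\<in>{..<n}. g i x \<odot>\<^bsub>M\<^esub> e i)"
  shows "module_iso (loc_ring R S) (free_module (loc_ring R S) {..<n}) (loc_module R S M) \<noteq> {}"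
proof -
  interpret M: module R M by (rule M)
  note RM = module_ring_module[OF R]
  let ?RP = "loc_ring R S" and ?L = "loc_module R S M"
  let ?fr = "loc_frac R S (ring_module R)" and ?frM = "loc_frac R S M"
  have sc: "s \<in> carrier R" by (rule S_carrier[OF s])
  have gc: "g i x \<in> carrier R" if "i < n" "x \<in> carrier M" for i x
    using module_hom_closed[OF g[OF that(1)] that(2)] by simp
  have gadd: "g i (x \<oplus>\<^bsub>M\<^esub> y) = g i x \<oplus> g i y" if "i < n" "x \<in> carrier M" "y \<in> carrier M" for i x y
    using module_hom_add[OF g[OF that(1)] that(2,3)] by simp
  have gsm: "g i (r \<odot>\<^bsub>M\<^esub> x) = r \<otimes> g i x" if "i < n" "r \<in> carrier R" "x \<in> carrier M" for i r x
    using module_hom_smult[OF g[OF that(1)] that(2,3)] by simp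
  \<comment> \<open>the vector of the fractions \<open>g i x / (s t)\<close>, for the fraction \<open>x / t\<close>\<close>
  define G where "G X i = (if i < n then \<Union>p\<in>X. ?fr (g i (fst p)) (s \<otimes> snd p) else \<zero>\<^bsub>?RP\<^esub>)" for X i
  have G: "G (?frM x t) i = ?fr (g i x) (s \<otimes> t)" if i: "i < n" and x: "x \<in> carrier M" "t \<in> S" for i x t
  proof -
    have "?fr (g i (fst p)) (s \<otimes> snd p) = ?fr (g i (fst q)) (s \<otimes> snd q)"
      if r: "(p, q) \<in> loc_rel R S M" for p q
    proof -
      obtain x t y w where pq: "p = (x, t)" "q = (y, w)" by (metis surj_pair)
      obtain u where u: "u \<in> S" "(u \<otimes> w) \<odot>\<^bsub>M\<^esub> x = (u \<otimes> t) \<odot>\<^bsub>M\<^esub> y"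
        and c: "x \<in> carrier M" "y \<in> carrier M" "t \<in> S" "w \<in> S"
        using r unfolding pq loc_rel_iff[OF M] by (elim conjE bexE)
      note k = u(1)[THEN S_carrier] c(3,4)[THEN S_carrier]
      have "(u \<otimes> w) \<otimes> g i x = (u \<otimes> t) \<otimes> g i y"
        using arg_cong[OF u(2), of "g i"] k c i by (simp add: gsm)
      then have "s \<otimes> ((u \<otimes> w) \<otimes> g i x) = s \<otimes> ((u \<otimes> t) \<otimes> g i y)" by simp
      then have "u \<otimes> (s \<otimes> w) \<otimes> g i x = u \<otimes> (s \<otimes> t) \<otimes> g i y"
        using k c gc[OF i] sc by (simp add: R.m_ac)
      then show ?thesis
        using c gc[OF i] s S(3) u(1) by (simp add: pq) (subst loc_frac_eq_iff[OF RM], auto)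
    qed
    then have "(\<lambda>p. ?fr (g i (fst p)) (s \<otimes> snd p)) respects loc_rel R S M"
      by (rule congruentI)
    from UN_equiv_class[OF equiv_loc_rel[OF M] this, of "(x, t)"] show ?thesis
      using i x unfolding G_def loc_frac_def[of R S M x t] by simp
  qed
  have G0: "G X i = \<zero>\<^bsub>?RP\<^esub>" if "\<not> i < n" for X i using that by (simp add: G_def)
  have LE: "\<exists>x t. x \<in> carrier M \<and> t \<in> S \<and> X = ?frM x t" if "X \<in> carrier ?L" for X
    using that loc_module_carrier[OF M] by blast
  have frc: "?fr a t \<in> carrier ?RP" if "a \<in> carrier R" "t \<in> S" for a t
    unfolding loc_ring_simps loc_module_carrier[OF RM] using that by fastforce
  have z: "\<zero>\<^bsub>?RP\<^esub> = ?fr \<zero> \<one>" by (rule loc_ring_simps)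
  have hom: "G \<in> module_hom ?RP ?L (free_module ?RP {..<n})"
  proof (rule module_homI)
    fix X assume "X \<in> carrier ?L"
    then obtain x t where X: "x \<in> carrier M" "t \<in> S" "X = ?frM x t" using LE by blast
    have "{i. G X i \<noteq> \<zero>\<^bsub>?RP\<^esub>} \<subseteq> {..<n}" using G0 by force
    then have "finite {i. G X i \<noteq> \<zero>\<^bsub>?RP\<^esub>}" by (rule finite_subset) simp
    moreover have "G X i \<in> carrier ?RP" if "i < n" for i
      unfolding X(3) G[OF that X(1,2)] using frc gc[OF that X(1)] s X(2) S(3) by simp
    ultimately show "G X \<in> carrier (free_module ?RP {..<n})"
      unfolding free_module_simps(1) using G0 by simp
  next
    fix X Y assume "X \<in> carrier ?L" "Y \<in> carrier ?L"
    then obtain x t y w where X: "x \<in> carrier M" "t \<in> S" "X = ?frM x t"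
      and Y: "y \<in> carrier M" "w \<in> S" "Y = ?frM y w" using LE by metis
    note k = X(2)[THEN S_carrier] Y(2)[THEN S_carrier]
    show "G (X \<oplus>\<^bsub>?L\<^esub> Y) = G X \<oplus>\<^bsub>free_module ?RP {..<n}\<^esub> G Y"
    proof
      fix i
      show "G (X \<oplus>\<^bsub>?L\<^esub> Y) i = (G X \<oplus>\<^bsub>free_module ?RP {..<n}\<^esub> G Y) i"
      proof (cases "i < n")
        case i: True
        have c: "g i x \<in> carrier R" "g i y \<in> carrier R" using gc i X Y by blast+
        have "G (X \<oplus>\<^bsub>?L\<^esub> Y) i = ?fr (w \<otimes> g i x \<oplus> t \<otimes> g i y) (s \<otimes> (t \<otimes> w))"
          using X Y i k S(3) by (simp add: loc_add[OF M] G gadd gsm)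
        also have "\<dots> = ?fr ((s \<otimes> w) \<otimes> g i x \<oplus> (s \<otimes> t) \<otimes> g i y)
            ((s \<otimes> t) \<otimes> (s \<otimes> w))"
          using c k sc s X Y S(3)
          by (intro loc_frac_eqI[OF RM]) (simp_all add: R.r_distr R.m_ac)
        also have "\<dots> = G X i \<oplus>\<^bsub>?RP\<^esub> G Y i"
          using X Y i s S(3) c by (simp add: G loc_ring_simps loc_add[OF RM])
        finally show ?thesis by (simp add: free_module_simps)
      next
        case False
        have "\<zero>\<^bsub>?RP\<^esub> \<oplus>\<^bsub>?RP\<^esub> \<zero>\<^bsub>?RP\<^esub> = \<zero>\<^bsub>?RP\<^esub>"
          using S(2) by (simp add: loc_ring_simps loc_add[OF RM])
        then show ?thesis by (simp add: free_module_simps G0[OF False])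
      qed
    qed
  next
    fix A X assume A: "A \<in> carrier ?RP" and "X \<in> carrier ?L"
    then obtain x t where X: "x \<in> carrier M" "t \<in> S" "X = ?frM x t" using LE by metis
    obtain a b where ab: "a \<in> carrier R" "b \<in> S" "A = ?fr a b"
      using A unfolding loc_ring_simps loc_module_carrier[OF RM] by auto
    note k = X(2)[THEN S_carrier] ab(2)[THEN S_carrier]
    show "G (A \<odot>\<^bsub>?L\<^esub> X) = A \<odot>\<^bsub>free_module ?RP {..<n}\<^esub> G X"
    proof
      fix i
      show "G (A \<odot>\<^bsub>?L\<^esub> X) i = (A \<odot>\<^bsub>free_module ?RP {..<n}\<^esub> G X) i"
      proof (cases "i < n")
        case i: True
        have c: "g i x \<in> carrier R" using gc i X by blast
        have "G (A \<odot>\<^bsub>?L\<^esub> X) i = ?fr (a \<otimes> g i x) (s \<otimes> (b \<otimes> t))"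
          using X ab i S(3) by (simp add: loc_smult[OF M] G gsm)
        also have "\<dots> = ?fr (a \<otimes> g i x) (b \<otimes> (s \<otimes> t))"
          using k sc by (simp add: R.m_ac)
        also have "\<dots> = A \<otimes>\<^bsub>?RP\<^esub> G X i"
          using X ab i s S(3) c by (simp add: G loc_ring_simps loc_smult[OF RM])
        finally show ?thesis by (simp add: free_module_simps)
      next
        case False
        have "A \<otimes>\<^bsub>?RP\<^esub> \<zero>\<^bsub>?RP\<^esub> = \<zero>\<^bsub>?RP\<^esub>"
          using S(2) ab k by (simp add: loc_ring_simps loc_smult[OF RM]) (rule loc_frac_eqI[OF RM], simp_all)
        then show ?thesis by (simp add: free_module_simps G0[OF False])
      qed
    qed
  qed
  have inj: "X = Y" if XY: "X \<in> carrier ?L" "Y \<in> carrier ?L" "G X = G Y" for X Y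
  proof -
    obtain x t y w where X: "x \<in> carrier M" "t \<in> S" "X = ?frM x t"
      and Y: "y \<in> carrier M" "w \<in> S" "Y = ?frM y w" using LE XY(1,2) by metis
    note k = X(2)[THEN S_carrier] Y(2)[THEN S_carrier]
    have "\<exists>u\<in>S. u \<otimes> (s \<otimes> w \<otimes> g i x) = u \<otimes> (s \<otimes> t \<otimes> g i y)" if i: "i < n" for i
    proof -
      have c: "g i x \<in> carrier R" "g i y \<in> carrier R" using gc i X Y by blast+
      have "?fr (g i x) (s \<otimes> t) = ?fr (g i y) (s \<otimes> w)"
        using fun_cong[OF XY(3), of i] X Y i by (simp add: G)
      then obtain u where "u \<in> S" "(u \<otimes> (s \<otimes> w)) \<otimes> g i x = (u \<otimes> (s \<otimes> t)) \<otimes> g i y"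
        using loc_frac_eq_iff[OF RM, of "g i x" "g i y" "s \<otimes> t" "s \<otimes> w"] c s S(3) X Y by auto
      then show ?thesis using c k sc S_carrier by (intro bexI[of _ u]) (simp_all add: R.m_assoc)
    qed
    then obtain u where u: "u \<in> S"
      "\<forall>i<n. u \<otimes> (s \<otimes> w \<otimes> g i x) = u \<otimes> (s \<otimes> t \<otimes> g i y)"
      using common_multiplier[of n "\<lambda>i. s \<otimes> w \<otimes> g i x" "\<lambda>i. s \<otimes> t \<otimes> g i y"]
        gc X(1) Y(1) k sc by auto
    have uc: "u \<in> carrier R" by (rule S_carrier[OF u(1)])
    have expand: "(u \<otimes> s \<otimes> s \<otimes> a) \<odot>\<^bsub>M\<^esub> z =
        (\<Oplus>\<^bsub>M\<^esub>i\<in>{..<n}. (u \<otimes> (s \<otimes> a \<otimes> g i z)) \<odot>\<^bsub>M\<^esub> e i)" if "a \<in> carrier R" "z \<in> carrier M" for a z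
    proof -
      have "(u \<otimes> s \<otimes> s \<otimes> a) \<odot>\<^bsub>M\<^esub> z = (u \<otimes> s \<otimes> a) \<odot>\<^bsub>M\<^esub> (s \<odot>\<^bsub>M\<^esub> z)"
        using that uc sc by (simp add: M.smult_assoc1[symmetric] R.m_ac)
      also have "\<dots> = (\<Oplus>\<^bsub>M\<^esub>i\<in>{..<n}. (u \<otimes> s \<otimes> a) \<odot>\<^bsub>M\<^esub> (g i z \<odot>\<^bsub>M\<^esub> e i))"
        unfolding span[OF that(2)] using that uc sc gc e
        by (intro M.finsum_smult_ldistr) auto
      also have "\<dots> = (\<Oplus>\<^bsub>M\<^esub>i\<in>{..<n}. (u \<otimes> (s \<otimes> a \<otimes> g i z)) \<odot>\<^bsub>M\<^esub> e i)"
        using that uc sc gc e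
        by (intro M.finsum_cong') (simp_all add: M.smult_assoc1[symmetric] R.m_assoc)
      finally show ?thesis .
    qed
    have "(u \<otimes> s \<otimes> s \<otimes> w) \<odot>\<^bsub>M\<^esub> x = (u \<otimes> s \<otimes> s \<otimes> t) \<odot>\<^bsub>M\<^esub> y"
      unfolding expand[OF k(1) Y(1)] expand[OF k(2) X(1)]
      using u(2) uc sc gc e k X(1) Y(1) by (intro M.finsum_cong') auto
    moreover have "u \<otimes> s \<otimes> s \<in> S" using S(3) u(1) s by simp
    ultimately show ?thesis unfolding X(3) Y(3) loc_frac_eq_iff[OF M X(1) Y(1) X(2) Y(2)] by blast
  qed
  have surj: "\<exists>X\<in>carrier ?L. G X = f" if f: "f \<in> carrier (free_module ?RP {..<n})" for f
  proof -
    have fz: "f i = \<zero>\<^bsub>?RP\<^esub>" if "\<not> i < n" for i using f that by (simp add: free_module_simps(1))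
    obtain r t where rt: "t \<in> S" "\<forall>i<n. r i \<in> carrier R \<and> f i = ?fr (r i) t"
      using common_denominator[of n f] f by (auto simp: free_module_simps(1))
    have tc: "t \<in> carrier R" by (rule S_carrier[OF rt(1)])
    let ?x = "\<Oplus>\<^bsub>M\<^esub>j\<in>{..<n}. r j \<odot>\<^bsub>M\<^esub> e j"
    have re: "(\<lambda>j. r j \<odot>\<^bsub>M\<^esub> e j) \<in> {..<n} \<rightarrow> carrier M" using rt(2) e by auto
    have x: "?x \<in> carrier M" by (rule M.finsum_closed[OF re])
    have gx: "g i ?x = r i \<otimes> s" if i: "i < n" for i
    proof -
      have "g i ?x = (\<Oplus>\<^bsub>ring_module R\<^esub>j\<in>{..<n}. g i (r j \<odot>\<^bsub>M\<^esub> e j))"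
        by (rule module_hom_finsum[OF M RM g[OF i] re])
      also have "\<dots> = (\<Oplus>j\<in>{..<n}. g i (r j \<odot>\<^bsub>M\<^esub> e j))" by (rule finsum_ring_module)
      also have "\<dots> = (\<Oplus>j\<in>{..<n}. if i = j then r j \<otimes> s else \<zero>)"
        using rt(2) sc i e by (intro R.finsum_cong') (auto simp: gsm ge)
      also have "\<dots> = r i \<otimes> s"
        using rt(2) sc i by (subst R.finsum_singleton) auto
      finally show ?thesis .
    qed
    have "G (?frM ?x t) = f"
    proof
      fix i
      show "G (?frM ?x t) i = f i"
      proof (cases "i < n")
        case i: True
        have "r i \<in> carrier R" "f i = ?fr (r i) t" using rt(2) i by blast+
        moreover from this(1) have "?fr (r i \<otimes> s) (s \<otimes> t) = ?fr (r i) t"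
          using s rt(1) S(3) sc tc by (intro loc_frac_eqI[OF RM]) (simp_all add: R.m_ac)
        ultimately show ?thesis unfolding G[OF i x rt(1)] gx[OF i] by simp
      qed (simp add: G0 fz)
    qed
    moreover have "?frM ?x t \<in> carrier ?L" using x rt(1) loc_module_carrier[OF M] by blast
    ultimately show ?thesis by blast
  qed
  have "bij_betw G (carrier ?L) (carrier (free_module ?RP {..<n}))"
    unfolding bij_betw_def
  proof
    show "inj_on G (carrier ?L)" using inj by (rule inj_onI)
    show "G ` carrier ?L = carrier (free_module ?RP {..<n})"
    proof
      show "G ` carrier ?L \<subseteq> carrier (free_module ?RP {..<n})"
        using module_hom_closed[OF hom] by blast
      show "carrier (free_module ?RP {..<n}) \<subseteq> G ` carrier ?L"
        using surj by (metis image_eqI subsetI)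
    qed
  qed
  then have "G \<in> module_iso ?RP ?L (free_module ?RP {..<n})" using hom by (simp add: module_iso_def)
  then have "inv_into (carrier ?L) G \<in> module_iso ?RP (free_module ?RP {..<n}) ?L"
  proof (rule module_iso_inverse)
    fix X Y assume "X \<in> carrier ?L" "Y \<in> carrier ?L"
    then obtain x t y w where "x \<in> carrier M" "t \<in> S" "X = ?frM x t"
      and "y \<in> carrier M" "w \<in> S" "Y = ?frM y w" using LE by metis
    then show "X \<oplus>\<^bsub>?L\<^esub> Y \<in> carrier ?L"
      using S(3) S_carrier unfolding loc_module_carrier[OF M]
      by (intro exI[of _ "w \<odot>\<^bsub>M\<^esub> x \<oplus>\<^bsub>M\<^esub> t \<odot>\<^bsub>M\<^esub> y"] exI[of _ "t \<otimes> w"]) (simp add: loc_add[OF M])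
  next
    fix A X assume A: "A \<in> carrier ?RP" and "X \<in> carrier ?L"
    then obtain x t where X: "x \<in> carrier M" "t \<in> S" "X = ?frM x t" using LE by metis
    obtain a b where "a \<in> carrier R" "b \<in> S" "A = ?fr a b"
      using A unfolding loc_ring_simps loc_module_carrier[OF RM] by auto
    then show "A \<odot>\<^bsub>?L\<^esub> X \<in> carrier ?L"
      using X S(3) S_carrier unfolding loc_module_carrier[OF M]
      by (intro exI[of _ "a \<odot>\<^bsub>M\<^esub> x"] exI[of _ "b \<otimes> t"]) (simp add: loc_smult[OF M])
  qed
  then show ?thesis by blast
qed

end

lemma ideal_finsum:
  assumes "ideal P R" "finite A" "s \<in> A \<rightarrow> P"
  shows "(\<Oplus>\<^bsub>R\<^esub>k\<in>A. s k) \<in> P"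
proof -
  interpret P: ideal P R by fact
  show ?thesis using assms(2,3)
  proof induction
    case (insert a A)
    then have "s a \<in> carrier R" "s \<in> A \<rightarrow> carrier R" using P.a_subset by auto
    then show ?case using insert by (simp add: P.finsum_insert)
  qed simp
qed

text \<open>
  A prime \<open>P\<close> not containing \<open>s\<close> makes \<open>s\<close> invertible in the localization, where the \<open>e i\<close> then form a
  basis.
\<close>

lemma has_rankI:
  assumes M: "module R M"
    and local_basis: "\<And>P. primeideal P R \<Longrightarrow> \<exists>s e g. s \<in> carrier R - P \<and> (\<forall>i<n. e i \<in> carrier M) \<and>
      (\<forall>i<n. g i \<in> module_hom R M (ring_module R)) \<and>
      (\<forall>i<n. \<forall>j<n. g i (e j) = (if i = j then s else \<zero>\<^bsub>R\<^esub>)) \<and>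
      (\<forall>x\<in>carrier M. s \<odot>\<^bsub>M\<^esub> x = (\<Oplus>\<^bsub>M\<^esub>i\<in>{..<n}. g i x \<odot>\<^bsub>M\<^esub> e i))"
  shows "has_rank R M n"
  unfolding has_rank_def Let_def
proof (intro allI impI)
  fix P assume P: "primeideal P R"
  interpret M: module R M by (rule M)
  interpret P: primeideal P R by (rule P)
  obtain s e g where b: "s \<in> carrier R - P" "\<forall>i<n. e i \<in> carrier M"
    "\<forall>i<n. g i \<in> module_hom R M (ring_module R)"
    "\<forall>i<n. \<forall>j<n. g i (e j) = (if i = j then s else \<zero>\<^bsub>R\<^esub>)"
    "\<forall>x\<in>carrier M. s \<odot>\<^bsub>M\<^esub> x = (\<Oplus>\<^bsub>M\<^esub>i\<in>{..<n}. g i x \<odot>\<^bsub>M\<^esub> e i)"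
    using local_basis[OF P] by (elim exE conjE)
  have one: "\<one>\<^bsub>R\<^esub> \<in> carrier R - P" using P.one_imp_carrier P.I_notcarr by auto
  have mult: "s \<otimes>\<^bsub>R\<^esub> t \<in> carrier R - P" if "s \<in> carrier R - P" "t \<in> carrier R - P" for s t
    using that P.I_prime by auto
  show "module_iso (loc_ring R (carrier R - P)) (free_module (loc_ring R (carrier R - P)) {..<n})
      (loc_module R (carrier R - P) M) \<noteq> {}"
    by (rule localization_free[OF M.is_cring _ one mult M b(1)]) (use b in auto)
qed

section \<open>Tensor powers\<close>

lemma words_iff: "w \<in> words Q i \<longleftrightarrow> set w \<subseteq> carrier Q \<and> length w = i"
  by (auto simp: words_def in_lists_conv_set)

locale tensor_powers =
  fixes R :: "('r, 'z) ring_scheme" (structure) and Q :: "('r, 'q, 'x) module_scheme"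
  assumes module_Q: "module R Q"
begin

interpretation Q: module R Q by (rule module_Q)

abbreviation "T \<equiv> tensor_power R Q"
abbreviation "pt \<equiv> pure_tensor R Q"
abbreviation "tp \<equiv> tensor_prod R Q"
abbreviation "FW i \<equiv> free_module R (words Q i)"
abbreviation "rel \<equiv> multilin_rel R Q"

lemma cring_R: "cring R" ..

lemma module_FW: "module R (FW i)"
  by (rule module_free[OF cring_R])

interpretation F: module R "FW i" for i by (rule module_FW)

lemma gen_closed: "set w \<subseteq> carrier Q \<Longrightarrow> length w = i \<Longrightarrow> free_gen R w \<in> carrier (FW i)"
  by (rule free_gen_closed[OF cring_R]) (simp add: words_iff)

definition rel_gens :: "nat \<Rightarrow> ('q list \<Rightarrow> 'r) set" where
  "rel_gens i = {free_gen R (u @ [a \<oplus>\<^bsub>Q\<^esub> b] @ v) \<ominus>\<^bsub>FW i\<^esub>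
        (free_gen R (u @ [a] @ v) \<oplus>\<^bsub>FW i\<^esub> free_gen R (u @ [b] @ v)) | u v a b.
      a \<in> carrier Q \<and> b \<in> carrier Q \<and> u \<in> lists (carrier Q) \<and> v \<in> lists (carrier Q) \<and>
      length u + 1 + length v = i} \<union>
    {free_gen R (u @ [r \<odot>\<^bsub>Q\<^esub> a] @ v) \<ominus>\<^bsub>FW i\<^esub> r \<odot>\<^bsub>FW i\<^esub> free_gen R (u @ [a] @ v) | u v a r.
      r \<in> carrier R \<and> a \<in> carrier Q \<and> u \<in> lists (carrier Q) \<and> v \<in> lists (carrier Q) \<and>
      length u + 1 + length v = i}"

lemma rel_eq: "rel i = generated_submodule R (FW i) (rel_gens i)"
  by (simp add: multilin_rel_def rel_gens_def Let_def)

lemma rel_gens_cases: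
  assumes "x \<in> rel_gens i"
  obtains (add) u v a b where "a \<in> carrier Q" "b \<in> carrier Q" "set u \<subseteq> carrier Q" "set v \<subseteq> carrier Q"
      "length u + 1 + length v = i"
      "x = free_gen R (u @ [a \<oplus>\<^bsub>Q\<^esub> b] @ v) \<ominus>\<^bsub>FW i\<^esub>
        (free_gen R (u @ [a] @ v) \<oplus>\<^bsub>FW i\<^esub> free_gen R (u @ [b] @ v))"
  | (smult) u v a r where "r \<in> carrier R" "a \<in> carrier Q" "set u \<subseteq> carrier Q" "set v \<subseteq> carrier Q"
      "length u + 1 + length v = i"
      "x = free_gen R (u @ [r \<odot>\<^bsub>Q\<^esub> a] @ v) \<ominus>\<^bsub>FW i\<^esub> r \<odot>\<^bsub>FW i\<^esub> free_gen R (u @ [a] @ v)"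
  using assms unfolding rel_gens_def lists_eq_set by blast

lemma rel_gens_carrier: "rel_gens i \<subseteq> carrier (FW i)"
proof
  fix x assume "x \<in> rel_gens i"
  then show "x \<in> carrier (FW i)"
  proof (cases rule: rel_gens_cases)
    case (add u v a b)
    then show ?thesis by (simp add: gen_closed)
  next
    case (smult u v a r)
    then show ?thesis by (simp add: gen_closed)
  qed
qed

lemma submodule_rel: "submodule (rel i) R (FW i)"
  unfolding rel_eq by (rule submodule_generated[OF module_FW rel_gens_carrier])

lemma rel_gens_rel: "rel_gens i \<subseteq> rel i"
  unfolding rel_eq by (rule generated_submodule_subset)

lemma module_T: "module R (T i)"
  unfolding tensor_power_def by (rule module_quotient[OF module_FW submodule_rel])

interpretation T: module R "T i" for i by (rule module_T)

abbreviation cls :: "nat \<Rightarrow> ('q list \<Rightarrow> 'r) \<Rightarrow> ('q list \<Rightarrow> 'r) set" where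
  "cls i p \<equiv> rel i +>\<^bsub>FW i\<^esub> p"

lemma cls_hom: "cls i \<in> module_hom R (FW i) (T i)"
  unfolding tensor_power_def
  by (rule module_homI)
    (simp_all add: quotient_carrier[OF module_FW submodule_rel] quotient_add[OF module_FW submodule_rel]
      quotient_smult[OF module_FW submodule_rel])

lemma T_carrier: "carrier (T i) = cls i ` carrier (FW i)"
  unfolding tensor_power_def by (rule quotient_carrier[OF module_FW submodule_rel])

lemma pt_eq: "length w = i \<Longrightarrow> pt w = cls i (free_gen R w)"
  by (auto simp: pure_tensor_def)

lemma pt_closed [simp]: "set w \<subseteq> carrier Q \<Longrightarrow> length w = i \<Longrightarrow> pt w \<in> carrier (T i)"
  by (simp add: pt_eq module_hom_closed[OF cls_hom] gen_closed)

lemma pt_add: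
  assumes "a \<in> carrier Q" "b \<in> carrier Q" "set u \<subseteq> carrier Q" "set v \<subseteq> carrier Q" "length u + 1 + length v = i"
  shows "pt (u @ [a \<oplus>\<^bsub>Q\<^esub> b] @ v) = pt (u @ [a] @ v) \<oplus>\<^bsub>T i\<^esub> pt (u @ [b] @ v)"
proof -
  let ?e = "\<lambda>a. free_gen R (u @ [a] @ v)"
  have c: "?e (a \<oplus>\<^bsub>Q\<^esub> b) \<in> carrier (FW i)" "?e a \<in> carrier (FW i)" "?e b \<in> carrier (FW i)"
    using assms by (simp_all add: gen_closed)
  have "?e (a \<oplus>\<^bsub>Q\<^esub> b) \<ominus>\<^bsub>FW i\<^esub> (?e a \<oplus>\<^bsub>FW i\<^esub> ?e b) \<in> rel_gens i"
    unfolding rel_gens_def lists_eq_set using assms by blast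
  from subsetD[OF rel_gens_rel this] have "cls i (?e (a \<oplus>\<^bsub>Q\<^esub> b)) = cls i (?e a \<oplus>\<^bsub>FW i\<^esub> ?e b)"
    using c by (simp only: coset_eq_iff[OF module_FW submodule_rel] F.a_closed)
  then show ?thesis
    using assms(5) c by (simp add: pt_eq[of _ i] module_hom_add[OF cls_hom])
qed

lemma pt_smult:
  assumes "r \<in> carrier R" "a \<in> carrier Q" "set u \<subseteq> carrier Q" "set v \<subseteq> carrier Q" "length u + 1 + length v = i"
  shows "pt (u @ [r \<odot>\<^bsub>Q\<^esub> a] @ v) = r \<odot>\<^bsub>T i\<^esub> pt (u @ [a] @ v)"
proof -
  let ?e = "\<lambda>a. free_gen R (u @ [a] @ v)"
  have c: "?e (r \<odot>\<^bsub>Q\<^esub> a) \<in> carrier (FW i)" "?e a \<in> carrier (FW i)"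
    using assms by (simp_all add: gen_closed)
  have "?e (r \<odot>\<^bsub>Q\<^esub> a) \<ominus>\<^bsub>FW i\<^esub> r \<odot>\<^bsub>FW i\<^esub> ?e a \<in> rel_gens i"
    unfolding rel_gens_def lists_eq_set using assms by blast
  from subsetD[OF rel_gens_rel this] have "cls i (?e (r \<odot>\<^bsub>Q\<^esub> a)) = cls i (r \<odot>\<^bsub>FW i\<^esub> ?e a)"
    using c assms(1) by (simp only: coset_eq_iff[OF module_FW submodule_rel] F.smult_closed)
  then show ?thesis
    using assms c by (simp add: pt_eq[of _ i] module_hom_smult[OF cls_hom])
qed

text \<open>Multilinearity of the pure tensor in the form in which it composes with other linear maps.\<close>

lemma pt_slot:
  assumes "set u \<subseteq> carrier Q" "set v \<subseteq> carrier Q" "length u + 1 + length v = i"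
  shows "(\<lambda>a. pt (u @ [a] @ v)) \<in> module_hom R Q (T i)"
  by (rule module_homI) (use assms pt_add pt_smult in auto)

text \<open>Zero needs no case of its own, since it is a multiple of a pure tensor.\<close>

lemma T_induct [consumes 1, case_names add pure]:
  assumes x: "x \<in> carrier (T i)"
    and add: "\<And>x y. x \<in> carrier (T i) \<Longrightarrow> y \<in> carrier (T i) \<Longrightarrow> P x \<Longrightarrow> P y \<Longrightarrow> P (x \<oplus>\<^bsub>T i\<^esub> y)"
    and pure: "\<And>r w. r \<in> carrier R \<Longrightarrow> set w \<subseteq> carrier Q \<Longrightarrow> length w = i \<Longrightarrow> P (r \<odot>\<^bsub>T i\<^esub> pt w)"
  shows "P x"
proof -
  have "P (cls i p)" if "p \<in> carrier (FW i)" for p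
  proof (rule free_module_induct[OF cring_R that])
    \<comment> \<open>some word is needed, since zero is to be written as a multiple of a pure tensor\<close>
    let ?w = "replicate i \<zero>\<^bsub>Q\<^esub>"
    have w: "set ?w \<subseteq> carrier Q" by (auto simp: set_replicate_conv_if)
    have "P (\<zero> \<odot>\<^bsub>T i\<^esub> pt ?w)" using w by (intro pure) simp_all
    then show "P (cls i \<zero>\<^bsub>FW i\<^esub>)"
      using w module_hom_zero[OF module_FW module_T cls_hom] by simp
  next
    fix p q assume "p \<in> carrier (FW i)" "q \<in> carrier (FW i)" "P (cls i p)" "P (cls i q)"
    then show "P (cls i (p \<oplus>\<^bsub>FW i\<^esub> q))"
      using add module_hom_closed[OF cls_hom] by (simp add: module_hom_add[OF cls_hom])
  next
    fix r w assume "r \<in> carrier R" "w \<in> words Q i"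
    then show "P (cls i (r \<odot>\<^bsub>FW i\<^esub> free_gen R w))"
      using pure by (simp add: words_iff module_hom_smult[OF cls_hom] gen_closed flip: pt_eq)
  qed
  then show ?thesis using x unfolding T_carrier by blast
qed

lemma T_hom_eq:
  assumes "f \<in> module_hom R (T i) N" "g \<in> module_hom R (T i) N" "x \<in> carrier (T i)"
    and "\<And>w. set w \<subseteq> carrier Q \<Longrightarrow> length w = i \<Longrightarrow> f (pt w) = g (pt w)"
  shows "f x = g x"
  using assms(3)
  by (induction rule: T_induct)
    (simp_all add: assms(4) module_hom_add[OF assms(1)] module_hom_add[OF assms(2)]
      module_hom_smult[OF assms(1)] module_hom_smult[OF assms(2)])

subsection \<open>Linear maps from multilinear maps\<close>

definition multilinear :: "nat \<Rightarrow> ('r, 'b, 'y) module_scheme \<Rightarrow> ('q list \<Rightarrow> 'b) \<Rightarrow> bool" where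
  "multilinear i N g \<longleftrightarrow> (\<forall>w. set w \<subseteq> carrier Q \<longrightarrow> length w = i \<longrightarrow> g w \<in> carrier N) \<and>
    (\<forall>u v. set u \<subseteq> carrier Q \<longrightarrow> set v \<subseteq> carrier Q \<longrightarrow> length u + 1 + length v = i \<longrightarrow>
      (\<lambda>a. g (u @ [a] @ v)) \<in> module_hom R Q N)"

context
  fixes N :: "('r, 'b, 'y) module_scheme" and g :: "'q list \<Rightarrow> 'b" and i :: nat
  assumes N: "module R N" and g: "multilinear i N g"
begin

interpretation N: module R N by (rule N)

lemma multilinear_closed: "set w \<subseteq> carrier Q \<Longrightarrow> length w = i \<Longrightarrow> g w \<in> carrier N"
  using g by (simp add: multilinear_def)

lemma multilinear_slot:
  "set u \<subseteq> carrier Q \<Longrightarrow> set v \<subseteq> carrier Q \<Longrightarrow> length u + 1 + length v = i \<Longrightarrow>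
    (\<lambda>a. g (u @ [a] @ v)) \<in> module_hom R Q N"
  using g by (simp add: multilinear_def)

lemma free_lift_multilinear_hom: "free_lift R N g \<in> module_hom R (FW i) N"
  by (rule free_lift_hom[OF cring_R N]) (simp add: words_iff multilinear_closed)

lemma free_lift_multilinear_gen:
  "set w \<subseteq> carrier Q \<Longrightarrow> length w = i \<Longrightarrow> free_lift R N g (free_gen R w) = g w"
  by (rule free_lift_gen[OF cring_R N, where X = "words Q i"]) (simp_all add: words_iff multilinear_closed)

text \<open>Multilinearity of \<open>g\<close> says that the evaluation vanishes on the generating relations.\<close>

lemma free_lift_rel:
  assumes "p \<in> rel i"
  shows "free_lift R N g p = \<zero>\<^bsub>N\<^esub>"
proof -
  note h = free_lift_multilinear_hom
  have "submodule {\<zero>\<^bsub>N\<^esub>} R N"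
    by (rule N.submoduleI) (auto intro: N.add.inv_one[folded a_inv_def, simplified])
  then have "submodule {p \<in> carrier (FW i). free_lift R N g p \<in> {\<zero>\<^bsub>N\<^esub>}} R (FW i)"
    by (rule submodule_kernel[OF module_FW N h])
  moreover have "rel_gens i \<subseteq> {p \<in> carrier (FW i). free_lift R N g p \<in> {\<zero>\<^bsub>N\<^esub>}}"
  proof
    fix x assume x: "x \<in> rel_gens i"
    then have "free_lift R N g x = \<zero>\<^bsub>N\<^esub>"
    proof (cases rule: rel_gens_cases)
      case (add u v a b)
      have "free_lift R N g x = g (u @ [a \<oplus>\<^bsub>Q\<^esub> b] @ v) \<ominus>\<^bsub>N\<^esub> (g (u @ [a] @ v) \<oplus>\<^bsub>N\<^esub> g (u @ [b] @ v))"
        using add by (simp add: gen_closed module_hom_minus[OF module_FW N h] module_hom_add[OF h]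
            free_lift_multilinear_gen)
      moreover have "g (u @ [a \<oplus>\<^bsub>Q\<^esub> b] @ v) = g (u @ [a] @ v) \<oplus>\<^bsub>N\<^esub> g (u @ [b] @ v)"
        by (rule module_hom_add[OF multilinear_slot[OF add(3-5)] add(1,2)])
      moreover have "g (u @ [a] @ v) \<oplus>\<^bsub>N\<^esub> g (u @ [b] @ v) \<in> carrier N"
        using add by (intro N.a_closed multilinear_closed) auto
      ultimately show ?thesis by (simp add: a_minus_def N.r_neg)
    next
      case (smult u v a r)
      have "free_lift R N g x = g (u @ [r \<odot>\<^bsub>Q\<^esub> a] @ v) \<ominus>\<^bsub>N\<^esub> r \<odot>\<^bsub>N\<^esub> g (u @ [a] @ v)"
        using smult by (simp add: gen_closed module_hom_minus[OF module_FW N h] module_hom_smult[OF h]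
            free_lift_multilinear_gen)
      moreover have "g (u @ [r \<odot>\<^bsub>Q\<^esub> a] @ v) = r \<odot>\<^bsub>N\<^esub> g (u @ [a] @ v)"
        by (rule module_hom_smult[OF multilinear_slot[OF smult(3-5)] smult(1,2)])
      moreover have "r \<odot>\<^bsub>N\<^esub> g (u @ [a] @ v) \<in> carrier N"
        using smult by (intro N.smult_closed multilinear_closed) auto
      ultimately show ?thesis by (simp add: a_minus_def N.r_neg)
    qed
    then show "x \<in> {p \<in> carrier (FW i). free_lift R N g p \<in> {\<zero>\<^bsub>N\<^esub>}}"
      using x rel_gens_carrier by auto
  qed
  ultimately show ?thesis using assms generated_submodule_minimal unfolding rel_eq by blast
qed

lemma tensor_lift_cls:
  assumes p: "p \<in> carrier (FW i)"
  shows "tensor_lift R N g (cls i p) = free_lift R N g p"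
proof -
  note h = free_lift_multilinear_hom
  have "free_lift R N g q = free_lift R N g p" if "q \<in> cls i p" for q
  proof -
    have q: "q \<in> carrier (FW i)" and "cls i q = cls i p"
      using coset_mem[OF module_FW submodule_rel p that] by blast+
    then have "q \<ominus>\<^bsub>FW i\<^esub> p \<in> rel i" using coset_eq_iff[OF module_FW submodule_rel q p] by blast
    then have "free_lift R N g q \<ominus>\<^bsub>N\<^esub> free_lift R N g p = \<zero>\<^bsub>N\<^esub>"
      using free_lift_rel module_hom_minus[OF module_FW N h q p] by simp
    then show ?thesis
      using module_hom_closed[OF h q] module_hom_closed[OF h p]
      by (metis a_minus_def N.minus_equality N.minus_minus N.a_inv_closed)
  qed
  moreover have "p \<in> cls i p"
    using abelian_subgroup.a_rcos_self[OF submodule_abelian_subgroup[OF module_FW submodule_rel] p] .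
  ultimately have "free_lift R N g ` cls i p = {free_lift R N g p}" by blast
  moreover have "tensor_lift R N g X = the_elem (free_lift R N g ` X)" for X
    by (simp add: tensor_lift_def free_lift_def[abs_def])
  ultimately show ?thesis by simp
qed

lemma tensor_lift_hom: "tensor_lift R N g \<in> module_hom R (T i) N"
proof (rule module_homI)
  note h = free_lift_multilinear_hom
  fix x assume "x \<in> carrier (T i)"
  then obtain p where p: "p \<in> carrier (FW i)" "x = cls i p" unfolding T_carrier by blast
  show "tensor_lift R N g x \<in> carrier N" using p by (simp add: tensor_lift_cls module_hom_closed[OF h])
  show "tensor_lift R N g (r \<odot>\<^bsub>T i\<^esub> x) = r \<odot>\<^bsub>N\<^esub> tensor_lift R N g x" if "r \<in> carrier R" for r
    using p that by (simp add: tensor_lift_cls module_hom_smult[OF h] flip: module_hom_smult[OF cls_hom])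
  fix y assume "y \<in> carrier (T i)"
  then obtain q where q: "q \<in> carrier (FW i)" "y = cls i q" unfolding T_carrier by blast
  show "tensor_lift R N g (x \<oplus>\<^bsub>T i\<^esub> y) = tensor_lift R N g x \<oplus>\<^bsub>N\<^esub> tensor_lift R N g y"
    using p q by (simp add: tensor_lift_cls module_hom_add[OF h] flip: module_hom_add[OF cls_hom])
qed

lemma tensor_lift_pt:
  "set w \<subseteq> carrier Q \<Longrightarrow> length w = i \<Longrightarrow> tensor_lift R N g (pt w) = g w"
  by (simp add: pt_eq tensor_lift_cls gen_closed free_lift_multilinear_gen)

end

subsection \<open>The product of homogeneous tensors\<close>

text \<open>The product of representatives that defines \<open>tensor_prod\<close>.\<close>

definition word_product :: "nat \<Rightarrow> ('q list \<Rightarrow> 'r) \<Rightarrow> ('q list \<Rightarrow> 'r) \<Rightarrow> 'q list \<Rightarrow> 'r" where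
  "word_product i p q = (\<lambda>w. p (take i w) \<otimes> q (drop i w))"

lemma word_product_closed:
  assumes p: "p \<in> carrier (FW i)" and q: "q \<in> carrier (FW j)"
  shows "word_product i p q \<in> carrier (FW (i + j))"
proof -
  note pc = free_module_component[OF cring_R p] and qc = free_module_component[OF cring_R q]
  have nz: "p (take i w) \<noteq> \<zero> \<and> q (drop i w) \<noteq> \<zero>" if "word_product i p q w \<noteq> \<zero>" for w
    using that pc qc unfolding word_product_def by (metis Q.l_null Q.r_null)
  have "w \<in> words Q (i + j)" if "word_product i p q w \<noteq> \<zero>" for w
  proof -
    have "take i w \<in> words Q i" "drop i w \<in> words Q j"
      using nz[OF that] p q unfolding free_module_simps(1) by blast+
    then show ?thesis unfolding words_iff
      by (metis append_take_drop_id length_append set_append le_sup_iff)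
  qed
  moreover have "finite {w. word_product i p q w \<noteq> \<zero>}"
  proof (rule finite_subset)
    show "{w. word_product i p q w \<noteq> \<zero>} \<subseteq> (\<lambda>(u, v). u @ v) ` ({w. p w \<noteq> \<zero>} \<times> {w. q w \<noteq> \<zero>})"
    proof
      fix w assume "w \<in> {w. word_product i p q w \<noteq> \<zero>}"
      then have "(take i w, drop i w) \<in> {w. p w \<noteq> \<zero>} \<times> {w. q w \<noteq> \<zero>}" using nz by simp
      then show "w \<in> (\<lambda>(u, v). u @ v) ` ({w. p w \<noteq> \<zero>} \<times> {w. q w \<noteq> \<zero>})"
        by (intro image_eqI[of _ _ "(take i w, drop i w)"]) simp_all
    qed
    show "finite ((\<lambda>(u, v). u @ v) ` ({w. p w \<noteq> \<zero>} \<times> {w. q w \<noteq> \<zero>}))"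
      using p q by (simp add: free_module_simps(1))
  qed
  moreover have "word_product i p q w \<in> carrier R" for w using pc qc by (simp add: word_product_def)
  ultimately show ?thesis unfolding free_module_simps(1) by blast
qed

lemma word_product_hom_left: "q \<in> carrier (FW j) \<Longrightarrow> (\<lambda>p. word_product i p q) \<in> module_hom R (FW i) (FW (i + j))"
  by (rule module_homI, rule word_product_closed)
    (simp_all add: free_module_simps(2,3) word_product_def free_module_component[OF cring_R] Q.l_distr Q.m_assoc)

lemma word_product_hom_right: "p \<in> carrier (FW i) \<Longrightarrow> word_product i p \<in> module_hom R (FW j) (FW (i + j))"
  by (rule module_homI, rule word_product_closed)
    (simp_all add: free_module_simps(2,3) word_product_def free_module_component[OF cring_R] Q.r_distr Q.m_lcomm)

lemma word_product_gen: "length u = i \<Longrightarrow> word_product i (free_gen R u) (free_gen R v) = free_gen R (u @ v)"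
  by (auto simp: word_product_def free_gen_def fun_eq_iff append_eq_conv_conj) (metis append_take_drop_id)

lemma free_hom_into_submodule:
  assumes "module R N" "h \<in> module_hom R (FW i) N" "submodule H R N"
    and "\<And>w. set w \<subseteq> carrier Q \<Longrightarrow> length w = i \<Longrightarrow> h (free_gen R w) \<in> H" and p: "p \<in> carrier (FW i)"
  shows "h p \<in> H"
proof -
  interpret N: module R N by fact
  note H = N.submoduleE[OF assms(3)] and h = assms(2)
  show ?thesis
  proof (rule free_module_induct[OF cring_R p])
    show "h \<zero>\<^bsub>FW i\<^esub> \<in> H"
      unfolding module_hom_zero[OF module_FW assms(1) h] by (rule submodule_zero[OF assms(1,3)])
    show "h (f \<oplus>\<^bsub>FW i\<^esub> g) \<in> H" if "f \<in> carrier (FW i)" "g \<in> carrier (FW i)" "h f \<in> H" "h g \<in> H" for f g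
      unfolding module_hom_add[OF h that(1,2)] by (rule H(5)[OF that(3,4)])
    show "h (r \<odot>\<^bsub>FW i\<^esub> free_gen R w) \<in> H" if r: "r \<in> carrier R" and w: "w \<in> words Q i" for r w
    proof -
      have "set w \<subseteq> carrier Q" "length w = i" using w by (simp_all add: words_iff)
      then show ?thesis using module_hom_smult[OF h r] H(4)[OF r] assms(4) gen_closed by simp
    qed
  qed
qed

text \<open>
  A linear map that sends each word \<open>w\<close> to \<open>u w v\<close> sends relations to relations, because it sends the
  multilinearity relations in a slot of \<open>w\<close> to those in the corresponding slot of \<open>u w v\<close>.
\<close>

lemma extension_preserves_rel:
  assumes h: "h \<in> module_hom R (FW i) (FW k)"
    and gen: "\<And>w. set w \<subseteq> carrier Q \<Longrightarrow> length w = i \<Longrightarrow> h (free_gen R w) = free_gen R (u @ w @ v)"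
    and uv: "set u \<subseteq> carrier Q" "set v \<subseteq> carrier Q" "length u + i + length v = k" and p: "p \<in> rel i"
  shows "h p \<in> rel k"
proof -
  have "h x \<in> rel_gens k" if "x \<in> rel_gens i" for x
    using that
  proof (cases rule: rel_gens_cases)
    case (add y z a b)
    have "h x = free_gen R ((u @ y) @ [a \<oplus>\<^bsub>Q\<^esub> b] @ (z @ v)) \<ominus>\<^bsub>FW k\<^esub>
        (free_gen R ((u @ y) @ [a] @ (z @ v)) \<oplus>\<^bsub>FW k\<^esub> free_gen R ((u @ y) @ [b] @ (z @ v)))"
      using add by (simp add: gen_closed module_hom_minus[OF module_FW module_FW h] module_hom_add[OF h] gen)
    moreover have "u @ y \<in> lists (carrier Q)" "z @ v \<in> lists (carrier Q)"
      "length (u @ y) + 1 + length (z @ v) = k" using add uv by auto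
    ultimately show ?thesis using add(1,2) unfolding rel_gens_def by blast
  next
    case (smult y z a r)
    have "h x = free_gen R ((u @ y) @ [r \<odot>\<^bsub>Q\<^esub> a] @ (z @ v)) \<ominus>\<^bsub>FW k\<^esub>
        r \<odot>\<^bsub>FW k\<^esub> free_gen R ((u @ y) @ [a] @ (z @ v))"
      using smult by (simp add: gen_closed module_hom_minus[OF module_FW module_FW h] module_hom_smult[OF h] gen)
    moreover have "u @ y \<in> lists (carrier Q)" "z @ v \<in> lists (carrier Q)"
      "length (u @ y) + 1 + length (z @ v) = k" using smult uv by auto
    ultimately show ?thesis using smult(1,2) unfolding rel_gens_def by blast
  qed
  then have "rel_gens i \<subseteq> {x \<in> carrier (FW i). h x \<in> rel k}"
    using rel_gens_carrier rel_gens_rel by blast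
  moreover have "submodule {x \<in> carrier (FW i). h x \<in> rel k} R (FW i)"
    by (rule submodule_kernel[OF module_FW module_FW h submodule_rel])
  ultimately show ?thesis using p generated_submodule_minimal unfolding rel_eq by blast
qed

lemma rel_carrier: "p \<in> rel i \<Longrightarrow> p \<in> carrier (FW i)"
  using F.submoduleE(1)[OF submodule_rel] by blast

lemma word_product_rel_left:
  assumes p: "p \<in> rel i" and q: "q \<in> carrier (FW j)"
  shows "word_product i p q \<in> rel (i + j)"
proof (rule free_hom_into_submodule[OF module_FW word_product_hom_right[OF rel_carrier[OF p]] submodule_rel _ q])
  show "word_product i p (free_gen R v) \<in> rel (i + j)" if v: "set v \<subseteq> carrier Q" "length v = j" for v
    by (rule extension_preserves_rel[OF word_product_hom_left[OF gen_closed[OF v]], where u = "[]" and v = v])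
      (use v p in \<open>simp_all add: word_product_gen\<close>)
qed

lemma word_product_rel_right:
  assumes p: "p \<in> carrier (FW i)" and q: "q \<in> rel j"
  shows "word_product i p q \<in> rel (i + j)"
proof (rule free_hom_into_submodule[OF module_FW word_product_hom_left[OF rel_carrier[OF q]] submodule_rel _ p])
  show "word_product i (free_gen R u) q \<in> rel (i + j)" if u: "set u \<subseteq> carrier Q" "length u = i" for u
    by (rule extension_preserves_rel[OF word_product_hom_right[OF gen_closed[OF u]], where u = u and v = "[]"])
      (use u q in \<open>simp_all add: word_product_gen\<close>)
qed

lemma tp_cls:
  assumes p: "p \<in> carrier (FW i)" and q: "q \<in> carrier (FW j)"
  shows "tp i j (cls i p) (cls j q) = cls (i + j) (word_product i p q)"
proof -
  note ceq = coset_eq_iff[OF module_FW submodule_rel]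
  have "cls (i + j) (word_product i p' q') = cls (i + j) (word_product i p q)" if "p' \<in> cls i p" "q' \<in> cls j q" for p' q'
  proof -
    have p': "p' \<in> carrier (FW i)" "p' \<ominus>\<^bsub>FW i\<^esub> p \<in> rel i"
      using coset_mem[OF module_FW submodule_rel p that(1)] ceq p by blast+
    have q': "q' \<in> carrier (FW j)" "q' \<ominus>\<^bsub>FW j\<^esub> q \<in> rel j"
      using coset_mem[OF module_FW submodule_rel q that(2)] ceq q by blast+
    have "cls (i + j) (word_product i p' q') = cls (i + j) (word_product i p q')"
      using word_product_rel_left[OF p'(2) q'(1)] module_hom_minus[OF module_FW module_FW word_product_hom_left[OF q'(1)] p'(1) p]
      by (simp add: ceq word_product_closed p p' q')
    also have "\<dots> = cls (i + j) (word_product i p q)"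
      using word_product_rel_right[OF p q'(2)] module_hom_minus[OF module_FW module_FW word_product_hom_right[OF p] q'(1) q]
      by (simp add: ceq word_product_closed p q q')
    finally show ?thesis .
  qed
  moreover have "p \<in> cls i p" "q \<in> cls j q"
    using abelian_subgroup.a_rcos_self[OF submodule_abelian_subgroup[OF module_FW submodule_rel]] p q by blast+
  moreover have "tp i j X Y = (\<Union>p\<in>X. \<Union>q\<in>Y. cls (i + j) (word_product i p q))" for X Y
    by (simp add: tensor_prod_def word_product_def)
  ultimately show ?thesis by blast
qed

lemma tp_closed [simp]:
  assumes "x \<in> carrier (T i)" "y \<in> carrier (T j)"
  shows "tp i j x y \<in> carrier (T (i + j))"
  using assms unfolding T_carrier by (force simp: tp_cls intro: word_product_closed)

lemma tp_pt: "set u \<subseteq> carrier Q \<Longrightarrow> length u = i \<Longrightarrow> set v \<subseteq> carrier Q \<Longrightarrow> length v = j \<Longrightarrow>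
    tp i j (pt u) (pt v) = pt (u @ v)"
  by (simp add: pt_eq[of u i] pt_eq[of v j] pt_eq[of _ "i + j"] tp_cls gen_closed word_product_gen)

lemma tp_hom_left:
  assumes y: "y \<in> carrier (T j)"
  shows "(\<lambda>x. tp i j x y) \<in> module_hom R (T i) (T (i + j))"
proof -
  obtain q where q: "q \<in> carrier (FW j)" "y = cls j q" using y unfolding T_carrier by blast
  note l = word_product_hom_left[OF q(1), of i]
  show ?thesis
  proof (rule module_homI)
    fix x assume x': "x \<in> carrier (T i)"
    then show "tp i j x y \<in> carrier (T (i + j))" using y by simp
    obtain p where p: "p \<in> carrier (FW i)" "x = cls i p" using x' unfolding T_carrier by blast
    show "tp i j (r \<odot>\<^bsub>T i\<^esub> x) y = r \<odot>\<^bsub>T (i + j)\<^esub> tp i j x y" if "r \<in> carrier R" for r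
      using p q that by (simp add: tp_cls module_hom_smult[OF l] word_product_closed flip: module_hom_smult[OF cls_hom])
    fix z assume "z \<in> carrier (T i)"
    then obtain p' where p': "p' \<in> carrier (FW i)" "z = cls i p'" unfolding T_carrier by blast
    show "tp i j (x \<oplus>\<^bsub>T i\<^esub> z) y = tp i j x y \<oplus>\<^bsub>T (i + j)\<^esub> tp i j z y"
      using p p' q by (simp add: tp_cls module_hom_add[OF l] word_product_closed flip: module_hom_add[OF cls_hom])
  qed
qed

lemma tp_hom_right:
  assumes x: "x \<in> carrier (T i)"
  shows "tp i j x \<in> module_hom R (T j) (T (i + j))"
proof -
  obtain p where p: "p \<in> carrier (FW i)" "x = cls i p" using x unfolding T_carrier by blast
  note l = word_product_hom_right[OF p(1), of j]
  show ?thesis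
  proof (rule module_homI)
    fix y assume y': "y \<in> carrier (T j)"
    then show "tp i j x y \<in> carrier (T (i + j))" using x by simp
    obtain q where q: "q \<in> carrier (FW j)" "y = cls j q" using y' unfolding T_carrier by blast
    show "tp i j x (r \<odot>\<^bsub>T j\<^esub> y) = r \<odot>\<^bsub>T (i + j)\<^esub> tp i j x y" if "r \<in> carrier R" for r
      using p q that by (simp add: tp_cls module_hom_smult[OF l] word_product_closed flip: module_hom_smult[OF cls_hom])
    fix z assume "z \<in> carrier (T j)"
    then obtain q' where q': "q' \<in> carrier (FW j)" "z = cls j q'" unfolding T_carrier by blast
    show "tp i j x (y \<oplus>\<^bsub>T j\<^esub> z) = tp i j x y \<oplus>\<^bsub>T (i + j)\<^esub> tp i j x z"
      using p q q' by (simp add: tp_cls module_hom_add[OF l] word_product_closed flip: module_hom_add[OF cls_hom])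
  qed
qed

lemmas tp_smult_left = module_hom_smult[OF tp_hom_left]
lemmas tp_smult_right = module_hom_smult[OF tp_hom_right]

lemma tp_zero_left: "y \<in> carrier (T j) \<Longrightarrow> tp i j \<zero>\<^bsub>T i\<^esub> y = \<zero>\<^bsub>T (i + j)\<^esub>"
  by (rule module_hom_zero[OF module_T module_T tp_hom_left])

lemma tp_zero_right: "x \<in> carrier (T i) \<Longrightarrow> tp i j x \<zero>\<^bsub>T j\<^esub> = \<zero>\<^bsub>T (i + j)\<^esub>"
  by (rule module_hom_zero[OF module_T module_T tp_hom_right])

text \<open>Both sides are linear in each argument, and on pure tensors they are concatenations of words.\<close>

lemma tp_assoc:
  assumes x: "x \<in> carrier (T i)" and y: "y \<in> carrier (T j)" and z: "z \<in> carrier (T k)"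
  shows "tp (i + j) k (tp i j x y) z = tp i (j + k) x (tp j k y z)"
proof (rule T_hom_eq[OF _ _ x, where f = "\<lambda>x. tp (i + j) k (tp i j x y) z"])
  show "(\<lambda>x. tp (i + j) k (tp i j x y) z) \<in> module_hom R (T i) (T (i + j + k))"
    by (rule module_hom_comp[OF tp_hom_left[OF y] tp_hom_left[OF z]])
  show "(\<lambda>x. tp i (j + k) x (tp j k y z)) \<in> module_hom R (T i) (T (i + j + k))"
    using tp_hom_left[OF tp_closed[OF y z]] by (simp add: add.assoc)
  fix u assume u: "set u \<subseteq> carrier Q" "length u = i"
  have uc: "pt u \<in> carrier (T i)" using u by simp
  show "tp (i + j) k (tp i j (pt u) y) z = tp i (j + k) (pt u) (tp j k y z)"
  proof (rule T_hom_eq[OF _ _ y, where f = "\<lambda>y. tp (i + j) k (tp i j (pt u) y) z"])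
    show "(\<lambda>y. tp (i + j) k (tp i j (pt u) y) z) \<in> module_hom R (T j) (T (i + j + k))"
      by (rule module_hom_comp[OF tp_hom_right[OF uc] tp_hom_left[OF z]])
    show "(\<lambda>y. tp i (j + k) (pt u) (tp j k y z)) \<in> module_hom R (T j) (T (i + j + k))"
      using module_hom_comp[OF tp_hom_left[OF z] tp_hom_right[OF uc]] by (simp add: add.assoc)
    fix v assume v: "set v \<subseteq> carrier Q" "length v = j"
    have vc: "pt v \<in> carrier (T j)" using v by simp
    show "tp (i + j) k (tp i j (pt u) (pt v)) z = tp i (j + k) (pt u) (tp j k (pt v) z)"
    proof (rule T_hom_eq[OF _ _ z, where f = "tp (i + j) k (tp i j (pt u) (pt v))"])
      show "tp (i + j) k (tp i j (pt u) (pt v)) \<in> module_hom R (T k) (T (i + j + k))"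
        by (rule tp_hom_right[OF tp_closed[OF uc vc]])
      show "(\<lambda>z. tp i (j + k) (pt u) (tp j k (pt v) z)) \<in> module_hom R (T k) (T (i + j + k))"
        using module_hom_comp[OF tp_hom_right[OF vc] tp_hom_right[OF uc]] by (simp add: add.assoc)
    qed (use u v in \<open>simp add: tp_pt\<close>)
  qed
qed

lemma id_hom: "(\<lambda>x. x) \<in> module_hom R (T i) (T i)"
  by (rule module_homI) simp_all

lemma tp_one_left: "x \<in> carrier (T i) \<Longrightarrow> tp 0 i (pt []) x = x"
  by (rule T_hom_eq[OF _ id_hom])
    (use tp_hom_right[of "pt []" 0 i] tp_pt[of "[]" 0 _ i] in simp_all)

text \<open>
  There are no relations in degree \<open>0\<close>: the constant \<open>1\<close> is multilinear there, and lifts to a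
  functional with value \<open>1\<close> at the empty tensor.
\<close>

lemma T0_scalar_inj:
  assumes "r \<in> carrier R" "r \<odot>\<^bsub>T 0\<^esub> pt [] = \<zero>\<^bsub>T 0\<^esub>"
  shows "r = \<zero>"
proof -
  note RM = module_ring_module[OF cring_R]
  have m: "multilinear 0 (ring_module R) (\<lambda>_. \<one>)" by (simp add: multilinear_def)
  note h = tensor_lift_hom[OF RM m]
  have "r \<otimes> tensor_lift R (ring_module R) (\<lambda>_. \<one>) (pt []) = \<zero>"
    using module_hom_smult[OF h assms(1), of "pt []"] module_hom_zero[OF module_T RM h] assms(2) by simp
  then show ?thesis using assms(1) by (simp add: tensor_lift_pt[OF RM m])
qed

end

section \<open>The product of the tensor algebra\<close>

context tensor_powers
begin

interpretation Q: module R Q by (rule module_Q)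
interpretation T: module R "T i" for i by (rule module_T)

text \<open>The product of the tensor algebra as a plain function, for which bilinearity is stated.\<close>

definition tensor_mult :: "(nat \<Rightarrow> ('q list \<Rightarrow> 'r) set) \<Rightarrow> (nat \<Rightarrow> ('q list \<Rightarrow> 'r) set) \<Rightarrow> nat \<Rightarrow> ('q list \<Rightarrow> 'r) set" where
  "tensor_mult x y = (\<lambda>k. \<Oplus>\<^bsub>T k\<^esub>i\<in>{..k}. tp i (k - i) (x i) (y (k - i)))"

abbreviation "DS I \<equiv> direct_sum I T"

lemma module_DS: "module R (DS I)"
  by (rule module_direct_sum[OF cring_R module_T])

lemma inject_hom: "i \<in> I \<Longrightarrow> ds_inject T i \<in> module_hom R (T i) (DS I)"
  by (rule ds_inject_hom[OF cring_R module_T])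

lemma tensor_algebra_mult: "x \<otimes>\<^bsub>tensor_algebra R Q\<^esub> y = tensor_mult x y"
  by (simp add: tensor_algebra_def tensor_mult_def)

lemma DS_comp: "x \<in> carrier (DS I) \<Longrightarrow> x i \<in> carrier (T i)"
  by (rule direct_sum_component[OF cring_R module_T])

lemma tensor_mult_summand_closed:
  assumes "x \<in> carrier (DS UNIV)" "y \<in> carrier (DS UNIV)" "i \<in> {..k}"
  shows "tp i (k - i) (x i) (y (k - i)) \<in> carrier (T k)"
  using tp_closed[OF DS_comp[OF assms(1)] DS_comp[OF assms(2)], of i "k - i"] assms(3) by simp

lemma tensor_mult_closed:
  assumes x: "x \<in> carrier (DS UNIV)" and y: "y \<in> carrier (DS UNIV)"
  shows "tensor_mult x y \<in> carrier (DS UNIV)"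
proof -
  let ?s = "\<lambda>x. {i. x i \<noteq> \<zero>\<^bsub>T i\<^esub>}"
  have c: "tensor_mult x y k \<in> carrier (T k)" for k
    unfolding tensor_mult_def by (rule T.finsum_closed) (use tensor_mult_summand_closed[OF x y] in simp)
  have "?s (tensor_mult x y) \<subseteq> (\<lambda>(i, j). i + j) ` (?s x \<times> ?s y)"
  proof
    fix k assume k: "k \<in> ?s (tensor_mult x y)"
    show "k \<in> (\<lambda>(i, j). i + j) ` (?s x \<times> ?s y)"
    proof (rule ccontr)
      assume n: "k \<notin> (\<lambda>(i, j). i + j) ` (?s x \<times> ?s y)"
      have "tp i (k - i) (x i) (y (k - i)) = \<zero>\<^bsub>T k\<^esub>" if i: "i \<in> {..k}" for i
      proof -
        have ik: "i + (k - i) = k" using i by simp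
        then have "x i = \<zero>\<^bsub>T i\<^esub> \<or> y (k - i) = \<zero>\<^bsub>T (k - i)\<^esub>"
          using n by (metis (mono_tags, lifting) SigmaI case_prod_conv image_eqI mem_Collect_eq)
        then show ?thesis
          using tp_zero_left[OF DS_comp[OF y], of i "k - i"] tp_zero_right[OF DS_comp[OF x], of i "k - i"] ik
          by auto
      qed
      then have "tensor_mult x y k = \<zero>\<^bsub>T k\<^esub>" unfolding tensor_mult_def by (rule T.add.finprod_one_eqI)
      then show False using k by simp
    qed
  qed
  moreover have "finite ((\<lambda>(i, j). i + j) ` (?s x \<times> ?s y))"
    using x y by (simp add: direct_sum_carrier)
  ultimately have "finite (?s (tensor_mult x y))" by (rule finite_subset)
  then show ?thesis using c by (simp add: direct_sum_carrier)
qed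

lemma component_hom: "(\<lambda>x. x i) \<in> module_hom R (DS I) (T i)"
  by (rule ds_component_hom[where M = T, OF cring_R module_T])

text \<open>In each degree the product is a finite sum of maps that are linear in \<open>x\<close>.\<close>

lemma tensor_mult_hom_left:
  assumes y: "y \<in> carrier (DS UNIV)"
  shows "(\<lambda>x. tensor_mult x y) \<in> module_hom R (DS UNIV) (DS UNIV)"
proof (rule hom_into_direct_sum[where M = T, OF cring_R module_T tensor_mult_closed[OF _ y]])
  fix k
  have "(\<lambda>x. tp i (k - i) (x i) (y (k - i))) \<in> module_hom R (DS UNIV) (T k)" if "i \<in> {..k}" for i
    using module_hom_comp[OF component_hom[of i UNIV] tp_hom_left[OF DS_comp[OF y, of "k - i"]]] that by simp
  then show "(\<lambda>x. tensor_mult x y k) \<in> module_hom R (DS UNIV) (T k)"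
    unfolding tensor_mult_def by (intro module_hom_sum[OF module_DS module_T]) simp_all
qed

lemma tensor_mult_hom_right:
  assumes x: "x \<in> carrier (DS UNIV)"
  shows "tensor_mult x \<in> module_hom R (DS UNIV) (DS UNIV)"
proof (rule hom_into_direct_sum[where M = T, OF cring_R module_T tensor_mult_closed[OF x]])
  fix k
  have "(\<lambda>y. tp i (k - i) (x i) (y (k - i))) \<in> module_hom R (DS UNIV) (T k)" if "i \<in> {..k}" for i
    using module_hom_comp[OF component_hom[of "k - i" UNIV] tp_hom_right[OF DS_comp[OF x, of i]]] that by simp
  then show "(\<lambda>y. tensor_mult x y k) \<in> module_hom R (DS UNIV) (T k)"
    unfolding tensor_mult_def by (intro module_hom_sum[OF module_DS module_T]) simp_all
qed

lemma tensor_mult_inject: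
  assumes a: "a \<in> carrier (T i)" and b: "b \<in> carrier (T j)"
  shows "tensor_mult (ds_inject T i a) (ds_inject T j b) = ds_inject T (i + j) (tp i j a b)"
proof
  fix k
  let ?t = "\<lambda>l. tp l (k - l) (ds_inject T i a l) (ds_inject T j b (k - l))"
  have zero: "?t l = \<zero>\<^bsub>T k\<^esub>" if "l \<in> {..k}" "l \<noteq> i \<or> k - l \<noteq> j" for l
  proof -
    have lk: "l + (k - l) = k" using that by simp
    have c: "ds_inject T i a l \<in> carrier (T l)" "ds_inject T j b (k - l) \<in> carrier (T (k - l))"
      using a b by (simp_all add: ds_inject_apply)
    have "ds_inject T i a l = \<zero>\<^bsub>T l\<^esub> \<or> ds_inject T j b (k - l) = \<zero>\<^bsub>T (k - l)\<^esub>"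
      using that(2) by (auto simp: ds_inject_apply)
    then show ?thesis using tp_zero_left[OF c(2), of l] tp_zero_right[OF c(1), of "k - l"] lk by auto
  qed
  show "tensor_mult (ds_inject T i a) (ds_inject T j b) k = ds_inject T (i + j) (tp i j a b) k"
  proof (cases "k = i + j")
    case True
    have "tensor_mult (ds_inject T i a) (ds_inject T j b) k =
        (\<Oplus>\<^bsub>T k\<^esub>l\<in>{..k}. if i = l then tp i j a b else \<zero>\<^bsub>T k\<^esub>)"
      unfolding tensor_mult_def
    proof (rule T.finsum_cong')
      fix l assume l: "l \<in> {..k}"
      show "?t l = (if i = l then tp i j a b else \<zero>\<^bsub>T k\<^esub>)"
      proof (cases "i = l")
        case i: True
        then have "k - l = j" using True by simp
        then show ?thesis using i by simp
      qed (use zero[OF l] in simp)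
    qed (use tp_closed[OF a b] True in auto)
    also have "\<dots> = tp i j a b"
      using tp_closed[OF a b] True by (intro T.finsum_singleton) auto
    finally show ?thesis using True by simp
  next
    case False
    have "tensor_mult (ds_inject T i a) (ds_inject T j b) k = \<zero>\<^bsub>T k\<^esub>"
      unfolding tensor_mult_def by (rule T.add.finprod_one_eqI, rule zero) (use False in auto)
    then show ?thesis using False by (simp add: ds_inject_apply)
  qed
qed

lemma DS_mono:
  assumes x: "x \<in> carrier (DS I)" and I: "I \<subseteq> J"
  shows "x \<in> carrier (DS J)"
proof -
  have "x i = \<zero>\<^bsub>T i\<^esub>" if "i \<notin> J" for i using x I that by (auto simp: direct_sum_carrier)
  then show ?thesis using x DS_comp[OF x] by (simp add: direct_sum_carrier)
qed

lemma hom_DS_mono: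
  assumes f: "f \<in> module_hom R (DS J) N" and I: "I \<subseteq> J"
  shows "f \<in> module_hom R (DS I) N"
proof (rule module_homI)
  fix x assume "x \<in> carrier (DS I)"
  then have x: "x \<in> carrier (DS J)" by (rule DS_mono[OF _ I])
  show "f x \<in> carrier N" by (rule module_hom_closed[OF f x])
  show "f (r \<odot>\<^bsub>DS I\<^esub> x) = r \<odot>\<^bsub>N\<^esub> f x" if "r \<in> carrier R" for r
    using module_hom_smult[OF f that x] by simp
  fix y assume "y \<in> carrier (DS I)"
  then have "y \<in> carrier (DS J)" by (rule DS_mono[OF _ I])
  then show "f (x \<oplus>\<^bsub>DS I\<^esub> y) = f x \<oplus>\<^bsub>N\<^esub> f y" using module_hom_add[OF f x] by simp
qed

end

section \<open>Saturated sets\<close>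

lemma closed_multiples:
  fixes I :: "nat set"
  assumes "0 \<in> I" "\<forall>i\<in>I. \<forall>j\<in>I. (i + j) mod m \<in> I" "i \<in> I"
  shows "(k * i) mod m \<in> I"
proof (induction k)
  case (Suc k)
  then have "(i + k * i mod m) mod m \<in> I" using assms by blast
  then show ?case by (simp add: mod_add_right_eq)
qed (use assms in simp)

text \<open>Closure under addition and \<open>0\<close> suffice for a subgroup because \<open>- i\<close> is the multiple \<open>(m - 1) i\<close> modulo \<open>m\<close>.\<close>

lemma saturated_iff:
  assumes m: "m \<ge> 1" and I: "I \<subseteq> {0..<m}"
  shows "saturated m I \<longleftrightarrow> 0 \<in> I \<and> (\<forall>i\<in>I. \<forall>j\<in>I. (i + j) mod m \<in> I)"
proof
  assume "saturated m I"
  then interpret subgroup "int ` I" "integer_mod_group m" by (simp add: saturated_def)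
  have "(i + j) mod m \<in> I" if "i \<in> I" "j \<in> I" for i j
  proof -
    have "(int i + int j) mod int m \<in> int ` I" using m_closed[of "int i" "int j"] that by simp
    then show ?thesis by (auto simp flip: of_nat_add of_nat_mod)
  qed
  moreover have "0 \<in> I" using one_closed by auto
  ultimately show "0 \<in> I \<and> (\<forall>i\<in>I. \<forall>j\<in>I. (i + j) mod m \<in> I)" by blast
next
  assume c: "0 \<in> I \<and> (\<forall>i\<in>I. \<forall>j\<in>I. (i + j) mod m \<in> I)"
  have carrier: "int i \<in> carrier (integer_mod_group m)" if "i \<in> I" for i
    using that I m by (auto simp: carrier_integer_mod_group)
  have inv: "(- int i) mod int m \<in> int ` I" if "i \<in> I" for i
  proof -
    have "int ((m - 1) * i mod m) = (int m * int i - int i) mod int m"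
      using m by (simp add: of_nat_mod of_nat_diff left_diff_distrib)
    also have "\<dots> = (- int i) mod int m" by (metis mod_mult_self2 add.commute uminus_add_conv_diff mult.commute)
    finally have "(- int i) mod int m = int ((m - 1) * i mod m)" by simp
    moreover have "(m - 1) * i mod m \<in> I" using closed_multiples[of I m i "m - 1"] c that by blast
    ultimately show ?thesis by simp
  qed
  show "saturated m I"
    unfolding saturated_def
  proof
    show "int ` I \<subseteq> carrier (integer_mod_group m)" using carrier by blast
    show "x \<otimes>\<^bsub>integer_mod_group m\<^esub> y \<in> int ` I" if xy: "x \<in> int ` I" "y \<in> int ` I" for x y
    proof -
      obtain i j where "i \<in> I" "j \<in> I" "x = int i" "y = int j" using xy by blast
      then show ?thesis using c by (simp flip: of_nat_add of_nat_mod)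
    qed
    show "\<one>\<^bsub>integer_mod_group m\<^esub> \<in> int ` I" using c by force
    show "inv\<^bsub>integer_mod_group m\<^esub> x \<in> int ` I" if "x \<in> int ` I" for x
      using that inv carrier by auto
  qed
qed

text \<open>The divisor is the least positive element of \<open>I\<close>, and \<open>m\<close> if there is none.\<close>

lemma saturated_multiples:
  assumes m: "m \<ge> 1" and I: "I \<subseteq> {0..<m}" and sat: "saturated m I"
  shows "\<exists>d n. d * n = m \<and> n \<ge> 1 \<and> I = (\<lambda>k. d * k) ` {..<n}"
proof (cases "I = {0}")
  case True
  then show ?thesis by (intro exI[of _ m] exI[of _ 1]) auto
next
  case False
  have z: "0 \<in> I" and c: "\<forall>i\<in>I. \<forall>j\<in>I. (i + j) mod m \<in> I"
    using sat saturated_iff[OF m I] by blast+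
  note mult = closed_multiples[OF z c]
  define d where "d = (LEAST d. d > 0 \<and> d \<in> I)"
  have "\<exists>d. d > 0 \<and> d \<in> I" using False z by (metis bot_nat_0.not_eq_extremum insert_absorb insert_iff subsetI subset_singletonD)
  then have d: "d > 0" "d \<in> I" unfolding d_def by (metis (mono_tags, lifting) LeastI_ex)+
  have least: "i = 0" if "i \<in> I" "i < d" for i
    using that not_less_Least[of i "\<lambda>d. d > 0 \<and> d \<in> I"] unfolding d_def[symmetric] by auto
  have dm: "d < m" using d I by auto
  have dvd: "d dvd i" if i: "i \<in> I" for i
  proof -
    let ?q = "i div d"
    \<comment> \<open>modulo \<open>m\<close>, subtracting \<open>d\<close> means adding \<open>(m - 1) d\<close>\<close>
    have "i + ((m - 1) * ?q) * d = i mod d + m * (?q * d)"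
    proof -
      have "i = i mod d + ?q * d" by simp
      moreover have "m * (?q * d) = (m - 1) * (?q * d) + ?q * d" using m by (cases m) simp_all
      ultimately show ?thesis by (simp add: mult.assoc)
    qed
    then have "(i + ((m - 1) * ?q) * d) mod m = i mod d"
      using order.strict_trans[OF mod_less_divisor[OF d(1)] dm] by simp
    moreover have "(i + ((m - 1) * ?q) * d) mod m \<in> I"
      using c i mult[OF d(2), of "(m - 1) * ?q"] by (metis mod_add_right_eq)
    ultimately have "i mod d \<in> I" by simp
    then show ?thesis using least[of "i mod d"] d(1) by auto
  qed
  have "d dvd m"
  proof -
    let ?q = "m div d"
    have q: "?q * d + m mod d = m" by simp
    have "?q > 0" using dm d(1) by (simp add: div_greater_zero_iff)
    then have q1: "?q * d \<ge> 1" using d(1) by (simp add: Suc_le_eq)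
    \<comment> \<open>the residue \<open>m mod d\<close> is \<open>- (m div d) d\<close> modulo \<open>m\<close>, and so lies in \<open>I\<close>\<close>
    have "((m - 1) * ?q) * d = m * (?q * d - 1) + m mod d"
    proof -
      have "(m - 1) * (?q * d) + ?q * d = m * (?q * d)" using m by (cases m) simp_all
      moreover have "m * (?q * d) = m * (?q * d - 1) + m" using q1 by (cases "?q * d") simp_all
      ultimately have "(m - 1) * (?q * d) = m * (?q * d - 1) + m mod d" using q by linarith
      then show ?thesis by (simp only: mult.assoc)
    qed
    then have "((m - 1) * ?q) * d mod m = m mod d"
      using order.strict_trans[OF mod_less_divisor[OF d(1)] dm] by simp
    then have "m mod d \<in> I" using mult[OF d(2), of "(m - 1) * ?q"] by simp
    then show ?thesis using least[of "m mod d"] d(1) by auto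
  qed
  then obtain n where n: "d * n = m" by (metis dvd_def)
  have "I = (\<lambda>k. d * k) ` {..<n}"
  proof
    show "I \<subseteq> (\<lambda>k. d * k) ` {..<n}"
    proof
      fix i assume i: "i \<in> I"
      then obtain k where k: "i = d * k" using dvd by (metis dvd_def)
      have "i < m" using i I by auto
      then have "k < n" using k n d(1) by auto
      then show "i \<in> (\<lambda>k. d * k) ` {..<n}" using k by blast
    qed
    show "(\<lambda>k. d * k) ` {..<n} \<subseteq> I"
    proof
      fix i assume "i \<in> (\<lambda>k. d * k) ` {..<n}"
      then obtain k where k: "k < n" "i = k * d" by (auto simp: mult.commute)
      then have "i < m" using n d(1) by (auto simp: mult.commute)
      then show "i \<in> I" using mult[OF d(2), of k] k by simp
    qed
  qed
  moreover have "n \<ge> 1" using n m by (cases n) auto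
  ultimately show ?thesis using n by blast
qed

section \<open>The tensor algebra of an invertible module\<close>

locale invertible_tensor_power = tensor_powers R Q
  for R :: "('r, 'z) ring_scheme" (structure) and Q :: "('r, 'q, 'x) module_scheme" +
  fixes m :: nat and \<phi> :: "('q list \<Rightarrow> 'r) set \<Rightarrow> 'r"
  assumes m_pos: "m \<ge> 1" and phi: "\<phi> \<in> module_iso R (T m) (ring_module R)"
begin

interpretation Q: module R Q by (rule module_Q)
interpretation T: module R "T i" for i by (rule module_T)

lemma phi_hom: "\<phi> \<in> module_hom R (T m) (ring_module R)"
  using phi by (simp add: module_iso_def)

lemma phi_closed [simp]: "x \<in> carrier (T m) \<Longrightarrow> \<phi> x \<in> carrier R"
  using module_hom_closed[OF phi_hom] by simp

text \<open>The tensor \<open>\<epsilon>\<close> with \<open>\<phi>(\<epsilon>) = 1\<close>, a basis of \<open>Q\<^sup>\<otimes>\<^sup>m\<close>.\<close>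

definition eps :: "('q list \<Rightarrow> 'r) set" where
  "eps = inv_into (carrier (T m)) \<phi> \<one>"

lemma eps_closed [simp]: "eps \<in> carrier (T m)" and phi_eps [simp]: "\<phi> eps = \<one>"
proof -
  have "\<one> \<in> \<phi> ` carrier (T m)" using phi by (simp add: module_iso_def bij_betw_def)
  then show "eps \<in> carrier (T m)" "\<phi> eps = \<one>"
    unfolding eps_def by (rule inv_into_into, rule f_inv_into_f)
qed

lemma phi_smult_eps:
  assumes x: "x \<in> carrier (T m)"
  shows "\<phi> x \<odot>\<^bsub>T m\<^esub> eps = x"
proof -
  have "\<phi> (\<phi> x \<odot>\<^bsub>T m\<^esub> eps) = \<phi> x" using x by (simp add: module_hom_smult[OF phi_hom])
  then show ?thesis using phi x by (auto simp: module_iso_def bij_betw_def dest: inj_onD)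
qed

subsection \<open>Contraction\<close>

abbreviation "ctr \<equiv> contract R Q m \<phi>"

text \<open>The slot that varies lies either in the part of the word that \<open>\<phi>\<close> consumes or in the rest.\<close>

lemma contract_multilinear:
  assumes i: "m \<le> i"
  shows "multilinear i (T (i - m)) (\<lambda>w. \<phi> (pt (take m w)) \<odot>\<^bsub>T (i - m)\<^esub> pt (drop m w))"
  unfolding multilinear_def
proof (intro conjI allI impI)
  fix w :: "'q list" assume "set w \<subseteq> carrier Q" "length w = i"
  then have "set (take m w) \<subseteq> carrier Q" "set (drop m w) \<subseteq> carrier Q" "length (take m w) = m"
    "length (drop m w) = i - m"
    using i set_take_subset[of m w] set_drop_subset[of m w] by auto
  then show "\<phi> (pt (take m w)) \<odot>\<^bsub>T (i - m)\<^esub> pt (drop m w) \<in> carrier (T (i - m))" by simp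
next
  fix u v :: "'q list" assume u: "set u \<subseteq> carrier Q" and v: "set v \<subseteq> carrier Q"
    and l: "length u + 1 + length v = i"
  show "(\<lambda>a. \<phi> (pt (take m (u @ [a] @ v))) \<odot>\<^bsub>T (i - m)\<^esub> pt (drop m (u @ [a] @ v)))
      \<in> module_hom R Q (T (i - m))"
  proof (cases "length u < m")
    case True
    then obtain k where k: "m = length u + Suc k" using less_imp_Suc_add by fastforce
    let ?y = "take k v" and ?z = "drop k v"
    have yz: "set ?y \<subseteq> carrier Q" "set ?z \<subseteq> carrier Q"
      using v set_take_subset[of k v] set_drop_subset[of k v] by auto
    have slot: "(\<lambda>a. pt (u @ [a] @ ?y)) \<in> module_hom R Q (T m)"
      by (rule pt_slot[OF u yz(1)]) (use k l i in simp)
    have "pt ?z \<in> carrier (T (i - m))" using yz k l by simp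
    from module_hom_comp[OF module_hom_comp[OF slot phi_hom] smult_right_hom[OF module_T this]]
    show ?thesis by (simp add: k)
  next
    case False
    let ?y = "drop m u" and ?x = "take m u"
    have xy: "set ?x \<subseteq> carrier Q" "set ?y \<subseteq> carrier Q"
      using u set_take_subset[of m u] set_drop_subset[of m u] by auto
    have slot: "(\<lambda>a. pt (?y @ [a] @ v)) \<in> module_hom R Q (T (i - m))"
      by (rule pt_slot[OF xy(2) v]) (use False l in simp)
    have "\<phi> (pt ?x) \<in> carrier R" using xy False by simp
    from module_hom_comp[OF slot smult_left_hom[OF module_T this]] show ?thesis using False by simp
  qed
qed

lemma contract_hom: "ctr (m + j) \<in> module_hom R (T (m + j)) (T j)"
  using tensor_lift_hom[OF module_T contract_multilinear[of "m + j"]] by (simp add: contract_def)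

lemmas contract_closed [simp] = module_hom_closed[OF contract_hom]
lemmas contract_smult = module_hom_smult[OF contract_hom]

text \<open>By definition the formula holds for pure tensors; both sides are linear in \<open>x\<close> and in \<open>y\<close>.\<close>

lemma contract_tp:
  assumes x: "x \<in> carrier (T m)" and y: "y \<in> carrier (T j)"
  shows "ctr (m + j) (tp m j x y) = \<phi> x \<odot>\<^bsub>T j\<^esub> y"
proof (rule T_hom_eq[OF _ _ x, where f = "\<lambda>x. ctr (m + j) (tp m j x y)"])
  show "(\<lambda>x. ctr (m + j) (tp m j x y)) \<in> module_hom R (T m) (T j)"
    by (rule module_hom_comp[OF tp_hom_left[OF y] contract_hom])
  show "(\<lambda>x. \<phi> x \<odot>\<^bsub>T j\<^esub> y) \<in> module_hom R (T m) (T j)"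
    by (rule module_hom_comp[OF phi_hom smult_right_hom[OF module_T y]])
  fix u assume u: "set u \<subseteq> carrier Q" "length u = m"
  have uc: "pt u \<in> carrier (T m)" using u by simp
  show "ctr (m + j) (tp m j (pt u) y) = \<phi> (pt u) \<odot>\<^bsub>T j\<^esub> y"
  proof (rule T_hom_eq[OF _ _ y, where f = "\<lambda>y. ctr (m + j) (tp m j (pt u) y)"])
    show "(\<lambda>y. ctr (m + j) (tp m j (pt u) y)) \<in> module_hom R (T j) (T j)"
      by (rule module_hom_comp[OF tp_hom_right[OF uc] contract_hom])
    show "(\<lambda>y. \<phi> (pt u) \<odot>\<^bsub>T j\<^esub> y) \<in> module_hom R (T j) (T j)"
      by (rule smult_left_hom[OF module_T phi_closed[OF uc]])
    fix v assume v: "set v \<subseteq> carrier Q" "length v = j"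
    show "ctr (m + j) (tp m j (pt u) (pt v)) = \<phi> (pt u) \<odot>\<^bsub>T j\<^esub> pt v"
      using u v tensor_lift_pt[OF module_T contract_multilinear[of "m + j"], of "u @ v"]
      by (simp add: tp_pt contract_def)
  qed
qed

text \<open>
  Contraction replaces the first \<open>m\<close> factors \<open>u\<close> by \<open>\<phi>(u)\<close>, and \<open>\<phi>(u) \<epsilon> = u\<close> puts them back.  So every tensor
  of degree at least \<open>m\<close> is divisible by \<open>\<epsilon>\<close>.
\<close>

lemma eps_contract:
  assumes x: "x \<in> carrier (T (m + j))"
  shows "tp m j eps (ctr (m + j) x) = x"
proof (rule T_hom_eq[OF _ id_hom x, where f = "\<lambda>x. tp m j eps (ctr (m + j) x)"])
  show "(\<lambda>x. tp m j eps (ctr (m + j) x)) \<in> module_hom R (T (m + j)) (T (m + j))"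
    by (rule module_hom_comp[OF contract_hom tp_hom_right[OF eps_closed]])
  fix w assume w: "set w \<subseteq> carrier Q" "length w = m + j"
  let ?u = "take m w" and ?v = "drop m w"
  have u: "set ?u \<subseteq> carrier Q" "length ?u = m" and v: "set ?v \<subseteq> carrier Q" "length ?v = j"
    using w set_take_subset[of m w] set_drop_subset[of m w] by auto
  have c: "pt ?u \<in> carrier (T m)" "pt ?v \<in> carrier (T j)" using u v by simp_all
  have "tp m j eps (ctr (m + j) (tp m j (pt ?u) (pt ?v))) = tp m j (\<phi> (pt ?u) \<odot>\<^bsub>T m\<^esub> eps) (pt ?v)"
    using c by (simp add: contract_tp tp_smult_left tp_smult_right)
  also have "\<dots> = tp m j (pt ?u) (pt ?v)" using c(1) by (simp add: phi_smult_eps)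
  finally show "tp m j eps (ctr (m + j) (pt w)) = pt w" using u v by (simp add: tp_pt)
qed

subsection \<open>Local vanishing\<close>

text \<open>The tensor \<open>\<epsilon>\<close> is a linear combination of pure tensors, and \<open>\<phi>(\<epsilon>) = 1\<close>.\<close>

lemma unit_ideal:
  "\<exists>W c. finite W \<and> (\<forall>w\<in>W. set w \<subseteq> carrier Q \<and> length w = m) \<and> c \<in> W \<rightarrow> carrier R \<and>
    (\<Oplus>w\<in>W. c w \<otimes> \<phi> (pt w)) = \<one>"
proof -
  note RM = module_ring_module[OF cring_R]
  have g: "(\<lambda>w. \<phi> (pt w)) \<in> words Q m \<rightarrow> carrier (ring_module R)"
    by (rule Pi_I) (simp add: words_iff)
  obtain p where p: "p \<in> carrier (FW m)" "eps = cls m p" using eps_closed unfolding T_carrier by blast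
  let ?W = "{w. p w \<noteq> \<zero>}"
  note h1 = module_hom_comp[OF cls_hom phi_hom] and h2 = free_lift_hom[OF cring_R RM g]
  have "\<phi> (cls m p) = free_lift R (ring_module R) (\<lambda>w. \<phi> (pt w)) p"
  proof (rule free_module_induct[OF cring_R p(1)])
    show "\<phi> (cls m \<zero>\<^bsub>FW m\<^esub>) = free_lift R (ring_module R) (\<lambda>w. \<phi> (pt w)) \<zero>\<^bsub>FW m\<^esub>"
      using module_hom_zero[OF module_FW RM h1] module_hom_zero[OF module_FW RM h2] by simp
  next
    fix r w assume r: "r \<in> carrier R" and w: "w \<in> words Q m"
    have "\<phi> (cls m (free_gen R w)) = free_lift R (ring_module R) (\<lambda>w. \<phi> (pt w)) (free_gen R w)"
      using w free_lift_gen[OF cring_R RM g w] by (simp add: words_iff pt_eq)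
    moreover have "free_gen R w \<in> carrier (FW m)" using w by (simp add: words_iff gen_closed)
    ultimately show "\<phi> (cls m (r \<odot>\<^bsub>FW m\<^esub> free_gen R w)) =
        free_lift R (ring_module R) (\<lambda>w. \<phi> (pt w)) (r \<odot>\<^bsub>FW m\<^esub> free_gen R w)"
      by (simp only: module_hom_smult[OF h1 r] module_hom_smult[OF h2 r])
  qed (simp only: module_hom_add[OF h1] module_hom_add[OF h2])
  moreover have "free_lift R (ring_module R) (\<lambda>w. \<phi> (pt w)) p = (\<Oplus>w\<in>?W. p w \<otimes> \<phi> (pt w))"
    by (simp add: free_lift_def finsum_ring_module)
  ultimately have "(\<Oplus>w\<in>?W. p w \<otimes> \<phi> (pt w)) = \<one>" using p(2) phi_eps by simp
  moreover have "finite ?W" "?W \<subseteq> words Q m" "p \<in> ?W \<rightarrow> carrier R"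
    using p(1) by (auto simp: free_module_simps(1))
  moreover from this have "\<forall>w\<in>?W. set w \<subseteq> carrier Q \<and> length w = m" by (simp add: words_iff subset_iff)
  ultimately show ?thesis by (intro exI[of _ ?W] exI[of _ p] conjI)
qed

text \<open>
  The values \<open>\<phi>(w)\<close> generate the unit ideal, so vanishing may be tested after multiplying by a power of
  each of them.
\<close>

lemma zero_if_killed:
  fixes M :: "('r, 'b, 'y) module_scheme"
  assumes M: "module R M" and x: "x \<in> carrier M"
    and kill: "\<And>w. set w \<subseteq> carrier Q \<Longrightarrow> length w = m \<Longrightarrow> \<exists>n::nat. (\<phi> (pt w) [^] n) \<odot>\<^bsub>M\<^esub> x = \<zero>\<^bsub>M\<^esub>"
  shows "x = \<zero>\<^bsub>M\<^esub>"
proof -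
  interpret M: module R M by (rule M)
  obtain W c where W: "finite W" "\<forall>w\<in>W. set w \<subseteq> carrier Q \<and> length w = m" "c \<in> W \<rightarrow> carrier R"
    "(\<Oplus>w\<in>W. c w \<otimes> \<phi> (pt w)) = \<one>"
    using unit_ideal by (elim exE conjE)
  show ?thesis
  proof (rule zero_if_locally_zero[OF M W(1) _ W(4) x])
    have wc: "c w \<in> carrier R" "\<phi> (pt w) \<in> carrier R" if "w \<in> W" for w using that W(2,3) by auto
    then show "(\<lambda>w. c w \<otimes> \<phi> (pt w)) \<in> W \<rightarrow> carrier R" by simp
    fix w assume w: "w \<in> W"
    obtain n :: nat where n: "(\<phi> (pt w) [^] n) \<odot>\<^bsub>M\<^esub> x = \<zero>\<^bsub>M\<^esub>" 
      using kill[OF W(2)[THEN bspec, OF w, THEN conjunct1] W(2)[THEN bspec, OF w, THEN conjunct2]] by (rule exE)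
    have "((c w \<otimes> \<phi> (pt w)) [^] n) \<odot>\<^bsub>M\<^esub> x = \<zero>\<^bsub>M\<^esub>"
      using wc[OF w] x n by (simp add: Q.nat_pow_distrib M.smult_assoc1)
    then show "\<exists>n::nat. ((c w \<otimes> \<phi> (pt w)) [^] n) \<odot>\<^bsub>M\<^esub> x = \<zero>\<^bsub>M\<^esub>" by blast
  qed
qed

lemma eq_if_locally_eq:
  fixes M :: "('r, 'b, 'y) module_scheme"
  assumes M: "module R M" and x: "x \<in> carrier M" and y: "y \<in> carrier M"
    and kill: "\<And>w. set w \<subseteq> carrier Q \<Longrightarrow> length w = m \<Longrightarrow>
      \<exists>n::nat. (\<phi> (pt w) [^] n) \<odot>\<^bsub>M\<^esub> x = (\<phi> (pt w) [^] n) \<odot>\<^bsub>M\<^esub> y"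
  shows "x = y"
proof -
  interpret M: module R M by (rule M)
  have "x \<ominus>\<^bsub>M\<^esub> y = \<zero>\<^bsub>M\<^esub>"
  proof (rule zero_if_killed[OF M])
    fix w assume w: "set w \<subseteq> carrier Q" "length w = m"
    obtain n :: nat where n: "(\<phi> (pt w) [^] n) \<odot>\<^bsub>M\<^esub> x = (\<phi> (pt w) [^] n) \<odot>\<^bsub>M\<^esub> y"
      using kill[OF w] by (rule exE)
    have "\<phi> (pt w) [^] n \<in> carrier R" using w by simp
    then have "(\<phi> (pt w) [^] n) \<odot>\<^bsub>M\<^esub> (x \<ominus>\<^bsub>M\<^esub> y) = \<zero>\<^bsub>M\<^esub>"
      using x y n by (simp add: a_minus_def M.smult_r_distr M.smult_r_minus M.r_neg)
    then show "\<exists>n::nat. (\<phi> (pt w) [^] n) \<odot>\<^bsub>M\<^esub> (x \<ominus>\<^bsub>M\<^esub> y) = \<zero>\<^bsub>M\<^esub>" by blast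
  qed (use x y in simp)
  then show ?thesis using x y by (metis a_minus_def M.minus_equality M.minus_minus M.a_inv_closed)
qed

subsection \<open>Commutativity\<close>

text \<open>
  Locally \<open>Q\<close> is generated by one element: contracting \<open>a \<otimes> b \<otimes> x\<close> on the left gives
  \<open>\<phi>(a \<otimes> b) x\<close>, whereas \<open>b \<otimes> x = \<phi>(b \<otimes> x) \<epsilon>\<close> turns it into a multiple of the contraction of
  \<open>a \<otimes> \<epsilon>\<close>.
\<close>

lemma locally_cyclic:
  assumes a: "a \<in> carrier Q" and b: "set b \<subseteq> carrier Q" "Suc (length b) = m" and x: "x \<in> carrier Q"
  shows "\<phi> (pt (a # b)) \<odot>\<^bsub>T (Suc 0)\<^esub> pt [x] =
    \<phi> (pt (b @ [x])) \<odot>\<^bsub>T (Suc 0)\<^esub> ctr (m + Suc 0) (tp (Suc 0) m (pt [a]) eps)"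
proof -
  have c: "pt (a # b) \<in> carrier (T m)" "pt [x] \<in> carrier (T (Suc 0))" "pt [a] \<in> carrier (T (Suc 0))"
    "pt (b @ [x]) \<in> carrier (T m)"
    using a b x by simp_all
  have "\<phi> (pt (a # b)) \<odot>\<^bsub>T (Suc 0)\<^esub> pt [x] = ctr (m + Suc 0) (tp m (Suc 0) (pt (a # b)) (pt [x]))"
    using c by (simp only: contract_tp)
  also have "tp m (Suc 0) (pt (a # b)) (pt [x]) = tp (Suc 0) m (pt [a]) (pt (b @ [x]))"
    using a b x by (simp add: tp_pt)
  also have "pt (b @ [x]) = \<phi> (pt (b @ [x])) \<odot>\<^bsub>T m\<^esub> eps"
    using c by (simp add: phi_smult_eps)
  also have "tp (Suc 0) m (pt [a]) \<dots> = \<phi> (pt (b @ [x])) \<odot>\<^bsub>T (m + Suc 0)\<^esub> tp (Suc 0) m (pt [a]) eps"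
    using c tp_smult_right[OF c(3), of "\<phi> (pt (b @ [x]))" eps m] by simp
  also have "ctr (m + Suc 0) \<dots> = \<phi> (pt (b @ [x])) \<odot>\<^bsub>T (Suc 0)\<^esub> ctr (m + Suc 0) (tp (Suc 0) m (pt [a]) eps)"
    using c tp_closed[OF c(3) eps_closed] by (intro contract_smult) simp_all
  finally show ?thesis .
qed

text \<open>After multiplication by \<open>\<phi>(a \<otimes> b)\<^sup>2\<close>, two neighbours \<open>x\<close>, \<open>y\<close> become multiples of one tensor.\<close>

lemma pt_swap:
  assumes u: "set u \<subseteq> carrier Q" and v: "set v \<subseteq> carrier Q" and x: "x \<in> carrier Q" and y: "y \<in> carrier Q"
  shows "pt (u @ [x, y] @ v) = pt (u @ [y, x] @ v)"
proof (rule eq_if_locally_eq[OF module_T])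
  let ?i = "length u" and ?j = "length v"
  let ?n = "?i + (Suc 0 + (Suc 0 + ?j))"
  show "pt (u @ [x, y] @ v) \<in> carrier (T ?n)" "pt (u @ [y, x] @ v) \<in> carrier (T ?n)"
    using assms by simp_all
  fix w assume w: "set w \<subseteq> carrier Q" "length w = m"
  then obtain a b where ab: "w = a # b" "a \<in> carrier Q" "set b \<subseteq> carrier Q" "Suc (length b) = m"
    using m_pos by (cases w) auto
  let ?s = "\<phi> (pt w)" and ?f = "\<lambda>x. \<phi> (pt (b @ [x]))"
  \<comment> \<open>the local generator of \<open>Q\<close>, and the tensor with two copies of it in place of \<open>x\<close> and \<open>y\<close>\<close>
  define h where "h = ctr (m + Suc 0) (tp (Suc 0) m (pt [a]) eps)"
  define z where "z = tp ?i (Suc 0 + (Suc 0 + ?j)) (pt u) (tp (Suc 0) (Suc 0 + ?j) h (tp (Suc 0) ?j h (pt v)))"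
  have uc: "pt u \<in> carrier (T ?i)" and vc: "pt v \<in> carrier (T ?j)" using u v by simp_all
  have sc: "?s \<in> carrier R" using w by simp
  have hc: "h \<in> carrier (T (Suc 0))"
    unfolding h_def using ab tp_closed[of "pt [a]" "Suc 0" eps m] by (intro contract_closed) simp
  have fc: "?f x \<in> carrier R" if "x \<in> carrier Q" for x using that ab by simp
  have main: "(?s [^] (2::nat)) \<odot>\<^bsub>T ?n\<^esub> pt (u @ [x, y] @ v) = (?f x \<otimes> ?f y) \<odot>\<^bsub>T ?n\<^esub> z"
    if x: "x \<in> carrier Q" and y: "y \<in> carrier Q" for x y
  proof -
    let ?p = "\<lambda>x. pt [x]"
    have xc: "?p x \<in> carrier (T (Suc 0))" "?p y \<in> carrier (T (Suc 0))" using x y by simp_all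
    have cyc: "?s \<odot>\<^bsub>T (Suc 0)\<^esub> ?p x = ?f x \<odot>\<^bsub>T (Suc 0)\<^esub> h" "?s \<odot>\<^bsub>T (Suc 0)\<^esub> ?p y = ?f y \<odot>\<^bsub>T (Suc 0)\<^esub> h"
      unfolding h_def ab(1) using ab x y by (intro locally_cyclic; simp)+
    have "pt (u @ [x, y] @ v) =
        tp ?i (Suc 0 + (Suc 0 + ?j)) (pt u) (tp (Suc 0) (Suc 0 + ?j) (?p x) (tp (Suc 0) ?j (?p y) (pt v)))"
      using u v x y by (simp add: tp_pt)
    then have "(?s [^] (2::nat)) \<odot>\<^bsub>T ?n\<^esub> pt (u @ [x, y] @ v) = tp ?i (Suc 0 + (Suc 0 + ?j)) (pt u)
        (tp (Suc 0) (Suc 0 + ?j) (?s \<odot>\<^bsub>T (Suc 0)\<^esub> ?p x) (tp (Suc 0) ?j (?s \<odot>\<^bsub>T (Suc 0)\<^esub> ?p y) (pt v)))"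
      using uc vc xc sc
      by (simp only: tp_smult_left tp_smult_right tp_closed T.smult_closed T.smult_assoc1[symmetric]
          Q.m_closed numeral_2_eq_2 Q.nat_pow_Suc Q.nat_pow_0 Q.l_one)
    also have "\<dots> = (?f x \<otimes> ?f y) \<odot>\<^bsub>T ?n\<^esub> z"
      unfolding cyc z_def using uc vc hc fc[OF x] fc[OF y]
      by (simp only: tp_smult_left tp_smult_right tp_closed T.smult_closed T.smult_assoc1[symmetric]
          Q.m_closed) (simp only: Q.m_comm)
    finally show ?thesis .
  qed
  show "\<exists>n::nat. (?s [^] n) \<odot>\<^bsub>T ?n\<^esub> pt (u @ [x, y] @ v) = (?s [^] n) \<odot>\<^bsub>T ?n\<^esub> pt (u @ [y, x] @ v)"
    using main[OF x y] main[OF y x] fc[OF x] fc[OF y] by (intro exI[of _ 2]) (simp only: Q.m_comm)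
qed

lemma pt_move:
  assumes "set u \<subseteq> carrier Q" "set p \<subseteq> carrier Q" "set v \<subseteq> carrier Q" "x \<in> carrier Q"
  shows "pt (u @ x # p @ v) = pt (u @ p @ x # v)"
  using assms(1,2)
proof (induction p arbitrary: u)
  case (Cons y p)
  have "pt (u @ x # (y # p) @ v) = pt (u @ y # x # p @ v)"
    using pt_swap[of u "p @ v" x y] Cons.prems assms by simp
  also have "\<dots> = pt ((u @ [y]) @ p @ x # v)"
    using Cons.IH[of "u @ [y]"] Cons.prems by simp
  finally show ?case by simp
qed simp

text \<open>Swaps of neighbours generate all permutations: the first letter is moved to its place in the other word.\<close>

lemma pt_mset:
  assumes "mset w = mset w'" "set w \<subseteq> carrier Q"
  shows "pt w = pt w'"
proof -
  have "pt (u @ w) = pt (u @ w')" if "mset w = mset w'" "set w \<subseteq> carrier Q" "set u \<subseteq> carrier Q" for u w w'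
    using that
  proof (induction w arbitrary: u w')
    case (Cons a w)
    have "a \<in> set w'" using mset_eq_setD[OF Cons.prems(1)] by auto
    then obtain p q where w': "w' = p @ a # q" by (meson split_list)
    have m: "mset w = mset (p @ q)" using Cons.prems(1) w' by simp
    then have pq: "set p \<subseteq> carrier Q" "set q \<subseteq> carrier Q"
      using mset_eq_setD[OF m] Cons.prems(2) by auto
    have "pt (u @ a # w) = pt ((u @ [a]) @ p @ q)"
      using Cons.IH[OF m, of "u @ [a]"] Cons.prems by simp
    also have "\<dots> = pt (u @ w')" using pt_move[of u p q a] Cons.prems pq w' by simp
    finally show ?case .
  qed simp
  from this[of w w' "[]"] assms show ?thesis by simp
qed

lemma tp_comm:
  assumes x: "x \<in> carrier (T i)" and y: "y \<in> carrier (T j)"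
  shows "tp i j x y = tp j i y x"
proof (rule T_hom_eq[OF _ _ x, where f = "\<lambda>x. tp i j x y"])
  show "(\<lambda>x. tp i j x y) \<in> module_hom R (T i) (T (i + j))" by (rule tp_hom_left[OF y])
  show "tp j i y \<in> module_hom R (T i) (T (i + j))" using tp_hom_right[OF y] by (simp add: add.commute)
  fix u assume u: "set u \<subseteq> carrier Q" "length u = i"
  have uc: "pt u \<in> carrier (T i)" using u by simp
  show "tp i j (pt u) y = tp j i y (pt u)"
  proof (rule T_hom_eq[OF _ _ y, where g = "\<lambda>y. tp j i y (pt u)"])
    show "tp i j (pt u) \<in> module_hom R (T j) (T (i + j))" by (rule tp_hom_right[OF uc])
    show "(\<lambda>y. tp j i y (pt u)) \<in> module_hom R (T j) (T (i + j))"
      using tp_hom_left[OF uc, of j] by (simp add: add.commute)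
    fix v assume "set v \<subseteq> carrier Q" "length v = j"
    then show "tp i j (pt u) (pt v) = tp j i (pt v) (pt u)"
      using u by (simp add: tp_pt) (rule pt_mset, simp_all)
  qed
qed

section \<open>Reduction modulo the degree\<close>

abbreviation "rd \<equiv> reduce_deg R Q m \<phi>"

text \<open>
  The value of \<open>reduce_deg\<close> without the embedding into the direct sum: it is concentrated in degree
  \<open>i mod m\<close>.
\<close>

definition red :: "nat \<Rightarrow> ('q list \<Rightarrow> 'r) set \<Rightarrow> ('q list \<Rightarrow> 'r) set" where
  "red i x = rd i x (i mod m)"

lemma rd_small: "i < m \<Longrightarrow> rd i x = ds_inject T i x"
  by (simp add: reduce_deg.simps)

lemma rd_step: "rd (m + i) x = rd i (ctr (m + i) x)"
  using m_pos by (subst reduce_deg.simps) simp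

lemma rd_hom_inject: "rd i \<in> module_hom R (T i) (DS {..<m}) \<and> (\<forall>x\<in>carrier (T i). rd i x = ds_inject T (i mod m) (red i x))"
proof (induction i rule: less_induct)
  case (less i)
  show ?case
  proof (cases "i < m")
    case True
    then have "rd i = ds_inject T i" by (simp add: rd_small fun_eq_iff)
    then show ?thesis using inject_hom[of i "{..<m}"] True by (simp add: red_def)
  next
    case False
    then obtain j where i: "i = m + j" using le_Suc_ex[of m i] by fastforce
    have "j < i" using i m_pos by simp
    note IH = less.IH[OF this]
    have e: "rd (m + j) x = rd j (ctr (m + j) x)" for x by (rule rd_step)
    have "rd (m + j) \<in> module_hom R (T (m + j)) (DS {..<m})"
      using module_hom_comp[OF contract_hom IH[THEN conjunct1]] unfolding e[symmetric] .
    moreover have "rd (m + j) x = ds_inject T ((m + j) mod m) (red (m + j) x)" if "x \<in> carrier (T (m + j))" for x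
      using IH[THEN conjunct2, rule_format, OF contract_closed[OF that]] by (simp add: red_def e)
    ultimately show ?thesis unfolding i by (intro conjI ballI)
  qed
qed

lemmas rd_hom = rd_hom_inject[THEN conjunct1]

lemma rd_inject: "x \<in> carrier (T i) \<Longrightarrow> rd i x = ds_inject T (i mod m) (red i x)"
  using rd_hom_inject by blast

lemma red_hom: "red i \<in> module_hom R (T i) (T (i mod m))"
  unfolding red_def[abs_def]
  by (rule module_hom_comp[OF rd_hom ds_component_hom[where M = T, OF cring_R module_T]])

lemmas red_closed [simp] = module_hom_closed[OF red_hom]

lemma red_small: "i < m \<Longrightarrow> red i x = x"
  by (simp add: red_def rd_small)

lemma red_step: "red (m + i) x = red i (ctr (m + i) x)"
  by (simp add: red_def rd_step)

lemma red_tp_phi: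
  "x \<in> carrier (T m) \<Longrightarrow> y \<in> carrier (T j) \<Longrightarrow> red (m + j) (tp m j x y) = \<phi> x \<odot>\<^bsub>T (j mod m)\<^esub> red j y"
  by (simp add: red_step contract_tp module_hom_smult[OF red_hom])

text \<open>
  A factor \<open>\<epsilon>\<close> of \<open>x\<close> is a factor of \<open>x \<otimes> y\<close>, so the contraction steps that reduce \<open>x\<close> are also steps of the
  reduction of \<open>x \<otimes> y\<close>.
\<close>

lemma red_tp_left:
  "x \<in> carrier (T i) \<Longrightarrow> y \<in> carrier (T k) \<Longrightarrow> red (i + k) (tp i k x y) = red (i mod m + k) (tp (i mod m) k (red i x) y)"
proof (induction i arbitrary: x rule: less_induct)
  case (less i)
  show ?case
  proof (cases "i < m")
    case True
    then show ?thesis by (simp add: red_small)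
  next
    case False
    then obtain j where i: "i = m + j" using le_Suc_ex[of m i] by fastforce
    have x: "x \<in> carrier (T (m + j))" and y: "y \<in> carrier (T k)" using less.prems i by simp_all
    have c: "ctr (m + j) x \<in> carrier (T j)" using x by simp
    have "red (i + k) (tp i k x y) = red (m + (j + k)) (tp m (j + k) eps (tp j k (ctr (m + j) x) y))"
      using tp_assoc[OF eps_closed c y] eps_contract[OF x] by (simp add: i add.assoc)
    also have "\<dots> = red (j + k) (tp j k (ctr (m + j) x) y)"
      using c y by (simp add: red_tp_phi)
    also have "\<dots> = red (j mod m + k) (tp (j mod m) k (red j (ctr (m + j) x)) y)"
      using i m_pos c y by (intro less.IH) simp_all
    finally show ?thesis by (simp add: i red_step)
  qed
qed

text \<open>
  The tensor algebra is commutative, which carries reduction of the left factor over to the right one.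
  This is where commutativity makes the product of the radical extension associative.
\<close>

lemma red_tp_right:
  assumes x: "x \<in> carrier (T i)" and y: "y \<in> carrier (T k)"
  shows "red (i + k) (tp i k x y) = red (i + k mod m) (tp i (k mod m) x (red k y))"
proof -
  have "red (i + k) (tp i k x y) = red (k + i) (tp k i y x)"
    using tp_comm[OF x y] by (simp add: add.commute)
  also have "\<dots> = red (k mod m + i) (tp (k mod m) i (red k y) x)" by (rule red_tp_left[OF y x])
  also have "\<dots> = red (i + k mod m) (tp i (k mod m) x (red k y))"
    using tp_comm[OF x red_closed[OF y]] by (simp add: add.commute)
  finally show ?thesis .
qed

text \<open>The powers of \<open>\<epsilon>\<close> reduce to \<open>1\<close>, so no tensor power is zero unless \<open>R\<close> is.\<close>

lemma eps_power: "\<exists>e\<in>carrier (T (m * n)). red (m * n) e = pt []"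
proof (induction n)
  case 0
  then show ?case using m_pos by (intro bexI[of _ "pt []"]) (simp_all add: red_small)
next
  case (Suc n)
  then obtain e where e: "e \<in> carrier (T (m * n))" "red (m * n) e = pt []" by blast
  have "tp m (m * n) eps e \<in> carrier (T (m * Suc n))"
    using tp_closed[OF eps_closed e(1)] by simp
  moreover have "red (m * Suc n) (tp m (m * n) eps e) = pt []"
    using red_tp_phi[OF eps_closed e(1)] e(2) by simp
  ultimately show ?case by blast
qed

text \<open>
  If a tensor power vanishes, then so do all of higher degree, among them one that contains a power of
  \<open>\<epsilon>\<close>.
\<close>

lemma T_nonzero:
  assumes "\<one> \<noteq> \<zero>"
  shows "carrier (T i) \<noteq> {\<zero>\<^bsub>T i\<^esub>}"
proof
  assume z: "carrier (T i) = {\<zero>\<^bsub>T i\<^esub>}"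
  obtain e where e: "e \<in> carrier (T (m * i))" "red (m * i) e = pt []" using eps_power by blast
  \<comment> \<open>the exponent \<open>i\<close> is large enough for the degree \<open>m i\<close> to be at least \<open>i\<close>\<close>
  obtain k where k: "m * i = i + k" using m_pos by (metis le_add_diff_inverse mult.commute mult_le_mono2 mult_1_right)
  have "e = \<zero>\<^bsub>T (i + k)\<^esub>"
  proof (rule T_hom_eq[OF id_hom, where g = "\<lambda>_. \<zero>\<^bsub>T (i + k)\<^esub>"])
    show "(\<lambda>_. \<zero>\<^bsub>T (i + k)\<^esub>) \<in> module_hom R (T (i + k)) (T (i + k))"
      by (rule module_homI) simp_all
    show "e \<in> carrier (T (i + k))" using e(1) k by simp
    fix w assume w: "set w \<subseteq> carrier Q" "length w = i + k"
    have d: "set (take i w) \<subseteq> carrier Q" "set (drop i w) \<subseteq> carrier Q"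
      using w(1) set_take_subset[of i w] set_drop_subset[of i w] by auto
    have "pt w = tp i k (pt (take i w)) (pt (drop i w))" using d w by (simp add: tp_pt)
    moreover have "pt (take i w) = \<zero>\<^bsub>T i\<^esub>" using z d w pt_closed[of "take i w" i] by auto
    ultimately show "pt w = \<zero>\<^bsub>T (i + k)\<^esub>" using d w by (simp add: tp_zero_left)
  qed
  moreover have "(i + k) mod m = 0" using k by (metis mod_mult_self1_is_0)
  ultimately have "pt [] = \<zero>\<^bsub>T 0\<^esub>"
    using e module_hom_zero[OF module_T module_T red_hom[of "m * i"]] k by simp
  then have "\<one> \<odot>\<^bsub>T 0\<^esub> pt [] = \<zero>\<^bsub>T 0\<^esub>" by simp
  then show False using T0_scalar_inj[of "\<one>"] assms by simp
qed

text \<open>Each contraction step is injective, because multiplication by \<open>\<epsilon>\<close> recovers the tensor.\<close>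

lemma red_inj:
  assumes "x \<in> carrier (T i)" "red i x = \<zero>\<^bsub>T (i mod m)\<^esub>"
  shows "x = \<zero>\<^bsub>T i\<^esub>"
  using assms
proof (induction i arbitrary: x rule: less_induct)
  case (less i)
  show ?case
  proof (cases "i < m")
    case True
    then show ?thesis using less.prems by (simp add: red_small)
  next
    case False
    then obtain j where i: "i = m + j" using le_Suc_ex[of m i] by fastforce
    have x: "x \<in> carrier (T (m + j))" using less.prems i by simp
    have "ctr (m + j) x = \<zero>\<^bsub>T j\<^esub>"
      by (rule less.IH) (use less.prems(2) i m_pos x in \<open>simp_all add: red_step\<close>)
    then show ?thesis using eps_contract[OF x] tp_zero_right[OF eps_closed, of j] i by simp
  qed
qed

section \<open>Dual bases of the tensor powers\<close>

text \<open>
  A word \<open>w = u v\<close> of length \<open>m\<close> gives a generator \<open>u\<close> of \<open>Q\<^sup>\<otimes>\<^sup>i\<close> after inverting \<open>\<phi>(w)\<close>; the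
  coordinate with respect to it is \<open>x \<mapsto> \<phi>(x \<otimes> v)\<close>.
\<close>

definition coord :: "nat \<Rightarrow> 'q list \<Rightarrow> ('q list \<Rightarrow> 'r) set \<Rightarrow> 'r" where
  "coord i w x = \<phi> (tp i (m - i) x (pt (drop i w)))"

lemma coord_hom:
  assumes w: "set w \<subseteq> carrier Q" "length w = m" and i: "i \<le> m"
  shows "coord i w \<in> module_hom R (T i) (ring_module R)"
proof -
  have "pt (drop i w) \<in> carrier (T (m - i))" using w set_drop_subset[of i w] by (intro pt_closed) auto
  from module_hom_comp[OF tp_hom_left[OF this, of i], of \<phi>] show ?thesis
    using phi_hom i by (simp add: coord_def[abs_def])
qed

lemma coord_gen:
  assumes w: "set w \<subseteq> carrier Q" "length w = m" and i: "i \<le> m"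
  shows "coord i w (pt (take i w)) = \<phi> (pt w)"
  using w i set_take_subset[of i w] set_drop_subset[of i w]
  by (simp add: coord_def tp_pt)

text \<open>
  In the commutative tensor algebra \<open>u v x = x v u\<close>.  The claim arises by contracting both sides, with
  \<open>u v\<close> and \<open>x v\<close> as the parts of degree \<open>m\<close>.
\<close>

lemma coord_expand:
  assumes w: "set w \<subseteq> carrier Q" "length w = m" and i: "i \<le> m" and x: "x \<in> carrier (T i)"
  shows "\<phi> (pt w) \<odot>\<^bsub>T i\<^esub> x = coord i w x \<odot>\<^bsub>T i\<^esub> pt (take i w)"
proof -
  let ?u = "pt (take i w)" and ?v = "pt (drop i w)" and ?k = "m - i"
  have s: "set (take i w) \<subseteq> carrier Q" "set (drop i w) \<subseteq> carrier Q"
    using w(1) set_take_subset[of i w] set_drop_subset[of i w] by auto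
  have u: "?u \<in> carrier (T i)" and v: "?v \<in> carrier (T ?k)" using s w i by simp_all
  have k: "i + ?k = m" "?k + i = m" using i by simp_all
  have xv: "tp i ?k x ?v \<in> carrier (T m)" using tp_closed[OF x v] k by simp
  have "pt w = tp i ?k ?u ?v" using s w i by (simp add: tp_pt)
  then have "tp m i (pt w) x = tp (i + ?k) i (tp i ?k ?u ?v) x" using k by simp
  also have "\<dots> = tp i (?k + i) ?u (tp ?k i ?v x)" by (rule tp_assoc[OF u v x])
  also have "\<dots> = tp i m ?u (tp i ?k x ?v)" using tp_comm[OF v x] k by simp
  also have "\<dots> = tp m i (tp i ?k x ?v) ?u" by (rule tp_comm[OF u xv])
  finally have e: "tp m i (pt w) x = tp m i (tp i ?k x ?v) ?u" .
  have "pt w \<in> carrier (T m)" using w by simp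
  from contract_tp[OF this x] contract_tp[OF xv u] show ?thesis by (simp add: e coord_def)
qed

end

section \<open>The radical extension as a graded algebra\<close>

context invertible_tensor_power
begin

interpretation Q: module R Q by (rule module_Q)
interpretation T: module R "T i" for i by (rule module_T)
interpretation DS: module R "DS I" for I by (rule module_DS)

abbreviation "A I \<equiv> I_radical_ext R Q m \<phi> I"

text \<open>
  The product of the radical extension, extended to all of the tensor algebra; in this form it is linear
  in each argument without regard to the index set.
\<close>

definition radical_mult :: "(nat \<Rightarrow> ('q list \<Rightarrow> 'r) set) \<Rightarrow> (nat \<Rightarrow> ('q list \<Rightarrow> 'r) set) \<Rightarrow> nat \<Rightarrow> ('q list \<Rightarrow> 'r) set" where
  "radical_mult x y = phi_tilde R Q m \<phi> (tensor_mult x y)"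

lemma phi_tilde_ds_lift: "phi_tilde R Q m \<phi> = ds_lift T (DS {..<m}) rd"
  by (simp add: phi_tilde_def ds_lift_def fun_eq_iff)

lemma phi_tilde_hom: "phi_tilde R Q m \<phi> \<in> module_hom R (DS UNIV) (DS {..<m})"
  unfolding phi_tilde_ds_lift by (rule ds_lift_hom[OF cring_R module_T module_DS rd_hom])

lemma phi_tilde_inject:
  "x \<in> carrier (T i) \<Longrightarrow> phi_tilde R Q m \<phi> (ds_inject T i x) = ds_inject T (i mod m) (red i x)"
  unfolding phi_tilde_ds_lift
  by (subst ds_lift_inject[where J = UNIV, OF cring_R module_T module_DS rd_hom]) (simp_all add: rd_inject)

lemma radical_mult_hom_left:
  assumes "y \<in> carrier (DS UNIV)"
  shows "(\<lambda>x. radical_mult x y) \<in> module_hom R (DS I) (DS {..<m})"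
  unfolding radical_mult_def
  by (rule hom_DS_mono[OF module_hom_comp[OF tensor_mult_hom_left[OF assms] phi_tilde_hom]]) simp

lemma radical_mult_hom_right:
  assumes "x \<in> carrier (DS UNIV)"
  shows "radical_mult x \<in> module_hom R (DS I) (DS {..<m})"
  unfolding radical_mult_def[abs_def]
  by (rule hom_DS_mono[OF module_hom_comp[OF tensor_mult_hom_right[OF assms] phi_tilde_hom]]) simp

lemma radical_mult_inject:
  "a \<in> carrier (T i) \<Longrightarrow> b \<in> carrier (T j) \<Longrightarrow>
    radical_mult (ds_inject T i a) (ds_inject T j b) = ds_inject T ((i + j) mod m) (red (i + j) (tp i j a b))"
  by (simp add: radical_mult_def tensor_mult_inject phi_tilde_inject)

lemma inject_closed: "i \<in> I \<Longrightarrow> a \<in> carrier (T i) \<Longrightarrow> ds_inject T i a \<in> carrier (DS I)"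
  by (rule module_hom_closed[OF inject_hom])

lemma radical_mult_comm:
  assumes x: "x \<in> carrier (DS I)" and y: "y \<in> carrier (DS I)"
  shows "radical_mult x y = radical_mult y x"
proof -
  note U = DS_mono[of _ I UNIV]
  show ?thesis
  proof (rule ds_hom_eq[OF cring_R module_T module_DS, where f = "\<lambda>x. radical_mult x y"])
    show "(\<lambda>x. radical_mult x y) \<in> module_hom R (DS I) (DS {..<m})" by (rule radical_mult_hom_left[OF U[OF y]]) simp
    show "radical_mult y \<in> module_hom R (DS I) (DS {..<m})" by (rule radical_mult_hom_right[OF U[OF y]]) simp
    fix i a assume a: "i \<in> I" "a \<in> carrier (T i)"
    note ia = inject_closed[OF a]
    show "radical_mult (ds_inject T i a) y = radical_mult y (ds_inject T i a)"
    proof (rule ds_hom_eq[OF cring_R module_T module_DS, where g = "\<lambda>y. radical_mult y (ds_inject T i a)"])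
      show "radical_mult (ds_inject T i a) \<in> module_hom R (DS I) (DS {..<m})" by (rule radical_mult_hom_right[OF U[OF ia]]) simp
      show "(\<lambda>y. radical_mult y (ds_inject T i a)) \<in> module_hom R (DS I) (DS {..<m})"
        by (rule radical_mult_hom_left[OF U[OF ia]]) simp
      fix j b assume "j \<in> I" "b \<in> carrier (T j)"
      then show "radical_mult (ds_inject T i a) (ds_inject T j b) = radical_mult (ds_inject T j b) (ds_inject T i a)"
        using a tp_comm[of a i b j] by (simp add: radical_mult_inject add.commute)
    qed (rule y)
  qed (rule x)
qed

text \<open>
  For homogeneous elements both sides are the reduction of \<open>a \<otimes> b \<otimes> c\<close>: intermediate reductions of a
  left or of a right factor do not change it.
\<close>

lemma radical_mult_assoc:
  assumes x: "x \<in> carrier (DS I)" and y: "y \<in> carrier (DS I)" and z: "z \<in> carrier (DS I)"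
  shows "radical_mult (radical_mult x y) z = radical_mult x (radical_mult y z)"
proof -
  note U = DS_mono[of _ I UNIV, OF _ subset_UNIV]
  have cl: "radical_mult x y \<in> carrier (DS UNIV)" if "x \<in> carrier (DS I)" "y \<in> carrier (DS I)" for x y
    using DS_mono[OF module_hom_closed[OF radical_mult_hom_right[OF U[OF that(1)]] that(2)] subset_UNIV] .
  have L: "(\<lambda>x. radical_mult (radical_mult x y) z) \<in> module_hom R (DS I) (DS {..<m})"
    if "y \<in> carrier (DS I)" "z \<in> carrier (DS I)" for y z
    by (rule module_hom_comp[OF radical_mult_hom_left[OF U[OF that(1)]] radical_mult_hom_left[OF U[OF that(2)]]])
  have M: "(\<lambda>y. radical_mult (radical_mult x y) z) \<in> module_hom R (DS I) (DS {..<m})"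
    if "x \<in> carrier (DS I)" "z \<in> carrier (DS I)" for x z
    by (rule module_hom_comp[OF radical_mult_hom_right[OF U[OF that(1)]] radical_mult_hom_left[OF U[OF that(2)]]])
  have M': "(\<lambda>y. radical_mult x (radical_mult y z)) \<in> module_hom R (DS I) (DS {..<m})"
    if "x \<in> carrier (DS I)" "z \<in> carrier (DS I)" for x z
    by (rule module_hom_comp[OF radical_mult_hom_left[OF U[OF that(2)]] radical_mult_hom_right[OF U[OF that(1)]]])
  have N: "(\<lambda>z. radical_mult x (radical_mult y z)) \<in> module_hom R (DS I) (DS {..<m})"
    if "x \<in> carrier (DS I)" "y \<in> carrier (DS I)" for x y
    by (rule module_hom_comp[OF radical_mult_hom_right[OF U[OF that(2)]] radical_mult_hom_right[OF U[OF that(1)]]])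
  note eqI = ds_hom_eq[OF cring_R module_T module_DS]
  show ?thesis
  proof (rule eqI[OF L[OF y z] radical_mult_hom_left[OF cl[OF y z]] _ x])
    fix i a assume a: "i \<in> I" "a \<in> carrier (T i)"
    note ia = inject_closed[OF a]
    show "radical_mult (radical_mult (ds_inject T i a) y) z = radical_mult (ds_inject T i a) (radical_mult y z)"
    proof (rule eqI[OF M[OF ia z] M'[OF ia z] _ y])
      fix j b assume b: "j \<in> I" "b \<in> carrier (T j)"
      note ib = inject_closed[OF b]
      show "radical_mult (radical_mult (ds_inject T i a) (ds_inject T j b)) z = radical_mult (ds_inject T i a) (radical_mult (ds_inject T j b) z)"
      proof (rule eqI[OF radical_mult_hom_right[OF cl[OF ia ib]] N[OF ia ib] _ z])
        fix k c assume c: "k \<in> I" "c \<in> carrier (T k)"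
        note ab = tp_closed[OF a(2) b(2)] and bc = tp_closed[OF b(2) c(2)]
        have "radical_mult (radical_mult (ds_inject T i a) (ds_inject T j b)) (ds_inject T k c) =
            ds_inject T (((i + j) mod m + k) mod m)
              (red ((i + j) mod m + k) (tp ((i + j) mod m) k (red (i + j) (tp i j a b)) c))"
          using a b c ab by (simp add: radical_mult_inject)
        also have "\<dots> = ds_inject T ((i + j + k) mod m) (red (i + j + k) (tp (i + j) k (tp i j a b) c))"
          using red_tp_left[OF ab c(2)] by (simp add: mod_add_left_eq)
        also have "\<dots> = ds_inject T ((i + (j + k)) mod m) (red (i + (j + k)) (tp i (j + k) a (tp j k b c)))"
          using tp_assoc[OF a(2) b(2) c(2)] by (simp add: add.assoc)
        also have "\<dots> = ds_inject T ((i + (j + k) mod m) mod m)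
              (red (i + (j + k) mod m) (tp i ((j + k) mod m) a (red (j + k) (tp j k b c))))"
          using red_tp_right[OF a(2) bc] by (simp add: mod_add_right_eq)
        also have "\<dots> = radical_mult (ds_inject T i a) (radical_mult (ds_inject T j b) (ds_inject T k c))"
          using a b c bc by (simp add: radical_mult_inject)
        finally show "radical_mult (radical_mult (ds_inject T i a) (ds_inject T j b)) (ds_inject T k c) =
          radical_mult (ds_inject T i a) (radical_mult (ds_inject T j b) (ds_inject T k c))" .
      qed
    qed
  qed
qed

abbreviation "unit_S \<equiv> ds_inject T 0 (pt [])"

lemma radical_mult_one_left:
  assumes I: "I \<subseteq> {..<m}" and x: "x \<in> carrier (DS I)"
  shows "radical_mult unit_S x = x"
proof (rule ds_hom_eq[OF cring_R module_T module_DS, where g = "\<lambda>x. x"])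
  have "unit_S \<in> carrier (DS UNIV)" by (rule inject_closed) simp_all
  then show "radical_mult unit_S \<in> module_hom R (DS I) (DS {..<m})" by (rule radical_mult_hom_right)
  show "(\<lambda>x. x) \<in> module_hom R (DS I) (DS {..<m})"
    by (rule hom_DS_mono[OF _ I]) (simp add: module_hom_def)
  fix i a assume a: "i \<in> I" "a \<in> carrier (T i)"
  then have "i < m" using I by blast
  then show "radical_mult unit_S (ds_inject T i a) = ds_inject T i a"
    using a radical_mult_inject[of "pt []" 0 a i] by (simp add: tp_one_left red_small)
qed (rule x)

lemma radical_mult_closed:
  assumes closed: "\<forall>i\<in>I. \<forall>j\<in>I. (i + j) mod m \<in> I"
    and x: "x \<in> carrier (DS I)" and y: "y \<in> carrier (DS I)"
  shows "radical_mult x y \<in> carrier (DS I)"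
proof (rule direct_sum_induct[where P = "\<lambda>x. radical_mult x y \<in> carrier (DS I)", OF cring_R module_T x])
  note U = DS_mono[of _ I UNIV, OF _ subset_UNIV]
  note h = radical_mult_hom_left[OF U[OF y], of I]
  show "radical_mult (\<lambda>i. \<zero>\<^bsub>T i\<^esub>) y \<in> carrier (DS I)"
    using module_hom_zero[OF module_DS module_DS h] DS.zero_closed[of I] by simp
  show "radical_mult (f \<oplus>\<^bsub>DS I\<^esub> g) y \<in> carrier (DS I)"
    if "f \<in> carrier (DS I)" "g \<in> carrier (DS I)" "radical_mult f y \<in> carrier (DS I)" "radical_mult g y \<in> carrier (DS I)" for f g
    using module_hom_add[OF h that(1,2)] DS.a_closed[OF that(3,4)] by simp
  fix i a assume a: "i \<in> I" "a \<in> carrier (T i)"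
  note h = radical_mult_hom_right[OF U[OF inject_closed[OF a]], of I]
  show "radical_mult (ds_inject T i a) y \<in> carrier (DS I)"
  proof (rule direct_sum_induct[where P = "\<lambda>y. radical_mult (ds_inject T i a) y \<in> carrier (DS I)", OF cring_R module_T y])
    show "radical_mult (ds_inject T i a) (\<lambda>i. \<zero>\<^bsub>T i\<^esub>) \<in> carrier (DS I)"
      using module_hom_zero[OF module_DS module_DS h] DS.zero_closed[of I] by simp
    show "radical_mult (ds_inject T i a) (f \<oplus>\<^bsub>DS I\<^esub> g) \<in> carrier (DS I)"
      if "f \<in> carrier (DS I)" "g \<in> carrier (DS I)" "radical_mult (ds_inject T i a) f \<in> carrier (DS I)"
        "radical_mult (ds_inject T i a) g \<in> carrier (DS I)" for f g
      using module_hom_add[OF h that(1,2)] DS.a_closed[OF that(3,4)] by simp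
    fix j b assume b: "j \<in> I" "b \<in> carrier (T j)"
    have "(i + j) mod m \<in> I" using closed a b by blast
    then show "radical_mult (ds_inject T i a) (ds_inject T j b) \<in> carrier (DS I)"
      using a b by (simp add: radical_mult_inject) (rule inject_closed, simp_all)
  qed
qed

lemma A_simps [simp]:
  "carrier (A I) = carrier (DS I)" "\<zero>\<^bsub>A I\<^esub> = \<zero>\<^bsub>DS I\<^esub>" "x \<oplus>\<^bsub>A I\<^esub> y = x \<oplus>\<^bsub>DS I\<^esub> y"
  "r \<odot>\<^bsub>A I\<^esub> x = r \<odot>\<^bsub>DS I\<^esub> x" "x \<otimes>\<^bsub>A I\<^esub> y = radical_mult x y" "\<one>\<^bsub>A I\<^esub> = unit_S"
  by (simp_all add: I_radical_ext_def radical_ext_def I_radical_carrier_def radical_mult_def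
      tensor_algebra_mult[symmetric])
    (simp_all add: tensor_algebra_def direct_sum_def)

lemma radical_ext_eq: "radical_ext R Q m \<phi> = A {..<m}"
  by (simp add: I_radical_ext_def radical_ext_def I_radical_carrier_def direct_sum_def)

lemma A_carrier_update: "A I\<lparr>carrier := I_radical_carrier R Q J\<rparr> = A J"
  by (simp add: I_radical_ext_def)

lemma module_A: "module R (A I)"
  by (rule module_cong[OF module_DS]) simp_all

interpretation A: module R "A I" for I by (rule module_A)

lemma finsum_A: "finsum (A I) f B = finsum (DS I) f B"
  by (simp add: finsum_def finprod_def I_radical_ext_def radical_ext_def I_radical_carrier_def direct_sum_def)

lemma submodule_A:
  assumes "I \<subseteq> J"
  shows "submodule (I_radical_carrier R Q I) R (A J)"
proof (rule A.module_incl_imp_submodule)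
  show "I_radical_carrier R Q I \<subseteq> carrier (A J)"
    using DS_mono[OF _ assms] by (auto simp: I_radical_carrier_def)
  show "module R (A J\<lparr>carrier := I_radical_carrier R Q I\<rparr>)"
    unfolding A_carrier_update by (rule module_A)
qed

lemma algebra_A:
  assumes I: "I \<subseteq> {..<m}" and zero: "0 \<in> I" and closed: "\<forall>i\<in>I. \<forall>j\<in>I. (i + j) mod m \<in> I"
  shows "algebra R (A I)"
proof -
  note U = DS_mono[of _ I UNIV, OF _ subset_UNIV]
  have one: "unit_S \<in> carrier (DS I)" using zero by (rule inject_closed) simp
  have distr: "radical_mult (x \<oplus>\<^bsub>DS I\<^esub> y) z = radical_mult x z \<oplus>\<^bsub>DS I\<^esub> radical_mult y z"
    if "x \<in> carrier (DS I)" "y \<in> carrier (DS I)" "z \<in> carrier (DS I)" for x y z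
    using module_hom_add[OF radical_mult_hom_left[OF U[OF that(3)]] that(1,2)] by simp
  have cr: "cring (A I)"
  proof (rule cringI)
    show "abelian_group (A I)" ..
    show "comm_monoid (A I)"
    proof (rule comm_monoidI)
      show "x \<otimes>\<^bsub>A I\<^esub> y \<in> carrier (A I)" if "x \<in> carrier (A I)" "y \<in> carrier (A I)" for x y
        using that radical_mult_closed[OF closed] by simp
      show "x \<otimes>\<^bsub>A I\<^esub> y \<otimes>\<^bsub>A I\<^esub> z = x \<otimes>\<^bsub>A I\<^esub> (y \<otimes>\<^bsub>A I\<^esub> z)"
        if "x \<in> carrier (A I)" "y \<in> carrier (A I)" "z \<in> carrier (A I)" for x y z
        using that radical_mult_assoc[of x I y z] by simp
      show "x \<otimes>\<^bsub>A I\<^esub> y = y \<otimes>\<^bsub>A I\<^esub> x" if "x \<in> carrier (A I)" "y \<in> carrier (A I)" for x y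
        using that radical_mult_comm[of x I y] by simp
      show "\<one>\<^bsub>A I\<^esub> \<in> carrier (A I)" using one by simp
      show "\<one>\<^bsub>A I\<^esub> \<otimes>\<^bsub>A I\<^esub> x = x" if "x \<in> carrier (A I)" for x
        using that radical_mult_one_left[OF I, of x] by simp
    qed
    show "(x \<oplus>\<^bsub>A I\<^esub> y) \<otimes>\<^bsub>A I\<^esub> z = x \<otimes>\<^bsub>A I\<^esub> z \<oplus>\<^bsub>A I\<^esub> y \<otimes>\<^bsub>A I\<^esub> z"
      if "x \<in> carrier (A I)" "y \<in> carrier (A I)" "z \<in> carrier (A I)" for x y z
      using that distr[of x y z] by simp
  qed
  show ?thesis
  proof (intro algebra.intro)
    show "algebra_axioms R (A I)"
    proof
      fix r x y assume r: "r \<in> carrier R" and "x \<in> carrier (A I)" "y \<in> carrier (A I)"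
      then have x: "x \<in> carrier (DS I)" and y: "y \<in> carrier (DS I)" by simp_all
      show "(r \<odot>\<^bsub>A I\<^esub> x) \<otimes>\<^bsub>A I\<^esub> y = r \<odot>\<^bsub>A I\<^esub> (x \<otimes>\<^bsub>A I\<^esub> y)"
        using module_hom_smult[OF radical_mult_hom_left[OF U[OF y]] r x] by simp
    qed
  qed (rule module_A cr)+
qed

subsection \<open>Subalgebras and saturated sets\<close>

text \<open>
  If the degrees \<open>i, j \<in> I\<close> had their sum outside \<open>I\<close>, all products of these degrees would vanish.  Reduction
  being injective, the tensor power of degree \<open>i + j\<close>, which such products span, would vanish as well.
\<close>

lemma closed_if_algebra:
  assumes one: "\<one> \<noteq> \<zero>" and alg: "algebra R (A I)"
  shows "0 \<in> I" "\<forall>i\<in>I. \<forall>j\<in>I. (i + j) mod m \<in> I"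
proof -
  interpret S: algebra R "A I" by (rule alg)
  show "0 \<in> I"
  proof (rule ccontr)
    assume "0 \<notin> I"
    then have "pt [] = \<zero>\<^bsub>T 0\<^esub>"
      using S.one_closed by (auto simp: direct_sum_carrier dest: spec[of _ 0])
    then have "\<one> \<odot>\<^bsub>T 0\<^esub> pt [] = \<zero>\<^bsub>T 0\<^esub>" by simp
    then show False using T0_scalar_inj[of "\<one>"] one by simp
  qed
  show "\<forall>i\<in>I. \<forall>j\<in>I. (i + j) mod m \<in> I"
  proof (intro ballI, rule ccontr)
    fix i j assume ij: "i \<in> I" "j \<in> I" "(i + j) mod m \<notin> I"
    have z: "tp i j a b = \<zero>\<^bsub>T (i + j)\<^esub>" if "a \<in> carrier (T i)" "b \<in> carrier (T j)" for a b
    proof -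
      have "radical_mult (ds_inject T i a) (ds_inject T j b) \<in> carrier (DS I)"
        using S.m_closed[of "ds_inject T i a" "ds_inject T j b"] inject_closed ij that by simp
      then have "radical_mult (ds_inject T i a) (ds_inject T j b) ((i + j) mod m) = \<zero>\<^bsub>T ((i + j) mod m)\<^esub>"
        using ij(3) by (simp add: direct_sum_carrier)
      then have "red (i + j) (tp i j a b) = \<zero>\<^bsub>T ((i + j) mod m)\<^esub>" using that by (simp add: radical_mult_inject)
      then show ?thesis by (rule red_inj[OF tp_closed[OF that]])
    qed
    have "x = \<zero>\<^bsub>T (i + j)\<^esub>" if x: "x \<in> carrier (T (i + j))" for x
    proof (rule T_hom_eq[OF id_hom _ x, where g = "\<lambda>_. \<zero>\<^bsub>T (i + j)\<^esub>"])
      show "(\<lambda>_. \<zero>\<^bsub>T (i + j)\<^esub>) \<in> module_hom R (T (i + j)) (T (i + j))" by (rule module_homI) simp_all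
      fix w assume w: "set w \<subseteq> carrier Q" "length w = i + j"
      have d: "set (take i w) \<subseteq> carrier Q" "set (drop i w) \<subseteq> carrier Q"
        using w(1) set_take_subset[of i w] set_drop_subset[of i w] by auto
      have "pt w = tp i j (pt (take i w)) (pt (drop i w))" using d w by (simp add: tp_pt)
      then show "pt w = \<zero>\<^bsub>T (i + j)\<^esub>" using d w z by simp
    qed
    then have "carrier (T (i + j)) = {\<zero>\<^bsub>T (i + j)\<^esub>}" by auto
    then show False using T_nonzero[OF one] by blast
  qed
qed

lemma commutative_subalgebra_iff:
  assumes one: "\<one> \<noteq> \<zero>" and I: "I \<subseteq> {0..<m}"
  shows "commutative_subalgebra R (radical_ext R Q m \<phi>) (I_radical_carrier R Q I) \<longleftrightarrow> saturated m I"
proof -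
  have I': "I \<subseteq> {..<m}" using I by (simp add: lessThan_atLeast0)
  show ?thesis
    unfolding commutative_subalgebra_def radical_ext_eq A_carrier_update saturated_iff[OF m_pos I]
    using submodule_A[OF I'] algebra_A[OF I'] closed_if_algebra[OF one, of I] by blast
qed

text \<open>
  In degree \<open>i\<close> the sum has the component \<open>f i\<close> alone.  This gives both existence and uniqueness of
  homogeneous components.
\<close>

lemma sum_of_components:
  assumes I: "I \<subseteq> {0..<m}" and f: "f \<in> (\<Pi>\<^sub>E g\<in>int ` I. I_radical_carrier R Q {nat g})" and x: "x \<in> carrier (DS I)"
  shows "x = (\<Oplus>\<^bsub>A I\<^esub>g\<in>{g \<in> int ` I. f g \<noteq> \<zero>\<^bsub>A I\<^esub>}. f g) \<longleftrightarrow> (\<forall>i\<in>I. x i = f (int i) i)"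
proof -
  let ?S = "{g \<in> int ` I. f g \<noteq> \<zero>\<^bsub>A I\<^esub>}" and ?y = "\<lambda>i. if i \<in> I then f (int i) i else \<zero>\<^bsub>T i\<^esub>"
  have fin: "finite I" using I finite_subset by blast
  have fc: "f (int i) \<in> carrier (DS {i})" if "i \<in> I" for i
    using f that by (force simp: I_radical_carrier_def)
  have f_eq: "f (int i) = ds_inject T i (?y i)" if "i \<in> I" for i
    using fc[OF that] that by (auto simp: direct_sum_carrier ds_inject_apply fun_eq_iff)
  have fI: "f \<in> int ` I \<rightarrow> carrier (DS I)" using DS_mono[OF fc] by auto
  have "finite {i. ?y i \<noteq> \<zero>\<^bsub>T i\<^esub>}" by (rule finite_subset[OF _ fin]) (auto split: if_split_asm)
  then have y: "?y \<in> carrier (DS I)" using DS_comp[OF fc] by (simp add: direct_sum_carrier)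
  have "(\<Oplus>\<^bsub>A I\<^esub>g\<in>?S. f g) = (\<Oplus>\<^bsub>DS I\<^esub>g\<in>int ` I. f g)"
    unfolding finsum_A by (rule DS.add.finprod_mono_neutral_cong_left) (use fin fI in auto)
  also have "\<dots> = (\<Oplus>\<^bsub>DS I\<^esub>i\<in>I. f (int i))"
    by (rule DS.finsum_reindex[OF fI]) (simp add: inj_on_def)
  also have "\<dots> = (\<Oplus>\<^bsub>DS I\<^esub>i\<in>I. ds_inject T i (?y i))"
  proof (rule DS.finsum_cong'[OF refl _ f_eq])
    show "(\<lambda>i. ds_inject T i (?y i)) \<in> I \<rightarrow> carrier (DS I)"
      by (rule Pi_I) (rule inject_closed[OF _ DS_comp[OF y]])
  qed
  also have "\<dots> = ?y"
    by (rule direct_sum_expand[where M = T, OF cring_R module_T fin y])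
  finally have "(\<Oplus>\<^bsub>A I\<^esub>g\<in>?S. f g) = ?y" .
  then show ?thesis using x by (auto simp: fun_eq_iff direct_sum_carrier)
qed

lemma graded_A:
  assumes I: "I \<subseteq> {0..<m}" and sat: "saturated m I"
  shows "graded_algebra R ((integer_mod_group m)\<lparr>carrier := int ` I\<rparr>) (A I) (\<lambda>k. I_radical_carrier R Q {nat k})"
  unfolding graded_algebra_def
proof (intro conjI ballI)
  have I': "I \<subseteq> {..<m}" using I by (simp add: lessThan_atLeast0)
  have z: "0 \<in> I" and closed: "\<forall>i\<in>I. \<forall>j\<in>I. (i + j) mod m \<in> I"
    using sat saturated_iff[OF m_pos I] by blast+
  show "group ((integer_mod_group m)\<lparr>carrier := int ` I\<rparr>)"
    using sat unfolding saturated_def by (rule subgroup.subgroup_is_group) simp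
  show "algebra R (A I)" by (rule algebra_A[OF I' z closed])
  show "submodule (I_radical_carrier R Q {nat g}) R (A I)"
    if "g \<in> carrier ((integer_mod_group m)\<lparr>carrier := int ` I\<rparr>)" for g
    using that by (intro submodule_A) auto
  show "\<one>\<^bsub>A I\<^esub> \<in> I_radical_carrier R Q {nat \<one>\<^bsub>(integer_mod_group m)\<lparr>carrier := int ` I\<rparr>\<^esub>}"
    by (simp add: I_radical_carrier_def) (rule inject_closed, simp_all)
  show "x \<otimes>\<^bsub>A I\<^esub> y \<in> I_radical_carrier R Q {nat (g \<otimes>\<^bsub>(integer_mod_group m)\<lparr>carrier := int ` I\<rparr>\<^esub> h)}"
    if g: "g \<in> carrier ((integer_mod_group m)\<lparr>carrier := int ` I\<rparr>)"
      and h: "h \<in> carrier ((integer_mod_group m)\<lparr>carrier := int ` I\<rparr>)"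
      and x: "x \<in> I_radical_carrier R Q {nat g}" and y: "y \<in> I_radical_carrier R Q {nat h}" for g h x y
  proof -
    obtain i j where ij: "g = int i" "h = int j" using g h by auto
    have inj: "x = ds_inject T i (x i)" if "x \<in> carrier (DS {i})" for x i
      using that by (auto simp: direct_sum_carrier ds_inject_apply fun_eq_iff)
    have xd: "x \<in> carrier (DS {i})" and yd: "y \<in> carrier (DS {j})"
      using x y ij by (simp_all add: I_radical_carrier_def)
    have c: "x i \<in> carrier (T i)" "y j \<in> carrier (T j)" by (rule DS_comp[OF xd], rule DS_comp[OF yd])
    have "radical_mult x y = ds_inject T ((i + j) mod m) (red (i + j) (tp i j (x i) (y j)))"
      using radical_mult_inject[OF c] inj[OF xd] inj[OF yd] by simp
    moreover have "\<dots> \<in> carrier (DS {(i + j) mod m})"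
      using c by (intro inject_closed) simp_all
    moreover have "nat ((int i + int j) mod int m) = (i + j) mod m"
      by (simp flip: of_nat_add of_nat_mod)
    ultimately show ?thesis using ij by (simp add: I_radical_carrier_def)
  qed
  fix x assume "x \<in> carrier (A I)"
  then have x: "x \<in> carrier (DS I)" by simp
  let ?G = "(integer_mod_group m)\<lparr>carrier := int ` I\<rparr>"
  let ?P = "\<lambda>f. f \<in> (\<Pi>\<^sub>E g\<in>carrier ?G. I_radical_carrier R Q {nat g}) \<and>
    finite {g \<in> carrier ?G. f g \<noteq> \<zero>\<^bsub>A I\<^esub>} \<and> x = (\<Oplus>\<^bsub>A I\<^esub>g\<in>{g \<in> carrier ?G. f g \<noteq> \<zero>\<^bsub>A I\<^esub>}. f g)"
  have fin: "finite (int ` I)" using I finite_subset by auto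
  show "\<exists>!f. ?P f"
  proof (rule ex1I)
    let ?f = "\<lambda>g\<in>int ` I. ds_inject T (nat g) (x (nat g))"
    have f: "?f \<in> (\<Pi>\<^sub>E g\<in>int ` I. I_radical_carrier R Q {nat g})"
      using DS_comp[OF x] by (auto simp: I_radical_carrier_def intro!: inject_closed)
    have "x = (\<Oplus>\<^bsub>A I\<^esub>g\<in>{g \<in> int ` I. ?f g \<noteq> \<zero>\<^bsub>A I\<^esub>}. ?f g)"
      unfolding sum_of_components[OF I f x] by auto
    then show "?P ?f" using f fin by simp
    fix h assume "?P h"
    then have h: "h \<in> (\<Pi>\<^sub>E g\<in>int ` I. I_radical_carrier R Q {nat g})"
      and e: "\<forall>i\<in>I. x i = h (int i) i" using sum_of_components[OF I _ x, of h] by auto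
    show "h = ?f"
    proof (rule PiE_ext[OF h f])
      fix g assume "g \<in> int ` I"
      then obtain i where i: "i \<in> I" "g = int i" by blast
      then have "h (int i) \<in> carrier (DS {i})" using h by (force simp: I_radical_carrier_def)
      then show "h g = ?f g" using i e by (auto simp: direct_sum_carrier ds_inject_apply fun_eq_iff)
    qed
  qed
qed

subsection \<open>Projectivity and rank\<close>

text \<open>
  Write \<open>1\<close> as a combination \<open>\<Sum>w. c w \<phi>(w)\<close> and expand \<open>1 x\<close> by means of the local generators.  The same
  words serve for all degrees.
\<close>

lemma tensor_power_dual_basis:
  obtains W f where "finite W" "\<And>w. w \<in> W \<Longrightarrow> set w \<subseteq> carrier Q \<and> length w = m"
    "\<And>i w. i \<le> m \<Longrightarrow> w \<in> W \<Longrightarrow> f i w \<in> module_hom R (T i) (ring_module R)"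
    "\<And>i x. i \<le> m \<Longrightarrow> x \<in> carrier (T i) \<Longrightarrow> x = (\<Oplus>\<^bsub>T i\<^esub>w\<in>W. f i w x \<odot>\<^bsub>T i\<^esub> pt (take i w))"
proof -
  obtain W c where W: "finite W" "\<forall>w\<in>W. set w \<subseteq> carrier Q \<and> length w = m" "c \<in> W \<rightarrow> carrier R"
    "(\<Oplus>w\<in>W. c w \<otimes> \<phi> (pt w)) = \<one>"
    using unit_ideal by (elim exE conjE)
  have w: "set w \<subseteq> carrier Q" "length w = m" "c w \<in> carrier R" "\<phi> (pt w) \<in> carrier R" if "w \<in> W" for w
    using that W by auto
  note coordc = module_hom_closed[OF coord_hom[OF w(1,2)], unfolded ring_module_simps]
  let ?f = "\<lambda>i w x. c w \<otimes> coord i w x"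
  show ?thesis
  proof (rule that[of W ?f])
    show "finite W" by (rule W)
    show "set w \<subseteq> carrier Q \<and> length w = m" if "w \<in> W" for w using w[OF that] by simp
    show "?f i w \<in> module_hom R (T i) (ring_module R)" if i: "i \<le> m" and W: "w \<in> W" for i w
      using module_hom_comp[OF coord_hom[OF w(1,2)[OF W] i]
          smult_left_hom[OF module_ring_module[OF cring_R] w(3)[OF W]]] by simp
    show "x = (\<Oplus>\<^bsub>T i\<^esub>w\<in>W. ?f i w x \<odot>\<^bsub>T i\<^esub> pt (take i w))" if i: "i \<le> m" and x: "x \<in> carrier (T i)" for i x
    proof -
      have "x = (\<Oplus>w\<in>W. c w \<otimes> \<phi> (pt w)) \<odot>\<^bsub>T i\<^esub> x" using x W(4) by simp
      also have "\<dots> = (\<Oplus>\<^bsub>T i\<^esub>w\<in>W. (c w \<otimes> \<phi> (pt w)) \<odot>\<^bsub>T i\<^esub> x)"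
        using w by (intro finsum_smult_left[OF module_T x]) simp
      also have "\<dots> = (\<Oplus>\<^bsub>T i\<^esub>w\<in>W. ?f i w x \<odot>\<^bsub>T i\<^esub> pt (take i w))"
      proof (rule T.finsum_cong')
        fix v assume v: "v \<in> W"
        have t: "pt (take i v) \<in> carrier (T i)"
          using w(1,2)[OF v] i set_take_subset[of i v] by (intro pt_closed) auto
        show "(c v \<otimes> \<phi> (pt v)) \<odot>\<^bsub>T i\<^esub> x = ?f i v x \<odot>\<^bsub>T i\<^esub> pt (take i v)"
          using w[OF v] x t coordc[OF v v i x] coord_expand[OF w(1,2)[OF v] i x]
          by (simp add: T.smult_assoc1)
      next
        show "(\<lambda>w. ?f i w x \<odot>\<^bsub>T i\<^esub> pt (take i w)) \<in> W \<rightarrow> carrier (T i)"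
        proof
          fix v assume v: "v \<in> W"
          have t: "pt (take i v) \<in> carrier (T i)"
            using w(1,2)[OF v] i set_take_subset[of i v] by (intro pt_closed) auto
          then show "?f i v x \<odot>\<^bsub>T i\<^esub> pt (take i v) \<in> carrier (T i)" using w[OF v] coordc[OF v v i x] by simp
        qed
      qed simp
      finally show ?thesis .
    qed
  qed
qed

lemma pt_take_closed:
  "set w \<subseteq> carrier Q \<Longrightarrow> length w = m \<Longrightarrow> i \<le> m \<Longrightarrow> pt (take i w) \<in> carrier (T i)"
  using set_take_subset[of i w] by (intro pt_closed) auto

lemma fg_projective_T: "i \<le> m \<Longrightarrow> fg_projective R (T i)"
proof -
  assume i: "i \<le> m"
  obtain W f where W: "finite W" "\<And>w. w \<in> W \<Longrightarrow> set w \<subseteq> carrier Q \<and> length w = m"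
    "\<And>i w. i \<le> m \<Longrightarrow> w \<in> W \<Longrightarrow> f i w \<in> module_hom R (T i) (ring_module R)"
    "\<And>i x. i \<le> m \<Longrightarrow> x \<in> carrier (T i) \<Longrightarrow> x = (\<Oplus>\<^bsub>T i\<^esub>w\<in>W. f i w x \<odot>\<^bsub>T i\<^esub> pt (take i w))"
    by (rule tensor_power_dual_basis) blast
  show ?thesis
    by (rule fg_projective_dual_basis[OF module_T W(1) _ W(3)[OF i] W(4)[OF i]])
      (use W(2) i pt_take_closed in blast)
qed

text \<open>
  The component of degree \<open>i\<close> is expanded in the dual basis of that degree, so the generators are indexed
  by a degree together with a word.
\<close>

lemma fg_projective_A:
  assumes I: "I \<subseteq> {..<m}"
  shows "fg_projective R (A I)"
proof -
  obtain W f where W: "finite W" "\<And>w. w \<in> W \<Longrightarrow> set w \<subseteq> carrier Q \<and> length w = m"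
    "\<And>i w. i \<le> m \<Longrightarrow> w \<in> W \<Longrightarrow> f i w \<in> module_hom R (T i) (ring_module R)"
    "\<And>i x. i \<le> m \<Longrightarrow> x \<in> carrier (T i) \<Longrightarrow> x = (\<Oplus>\<^bsub>T i\<^esub>w\<in>W. f i w x \<odot>\<^bsub>T i\<^esub> pt (take i w))"
    by (rule tensor_power_dual_basis) blast
  let ?a = "\<lambda>(i, w). ds_inject T i (pt (take i w))" and ?f = "\<lambda>(i, w) x. f i w (x i)"
  have im: "i \<le> m" if "i \<in> I" for i using I that by auto
  have finI: "finite I" using I finite_subset by blast
  have pc: "pt (take i w) \<in> carrier (T i)" if "i \<in> I" "w \<in> W" for i w
    using pt_take_closed W(2)[OF that(2)] im[OF that(1)] by blast
  have fc: "f i w y \<in> carrier R" if "i \<in> I" "w \<in> W" "y \<in> carrier (T i)" for i w y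
    using module_hom_closed[OF W(3)[OF im[OF that(1)] that(2)] that(3)] by simp
  show ?thesis
  proof (rule fg_projective_dual_basis[OF module_A, where K = "I \<times> W" and a = ?a and f = ?f])
    show "finite (I \<times> W)" using finI W(1) by simp
    show "?a \<in> I \<times> W \<rightarrow> carrier (A I)" using pc inject_closed by fastforce
    show "?f k \<in> module_hom R (A I) (ring_module R)" if k: "k \<in> I \<times> W" for k
    proof -
      obtain i w where iw: "k = (i, w)" "i \<in> I" "w \<in> W" using k by blast
      have "(\<lambda>x. f i w (x i)) \<in> module_hom R (DS I) (ring_module R)"
        by (rule module_hom_comp[OF ds_component_hom[where M = T, OF cring_R module_T] W(3)[OF im[OF iw(2)] iw(3)]])
      then show ?thesis by (simp add: iw(1) module_hom_def)
    qed
    fix x assume "x \<in> carrier (A I)"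
    then have x: "x \<in> carrier (DS I)" by simp
    let ?e = "\<lambda>i w. ds_inject T i (pt (take i w))" and ?t = "\<lambda>(i, w). f i w (x i) \<odot>\<^bsub>DS I\<^esub> ds_inject T i (pt (take i w))"
    have tc: "?t (i, w) \<in> carrier (DS I)" if "i \<in> I" "w \<in> W" for i w
      unfolding prod.case by (rule DS.smult_closed[OF fc[OF that DS_comp[OF x]] inject_closed[OF that(1) pc[OF that]]])
    have inner: "ds_inject T i (x i) = (\<Oplus>\<^bsub>DS I\<^esub>w\<in>W. ?t (i, w))" if i: "i \<in> I" for i
    proof -
      note xi = DS_comp[OF x, of i]
      have "ds_inject T i (x i) = ds_inject T i (\<Oplus>\<^bsub>T i\<^esub>w\<in>W. f i w (x i) \<odot>\<^bsub>T i\<^esub> pt (take i w))"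
        by (rule arg_cong[OF W(4)[OF im[OF i] xi]])
      also have "\<dots> = (\<Oplus>\<^bsub>DS I\<^esub>w\<in>W. ds_inject T i (f i w (x i) \<odot>\<^bsub>T i\<^esub> pt (take i w)))"
        by (rule module_hom_finsum[OF module_T module_DS inject_hom[OF i] Pi_I])
          (rule T.smult_closed[OF fc[OF i _ xi] pc[OF i]])
      also have "\<dots> = (\<Oplus>\<^bsub>DS I\<^esub>w\<in>W. ?t (i, w))"
      proof (rule DS.finsum_cong'[OF refl Pi_I])
        show "?t (i, w) \<in> carrier (DS I)" if "w \<in> W" for w by (rule tc[OF i that])
        show "ds_inject T i (f i w (x i) \<odot>\<^bsub>T i\<^esub> pt (take i w)) = ?t (i, w)" if "w \<in> W" for w
          unfolding prod.case by (rule module_hom_smult[OF inject_hom[OF i] fc[OF i that xi] pc[OF i that]])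
      qed
      finally show ?thesis .
    qed
    have "x = (\<Oplus>\<^bsub>DS I\<^esub>i\<in>I. ds_inject T i (x i))"
      by (rule direct_sum_expand[where M = T, OF cring_R module_T finI x, symmetric])
    also have "\<dots> = (\<Oplus>\<^bsub>DS I\<^esub>i\<in>I. \<Oplus>\<^bsub>DS I\<^esub>w\<in>W. ?t (i, w))"
      by (rule DS.finsum_cong'[OF refl Pi_I]) (rule DS.finsum_closed, rule Pi_I, erule (1) tc, erule inner)
    also have "\<dots> = (\<Oplus>\<^bsub>DS I\<^esub>k\<in>I \<times> W. ?t k)"
      by (rule DS.finsum_Times[symmetric, OF finI W(1)]) (use tc in blast)
    also have "\<dots> = (\<Oplus>\<^bsub>A I\<^esub>k\<in>I \<times> W. ?f k x \<odot>\<^bsub>A I\<^esub> ?a k)"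
      unfolding finsum_A by (rule DS.finsum_cong') (use tc in \<open>auto simp: split_def\<close>)
    finally show "x = (\<Oplus>\<^bsub>A I\<^esub>k\<in>I \<times> W. ?f k x \<odot>\<^bsub>A I\<^esub> ?a k)" .
  qed
qed

text \<open>Otherwise \<open>P\<close> would contain \<open>1\<close>, a combination of the \<open>\<phi>(w)\<close>.\<close>

lemma word_outside_prime:
  assumes "primeideal P R"
  shows "\<exists>w. set w \<subseteq> carrier Q \<and> length w = m \<and> \<phi> (pt w) \<in> carrier R - P"
proof (rule ccontr)
  assume n: "\<not> ?thesis"
  interpret P: primeideal P R by fact
  obtain W c where W: "finite W" "\<forall>w\<in>W. set w \<subseteq> carrier Q \<and> length w = m" "c \<in> W \<rightarrow> carrier R"
    "(\<Oplus>w\<in>W. c w \<otimes> \<phi> (pt w)) = \<one>"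
    using unit_ideal by (elim exE conjE)
  have "c w \<otimes> \<phi> (pt w) \<in> P" if w: "w \<in> W" for w
  proof -
    have w': "set w \<subseteq> carrier Q" "length w = m" "c w \<in> carrier R" using w W by auto
    then have "\<phi> (pt w) \<in> P" using n by auto
    then show ?thesis using P.I_l_closed w'(3) by blast
  qed
  then have "\<one> \<in> P" using ideal_finsum[OF P.ideal_axioms W(1)] W(4) by (metis (no_types, lifting) Pi_I)
  then show False using P.one_imp_carrier P.I_notcarr by blast
qed

lemma has_rank_T:
  assumes i: "i \<le> m"
  shows "has_rank R (T i) 1"
proof (rule has_rankI[OF module_T])
  fix P assume "primeideal P R"
  then obtain w where w: "set w \<subseteq> carrier Q" "length w = m" "\<phi> (pt w) \<in> carrier R - P"
    using word_outside_prime by blast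
  note pc = pt_take_closed[OF w(1,2) i]
  show "\<exists>s e g. s \<in> carrier R - P \<and> (\<forall>k<1. e k \<in> carrier (T i)) \<and>
      (\<forall>k<1. g k \<in> module_hom R (T i) (ring_module R)) \<and>
      (\<forall>k<1. \<forall>j<1. g k (e j) = (if k = j then s else \<zero>)) \<and>
      (\<forall>x\<in>carrier (T i). s \<odot>\<^bsub>T i\<^esub> x = (\<Oplus>\<^bsub>T i\<^esub>k\<in>{..<1::nat}. g k x \<odot>\<^bsub>T i\<^esub> e k))"
  proof (intro exI conjI allI impI ballI)
    show "\<phi> (pt w) \<in> carrier R - P" by (rule w)
    show "(\<lambda>_::nat. pt (take i w)) k \<in> carrier (T i)" for k by (rule pc)
    show "(\<lambda>_::nat. coord i w) k \<in> module_hom R (T i) (ring_module R)" for k by (rule coord_hom[OF w(1,2) i])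
    show "coord i w (pt (take i w)) = (if k = j then \<phi> (pt w) else \<zero>)" if "k < 1" "j < 1" for k j :: nat
      using that coord_gen[OF w(1,2) i] by simp
    fix x assume x: "x \<in> carrier (T i)"
    have "coord i w x \<in> carrier R" using module_hom_closed[OF coord_hom[OF w(1,2) i] x] by simp
    then show "\<phi> (pt w) \<odot>\<^bsub>T i\<^esub> x = (\<Oplus>\<^bsub>T i\<^esub>k\<in>{..<1::nat}. coord i w x \<odot>\<^bsub>T i\<^esub> pt (take i w))"
      using coord_expand[OF w(1,2) i x] pc by (simp add: lessThan_Suc)
  qed
qed

text \<open>For \<open>\<phi>(w)\<close> outside the prime, the tensors \<open>take i w\<close> with \<open>i \<in> I\<close> form a local basis.\<close>

lemma has_rank_A:
  assumes I: "I \<subseteq> {..<m}"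
  shows "has_rank R (A I) (card I)"
proof (rule has_rankI[OF module_A])
  fix P assume "primeideal P R"
  then obtain w where w: "set w \<subseteq> carrier Q" "length w = m" "\<phi> (pt w) \<in> carrier R - P"
    using word_outside_prime by blast
  have finI: "finite I" using I finite_subset by blast
  obtain h where h: "bij_betw h {0..<card I} I" using ex_bij_betw_nat_finite[OF finI] by blast
  have hI: "h k \<in> I" if "k < card I" for k using h that by (auto simp: bij_betw_def)
  have hm: "h k \<le> m" if "k < card I" for k using hI[OF that] I by auto
  have hinj: "h k = h l \<longleftrightarrow> k = l" if "k < card I" "l < card I" for k l
    using h that by (auto simp: bij_betw_def inj_on_def)
  note pc = pt_take_closed[OF w(1,2)]
  note ch = coord_hom[OF w(1,2)]
  have cc: "coord i w y \<in> carrier R" if "i \<le> m" "y \<in> carrier (T i)" for i y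
    using module_hom_closed[OF ch[OF that(1)] that(2)] by simp
  let ?s = "\<phi> (pt w)"
  let ?e = "\<lambda>k. ds_inject T (h k) (pt (take (h k) w))" and ?g = "\<lambda>k x. coord (h k) w (x (h k))"
  have ec: "?e k \<in> carrier (DS I)" if "k < card I" for k
    by (rule inject_closed[OF hI[OF that] pc[OF hm[OF that]]])
  show "\<exists>s e g. s \<in> carrier R - P \<and> (\<forall>i<card I. e i \<in> carrier (A I)) \<and>
      (\<forall>i<card I. g i \<in> module_hom R (A I) (ring_module R)) \<and>
      (\<forall>i<card I. \<forall>j<card I. g i (e j) = (if i = j then s else \<zero>)) \<and>
      (\<forall>x\<in>carrier (A I). s \<odot>\<^bsub>A I\<^esub> x = (\<Oplus>\<^bsub>A I\<^esub>i\<in>{..<card I}. g i x \<odot>\<^bsub>A I\<^esub> e i))"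
  proof (rule exI[of _ ?s], rule exI[of _ ?e], rule exI[of _ ?g], intro conjI allI impI ballI)
    show "?s \<in> carrier R - P" by (rule w)
    show "?e k \<in> carrier (A I)" if "k < card I" for k using ec[OF that] by simp
    show "?g k \<in> module_hom R (A I) (ring_module R)" if "k < card I" for k
      using module_hom_comp[OF ds_component_hom[where M = T and J = I, OF cring_R module_T] ch[OF hm[OF that]]]
      by (simp add: module_hom_def)
    show "?g k (?e l) = (if k = l then ?s else \<zero>)" if "k < card I" "l < card I" for k l
      using coord_gen[OF w(1,2) hm[OF that(1)]] hinj[OF that]
        module_hom_zero[OF module_T module_ring_module[OF cring_R] ch[OF hm[OF that(1)]]]
      by (cases "k = l") (simp_all add: ds_inject_apply)
    fix x assume "x \<in> carrier (A I)"
    then have x: "x \<in> carrier (DS I)" by simp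
    have x': "?s \<odot>\<^bsub>DS I\<^esub> x \<in> carrier (DS I)" using w x by (intro DS.smult_closed) auto
    let ?u = "\<lambda>i. coord i w (x i) \<odot>\<^bsub>DS I\<^esub> ds_inject T i (pt (take i w))"
    have im: "i \<le> m" if "i \<in> I" for i using I that by auto
    have uc: "?u i \<in> carrier (DS I)" if "i \<in> I" for i
      by (rule DS.smult_closed[OF cc[OF im[OF that] DS_comp[OF x]] inject_closed[OF that pc[OF im[OF that]]]])
    have "?s \<odot>\<^bsub>DS I\<^esub> x = (\<Oplus>\<^bsub>DS I\<^esub>i\<in>I. ds_inject T i ((?s \<odot>\<^bsub>DS I\<^esub> x) i))"
      by (rule direct_sum_expand[where M = T, OF cring_R module_T finI x', symmetric])
    also have "\<dots> = (\<Oplus>\<^bsub>DS I\<^esub>i\<in>I. ?u i)"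
    proof (rule DS.finsum_cong'[OF refl])
      show "?u \<in> I \<rightarrow> carrier (DS I)" by (rule Pi_I) (rule uc)
      show "ds_inject T i ((?s \<odot>\<^bsub>DS I\<^esub> x) i) = ?u i" if i: "i \<in> I" for i
        using coord_expand[OF w(1,2) im[OF i] DS_comp[OF x, of i]]
          module_hom_smult[OF inject_hom[OF i] cc[OF im[OF i] DS_comp[OF x]] pc[OF im[OF i]]] by simp
    qed
    also have "\<dots> = (\<Oplus>\<^bsub>DS I\<^esub>i\<in>h ` {..<card I}. ?u i)"
      using h by (simp add: bij_betw_def lessThan_atLeast0)
    also have "\<dots> = (\<Oplus>\<^bsub>DS I\<^esub>k\<in>{..<card I}. ?u (h k))"
    proof (rule DS.finsum_reindex)
      show "?u \<in> h ` {..<card I} \<rightarrow> carrier (DS I)" using uc hI by blast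
      show "inj_on h {..<card I}" using h by (simp add: bij_betw_def lessThan_atLeast0)
    qed
    finally show "?s \<odot>\<^bsub>A I\<^esub> x = (\<Oplus>\<^bsub>A I\<^esub>k\<in>{..<card I}. ?g k x \<odot>\<^bsub>A I\<^esub> ?e k)"
      unfolding finsum_A by simp
  qed
qed

end

section \<open>Tensor powers of a tensor power\<close>

context tensor_powers
begin

interpretation Q: module R Q by (rule module_Q)
interpretation T: module R "T i" for i by (rule module_T)

primrec tensor_concat :: "nat \<Rightarrow> ('q list \<Rightarrow> 'r) set list \<Rightarrow> ('q list \<Rightarrow> 'r) set" where
  "tensor_concat d [] = pt []"
| "tensor_concat d (X # Xs) = tp d (d * length Xs) X (tensor_concat d Xs)"

lemma tensor_concat_closed:
  "set Xs \<subseteq> carrier (T d) \<Longrightarrow> length Xs = k \<Longrightarrow> tensor_concat d Xs \<in> carrier (T (d * k))"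
proof (induction Xs arbitrary: k)
  case (Cons X Xs)
  then have "tp d (d * length Xs) X (tensor_concat d Xs) \<in> carrier (T (d + d * length Xs))"
    by (intro tp_closed) auto
  then show ?case using Cons.prems(2) by auto
qed simp

lemma tensor_concat_append:
  assumes "set Xs \<subseteq> carrier (T d)" "set Ys \<subseteq> carrier (T d)"
  shows "tensor_concat d (Xs @ Ys) = tp (d * length Xs) (d * length Ys) (tensor_concat d Xs) (tensor_concat d Ys)"
  using assms(1)
proof (induction Xs)
  case Nil
  then show ?case using tensor_concat_closed[OF assms(2)] by (simp add: tp_one_left)
next
  case (Cons X Xs)
  have c: "X \<in> carrier (T d)" "tensor_concat d Xs \<in> carrier (T (d * length Xs))"
    "tensor_concat d Ys \<in> carrier (T (d * length Ys))"
    using Cons.prems tensor_concat_closed[OF _ refl] assms(2) by auto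
  show ?case using Cons tp_assoc[OF c] by (simp add: add_mult_distrib2)
qed

lemma tensor_concat_pt:
  "set u \<subseteq> carrier Q \<Longrightarrow> length u = d \<Longrightarrow>
    tensor_concat d (replicate k (pt u)) = pt (concat (replicate k u))"
proof (induction k)
  case (Suc k)
  have "set (concat (replicate k u)) \<subseteq> carrier Q" using Suc.prems by (auto simp: set_replicate_conv_if)
  moreover have "length (concat (replicate k u)) = d * k" using Suc.prems by (simp add: length_concat sum_list_replicate)
  ultimately show ?case using Suc by (simp add: tp_pt)
qed simp

text \<open>A word of length \<open>d k\<close> is cut into \<open>k\<close> words of length \<open>d\<close>.\<close>

lemma tensor_concat_surj:
  "set w \<subseteq> carrier Q \<Longrightarrow> length w = d * k \<Longrightarrow>
    \<exists>Xs. set Xs \<subseteq> carrier (T d) \<and> length Xs = k \<and> tensor_concat d Xs = pt w"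
proof (induction k arbitrary: w)
  case (Suc k)
  let ?u = "take d w" and ?v = "drop d w"
  have u: "set ?u \<subseteq> carrier Q" "length ?u = d" and v: "set ?v \<subseteq> carrier Q" "length ?v = d * k"
    using Suc.prems set_take_subset[of d w] set_drop_subset[of d w] by auto
  obtain Xs where Xs: "set Xs \<subseteq> carrier (T d)" "length Xs = k" "tensor_concat d Xs = pt ?v"
    using Suc.IH[OF v] by blast
  have "tensor_concat d (pt ?u # Xs) = pt w" using Xs u v by (simp add: tp_pt)
  then show ?case using Xs u by (intro exI[of _ "pt ?u # Xs"]) simp
qed simp

end

context invertible_tensor_power
begin

interpretation Q: module R Q by (rule module_Q)
interpretation T: module R "T i" for i by (rule module_T)

context
  fixes d n :: nat
  assumes dn: "d * n = m"
begin

lemma d_pos: "d \<ge> 1"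
proof -
  have "d \<noteq> 0" using dn m_pos by (intro notI) simp
  then show ?thesis by simp
qed

lemma n_pos: "n \<ge> 1"
proof -
  have "n \<noteq> 0" using dn m_pos by (intro notI) simp
  then show ?thesis by simp
qed

lemma d_le_m: "d \<le> m"
  using n_pos unfolding dn[symmetric] by simp

interpretation Q': tensor_powers R "T d"
  by (rule tensor_powers.intro[OF module_T])
interpretation T': module R "Q'.T i" for i by (rule Q'.module_T)

text \<open>The canonical map \<open>(Q\<^sup>\<otimes>\<^sup>d)\<^sup>\<otimes>\<^sup>k \<rightarrow> Q\<^sup>\<otimes>\<^sup>(\<^sup>d\<^sup>k\<^sup>)\<close> that forgets the inner brackets.\<close>

definition flatten :: "nat \<Rightarrow> (('q list \<Rightarrow> 'r) set list \<Rightarrow> 'r) set \<Rightarrow> ('q list \<Rightarrow> 'r) set" where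
  "flatten k = tensor_lift R (T (d * k)) (tensor_concat d)"

lemma tensor_concat_multilinear: "Q'.multilinear k (T (d * k)) (tensor_concat d)"
  unfolding Q'.multilinear_def
proof (intro conjI allI impI)
  show "tensor_concat d w \<in> carrier (T (d * k))" if "set w \<subseteq> carrier (T d)" "length w = k" for w
    by (rule tensor_concat_closed[OF that])
  fix u v assume u: "set u \<subseteq> carrier (T d)" and v: "set v \<subseteq> carrier (T d)" and l: "length u + 1 + length v = k"
  note cu = tensor_concat_closed[OF u refl] and cv = tensor_concat_closed[OF v refl]
  have k: "d * length u + (d + d * length v) = d * k" using l by (auto simp: algebra_simps)
  have "(\<lambda>a. tp (d * length u) (d + d * length v) (tensor_concat d u) (tp d (d * length v) a (tensor_concat d v)))
      \<in> module_hom R (T d) (T (d * k))"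
    using module_hom_comp[OF tp_hom_left[OF cv, of d] tp_hom_right[OF cu]] unfolding k .
  moreover have "tensor_concat d (u @ [a] @ v) =
      tp (d * length u) (d + d * length v) (tensor_concat d u) (tp d (d * length v) a (tensor_concat d v))"
    if "a \<in> carrier (T d)" for a
    using u v that tensor_concat_append[of u d "a # v"] by simp
  ultimately show "(\<lambda>a. tensor_concat d (u @ [a] @ v)) \<in> module_hom R (T d) (T (d * k))"
    by (simp add: module_hom_def Pi_def)
qed

lemma flatten_hom: "flatten k \<in> module_hom R (Q'.T k) (T (d * k))"
  unfolding flatten_def by (rule Q'.tensor_lift_hom[OF module_T tensor_concat_multilinear])

lemmas flatten_closed = module_hom_closed[OF flatten_hom]

lemma flatten_pt: "set Xs \<subseteq> carrier (T d) \<Longrightarrow> length Xs = k \<Longrightarrow> flatten k (Q'.pt Xs) = tensor_concat d Xs"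
  unfolding flatten_def by (rule Q'.tensor_lift_pt[OF module_T tensor_concat_multilinear])

lemma flatten_tp:
  assumes x: "x \<in> carrier (Q'.T i)" and y: "y \<in> carrier (Q'.T j)"
  shows "flatten (i + j) (Q'.tp i j x y) = tp (d * i) (d * j) (flatten i x) (flatten j y)"
proof (rule Q'.T_hom_eq[OF _ _ x, where f = "\<lambda>x. flatten (i + j) (Q'.tp i j x y)"])
  show "(\<lambda>x. flatten (i + j) (Q'.tp i j x y)) \<in> module_hom R (Q'.T i) (T (d * i + d * j))"
    using module_hom_comp[OF Q'.tp_hom_left[OF y] flatten_hom] by (simp add: add_mult_distrib2)
  show "(\<lambda>x. tp (d * i) (d * j) (flatten i x) (flatten j y)) \<in> module_hom R (Q'.T i) (T (d * i + d * j))"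
    by (rule module_hom_comp[OF flatten_hom tp_hom_left[OF flatten_closed[OF y]]])
  fix u assume u: "set u \<subseteq> carrier (T d)" "length u = i"
  have uc: "Q'.pt u \<in> carrier (Q'.T i)" using u by simp
  show "flatten (i + j) (Q'.tp i j (Q'.pt u) y) = tp (d * i) (d * j) (flatten i (Q'.pt u)) (flatten j y)"
  proof (rule Q'.T_hom_eq[OF _ _ y, where f = "\<lambda>y. flatten (i + j) (Q'.tp i j (Q'.pt u) y)"])
    show "(\<lambda>y. flatten (i + j) (Q'.tp i j (Q'.pt u) y)) \<in> module_hom R (Q'.T j) (T (d * i + d * j))"
      using module_hom_comp[OF Q'.tp_hom_right[OF uc] flatten_hom] by (simp add: add_mult_distrib2)
    show "(\<lambda>y. tp (d * i) (d * j) (flatten i (Q'.pt u)) (flatten j y)) \<in> module_hom R (Q'.T j) (T (d * i + d * j))"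
      by (rule module_hom_comp[OF flatten_hom tp_hom_right[OF flatten_closed[OF uc]]])
    fix v assume "set v \<subseteq> carrier (T d)" "length v = j"
    then show "flatten (i + j) (Q'.tp i j (Q'.pt u) (Q'.pt v)) =
        tp (d * i) (d * j) (flatten i (Q'.pt u)) (flatten j (Q'.pt v))"
      using u tensor_concat_append[of u d v] by (simp add: Q'.tp_pt flatten_pt)
  qed
qed

lemma flatten_surj: "x \<in> carrier (T (d * k)) \<Longrightarrow> \<exists>y\<in>carrier (Q'.T k). flatten k y = x"
proof (induction rule: T_induct)
  case (add x y)
  then obtain x' y' where "x' \<in> carrier (Q'.T k)" "flatten k x' = x" "y' \<in> carrier (Q'.T k)" "flatten k y' = y"
    by (elim bexE)
  then show ?case
    by (intro bexI[of _ "x' \<oplus>\<^bsub>Q'.T k\<^esub> y'"]) (simp_all add: module_hom_add[OF flatten_hom])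
next
  case (pure r w)
  then obtain Xs where "set Xs \<subseteq> carrier (T d)" "length Xs = k" "tensor_concat d Xs = pt w"
    using tensor_concat_surj[OF pure(2,3)] by (elim exE conjE)
  then show ?case using pure(1)
    by (intro bexI[of _ "r \<odot>\<^bsub>Q'.T k\<^esub> Q'.pt Xs"]) (simp_all add: module_hom_smult[OF flatten_hom] flatten_pt)
qed

text \<open>
  Each of the \<open>k\<close> factors \<open>X\<close> of a pure tensor satisfies \<open>\<phi>(w) X = f u\<close> with \<open>u = take d w\<close> and \<open>f\<close> the
  coordinate of \<open>X\<close>.
\<close>

lemma locally_cyclic_power:
  assumes w: "set w \<subseteq> carrier Q" "length w = m"
  shows "x \<in> carrier (Q'.T k) \<Longrightarrow> \<exists>r\<in>carrier R.
    (\<phi> (pt w) [^] k) \<odot>\<^bsub>Q'.T k\<^esub> x = r \<odot>\<^bsub>Q'.T k\<^esub> Q'.pt (replicate k (pt (take d w)))"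
proof (induction rule: Q'.T_induct)
  let ?s = "\<phi> (pt w)" and ?a = "pt (take d w)"
  have sc: "?s \<in> carrier R" using w by simp
  have ac: "?a \<in> carrier (T d)" by (rule pt_take_closed[OF w d_le_m])
  have rc: "Q'.pt (replicate k ?a) \<in> carrier (Q'.T k)" for k
    using ac by (intro Q'.pt_closed) (auto simp: set_replicate_conv_if)
  {
    case (add x y)
    then obtain r t where r: "r \<in> carrier R" "(?s [^] k) \<odot>\<^bsub>Q'.T k\<^esub> x = r \<odot>\<^bsub>Q'.T k\<^esub> Q'.pt (replicate k ?a)"
      and t: "t \<in> carrier R" "(?s [^] k) \<odot>\<^bsub>Q'.T k\<^esub> y = t \<odot>\<^bsub>Q'.T k\<^esub> Q'.pt (replicate k ?a)"
      by (elim bexE)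
    then show ?case using add(1,2) sc rc[of k]
      by (intro bexI[of _ "r \<oplus> t"]) (simp_all add: T'.smult_r_distr T'.smult_l_distr)
  next
    case (pure r Xs)
    have "\<exists>t\<in>carrier R. (?s [^] k) \<odot>\<^bsub>Q'.T k\<^esub> Q'.pt Xs = t \<odot>\<^bsub>Q'.T k\<^esub> Q'.pt (replicate k ?a)"
      using pure(2,3)
    proof (induction Xs arbitrary: k)
      case Nil
      then show ?case by (intro bexI[of _ "\<one>"]) simp_all
    next
      case (Cons X Xs)
      obtain j where k: "k = Suc j" "length Xs = j" using Cons.prems(2) by auto
      have Xc: "X \<in> carrier (T d)" "set Xs \<subseteq> carrier (T d)" using Cons.prems(1) by auto
      obtain t where t: "t \<in> carrier R"
        "(?s [^] j) \<odot>\<^bsub>Q'.T j\<^esub> Q'.pt Xs = t \<odot>\<^bsub>Q'.T j\<^esub> Q'.pt (replicate j ?a)"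
        using Cons.IH[OF Xc(2) k(2)] by (elim bexE)
      let ?f = "coord d w X"
      have fc: "?f \<in> carrier R" using module_hom_closed[OF coord_hom[OF w d_le_m] Xc(1)] by simp
      have p: "Q'.pt [X] \<in> carrier (Q'.T (Suc 0))" "Q'.pt Xs \<in> carrier (Q'.T j)"
        "Q'.pt [?a] \<in> carrier (Q'.T (Suc 0))"
        using Xc k ac by simp_all
      have cyc: "?s \<odot>\<^bsub>Q'.T (Suc 0)\<^esub> Q'.pt [X] = ?f \<odot>\<^bsub>Q'.T (Suc 0)\<^esub> Q'.pt [?a]"
        using Q'.pt_smult[OF sc Xc(1), of "[]" "[]" "Suc 0"] Q'.pt_smult[OF fc ac, of "[]" "[]" "Suc 0"]
          coord_expand[OF w d_le_m Xc(1)] by simp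
      have "(?s [^] k) \<odot>\<^bsub>Q'.T k\<^esub> Q'.pt (X # Xs) =
          ((?s [^] j) \<otimes> ?s) \<odot>\<^bsub>Q'.T (Suc 0 + j)\<^esub> Q'.tp (Suc 0) j (Q'.pt [X]) (Q'.pt Xs)"
        using Xc k by (simp add: Q'.tp_pt)
      also have "\<dots> = Q'.tp (Suc 0) j (?s \<odot>\<^bsub>Q'.T (Suc 0)\<^esub> Q'.pt [X]) ((?s [^] j) \<odot>\<^bsub>Q'.T j\<^esub> Q'.pt Xs)"
        using p sc by (simp only: Q'.tp_smult_left Q'.tp_smult_right Q'.tp_closed T'.smult_closed
            T'.smult_assoc1 Q.nat_pow_closed)
      also have "\<dots> = (t \<otimes> ?f) \<odot>\<^bsub>Q'.T (Suc 0 + j)\<^esub> Q'.tp (Suc 0) j (Q'.pt [?a]) (Q'.pt (replicate j ?a))"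
        unfolding cyc t(2) using p fc t(1) rc[of j]
        by (simp only: Q'.tp_smult_left Q'.tp_smult_right Q'.tp_closed T'.smult_closed T'.smult_assoc1)
      also have "Q'.tp (Suc 0) j (Q'.pt [?a]) (Q'.pt (replicate j ?a)) = Q'.pt (replicate k ?a)"
        using ac k by (simp add: Q'.tp_pt set_replicate_conv_if)
      finally show ?case using t(1) fc k by (intro bexI[of _ "t \<otimes> ?f"]) simp_all
    qed
    then obtain t where t: "t \<in> carrier R"
      "(?s [^] k) \<odot>\<^bsub>Q'.T k\<^esub> Q'.pt Xs = t \<odot>\<^bsub>Q'.T k\<^esub> Q'.pt (replicate k ?a)" by (elim bexE)
    have Xs: "Q'.pt Xs \<in> carrier (Q'.T k)" using pure by simp
    have "(?s [^] k) \<odot>\<^bsub>Q'.T k\<^esub> (r \<odot>\<^bsub>Q'.T k\<^esub> Q'.pt Xs) = r \<odot>\<^bsub>Q'.T k\<^esub> ((?s [^] k) \<odot>\<^bsub>Q'.T k\<^esub> Q'.pt Xs)"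
      using Xs pure(1) sc by (simp add: T'.smult_assoc1[symmetric] Q.m_comm)
    then show ?case using t pure(1) rc[of k]
      by (intro bexI[of _ "r \<otimes> t"]) (simp_all add: T'.smult_assoc1)
  }
qed

lemma red_word_power:
  assumes w: "set w \<subseteq> carrier Q" "length w = m"
  shows "red (m * k) (pt (concat (replicate k w))) = (\<phi> (pt w) [^] k) \<odot>\<^bsub>T 0\<^esub> pt []"
proof (induction k)
  case 0
  then show ?case using m_pos by (simp add: red_small)
next
  case (Suc k)
  have c: "set (concat (replicate k w)) \<subseteq> carrier Q" "length (concat (replicate k w)) = m * k"
    using w by (auto simp: set_replicate_conv_if length_concat sum_list_replicate)
  have sc: "\<phi> (pt w) \<in> carrier R" using w by simp
  have "red (m * Suc k) (pt (concat (replicate (Suc k) w))) =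
      red (m + m * k) (tp m (m * k) (pt w) (pt (concat (replicate k w))))"
    using w c by (simp add: tp_pt)
  also have "\<dots> = \<phi> (pt w) \<odot>\<^bsub>T 0\<^esub> red (m * k) (pt (concat (replicate k w)))"
    using red_tp_phi[of "pt w" "pt (concat (replicate k w))" "m * k"] w c by simp
  also have "\<dots> = (\<phi> (pt w) [^] Suc k) \<odot>\<^bsub>T 0\<^esub> pt []"
    unfolding Suc.IH using sc by (simp add: T.smult_assoc1[symmetric] Q.m_comm)
  finally show ?case .
qed

lemma mset_concat_replicate:
  "mset (concat (replicate k (u @ v))) = mset (concat (replicate k u) @ concat (replicate k v))"
  by (induction k) simp_all

text \<open>
  The argument is local at a word \<open>w = u v\<close> with \<open>u\<close> of length \<open>d\<close>: there \<open>\<phi>(w)\<^sup>k x = r u\<^sup>k\<close> for some scalar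
  \<open>r\<close>.  If \<open>x\<close> flattens to zero, multiplication by \<open>v\<^sup>k\<close> and a permutation of the letters give \<open>r w\<^sup>k = 0\<close>.
  This reduces to \<open>r \<phi>(w)\<^sup>k = 0\<close>, so that \<open>\<phi>(w)\<^sup>2\<^sup>k x = 0\<close>.
\<close>

lemma flatten_inj:
  assumes x: "x \<in> carrier (Q'.T k)" and z: "flatten k x = \<zero>\<^bsub>T (d * k)\<^esub>"
  shows "x = \<zero>\<^bsub>Q'.T k\<^esub>"
proof (rule zero_if_killed[OF Q'.module_T x])
  fix w assume w: "set w \<subseteq> carrier Q" "length w = m"
  let ?s = "\<phi> (pt w)" and ?u = "take d w" and ?v = "drop d w"
  let ?a = "pt ?u"
  let ?U = "concat (replicate k ?u)" and ?V = "concat (replicate k ?v)" and ?W = "concat (replicate k w)"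
  have sc: "?s \<in> carrier R" and skc: "?s [^] k \<in> carrier R" using w by simp_all
  have ac: "?a \<in> carrier (T d)" by (rule pt_take_closed[OF w d_le_m])
  have u: "set ?u \<subseteq> carrier Q" "length ?u = d" and v: "set ?v \<subseteq> carrier Q" "length ?v = m - d"
    using w d_le_m set_take_subset[of d w] set_drop_subset[of d w] by auto
  have rs: "set (replicate k ?a) \<subseteq> carrier (T d)" using ac by (auto simp: set_replicate_conv_if)
  have rc: "Q'.pt (replicate k ?a) \<in> carrier (Q'.T k)"
    using rs by (intro Q'.pt_closed) simp_all
  have U: "set ?U \<subseteq> carrier Q" "length ?U = d * k"
    using u by (auto simp: set_replicate_conv_if length_concat sum_list_replicate)
  have V: "set ?V \<subseteq> carrier Q" "length ?V = (m - d) * k"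
    using v by (auto simp: set_replicate_conv_if length_concat sum_list_replicate)
  have W: "set ?W \<subseteq> carrier Q" "length ?W = m * k"
    using w by (auto simp: set_replicate_conv_if length_concat sum_list_replicate)
  have mk: "d * k + (m - d) * k = m * k" using d_le_m by (simp flip: add_mult_distrib)
  have Uc: "pt ?U \<in> carrier (T (d * k))" and Vc: "pt ?V \<in> carrier (T ((m - d) * k))"
    and Wc: "pt ?W \<in> carrier (T (m * k))" using U V W by simp_all
  obtain r where r: "r \<in> carrier R" "(?s [^] k) \<odot>\<^bsub>Q'.T k\<^esub> x = r \<odot>\<^bsub>Q'.T k\<^esub> Q'.pt (replicate k ?a)"
    using locally_cyclic_power[OF w x] by (elim bexE)
  have "r \<odot>\<^bsub>T (d * k)\<^esub> pt ?U = flatten k (r \<odot>\<^bsub>Q'.T k\<^esub> Q'.pt (replicate k ?a))"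
    using module_hom_smult[OF flatten_hom r(1) rc] flatten_pt[OF rs, of k] tensor_concat_pt[OF u, of k] by simp
  also have "\<dots> = \<zero>\<^bsub>T (d * k)\<^esub>"
    unfolding r(2)[symmetric] using module_hom_smult[OF flatten_hom skc x] z skc by simp
  finally have "tp (d * k) ((m - d) * k) (r \<odot>\<^bsub>T (d * k)\<^esub> pt ?U) (pt ?V) = \<zero>\<^bsub>T (m * k)\<^esub>"
    using tp_zero_left[OF Vc, of "d * k"] mk by simp
  moreover have "tp (d * k) ((m - d) * k) (pt ?U) (pt ?V) = pt ?W"
  proof -
    have "pt (?U @ ?V) = pt ?W"
      using mset_concat_replicate[of k ?u ?v] U(1) V(1) by (intro pt_mset) simp_all
    then show ?thesis using U V by (simp add: tp_pt)
  qed
  ultimately have "r \<odot>\<^bsub>T (m * k)\<^esub> pt ?W = \<zero>\<^bsub>T (m * k)\<^esub>"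
    using tp_smult_left[OF Vc r(1) Uc] mk by simp
  then have "r \<odot>\<^bsub>T 0\<^esub> red (m * k) (pt ?W) = \<zero>\<^bsub>T 0\<^esub>"
    using module_hom_smult[OF red_hom r(1) Wc] module_hom_zero[OF module_T module_T red_hom, of "m * k"] by simp
  then have "(r \<otimes> ?s [^] k) \<odot>\<^bsub>T 0\<^esub> pt [] = \<zero>\<^bsub>T 0\<^esub>"
    unfolding red_word_power[OF w] using r(1) skc by (simp add: T.smult_assoc1)
  then have "?s [^] k \<otimes> r = \<zero>"
    using T0_scalar_inj[of "r \<otimes> ?s [^] k"] r(1) skc by (simp add: Q.m_comm)
  then have "(?s [^] k) \<odot>\<^bsub>Q'.T k\<^esub> ((?s [^] k) \<odot>\<^bsub>Q'.T k\<^esub> x) = \<zero>\<^bsub>Q'.T k\<^esub>"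
    unfolding r(2) using r(1) skc rc by (simp add: T'.smult_assoc1[symmetric])
  then have "(?s [^] (k + k)) \<odot>\<^bsub>Q'.T k\<^esub> x = \<zero>\<^bsub>Q'.T k\<^esub>"
    using sc skc x by (simp add: T'.smult_assoc1 flip: Q.nat_pow_mult)
  then show "\<exists>n::nat. (?s [^] n) \<odot>\<^bsub>Q'.T k\<^esub> x = \<zero>\<^bsub>Q'.T k\<^esub>" by (rule exI)
qed

lemma flatten_iso: "flatten k \<in> module_iso R (Q'.T k) (T (d * k))"
proof -
  have "inj_on (flatten k) (carrier (Q'.T k))"
  proof (rule inj_onI)
    fix x y assume x: "x \<in> carrier (Q'.T k)" and y: "y \<in> carrier (Q'.T k)" and e: "flatten k x = flatten k y"
    have "flatten k (x \<ominus>\<^bsub>Q'.T k\<^esub> y) = \<zero>\<^bsub>T (d * k)\<^esub>"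
      using module_hom_minus[OF Q'.module_T module_T flatten_hom x y] e flatten_closed[OF y]
      by (simp add: a_minus_def T.r_neg)
    then have "x \<ominus>\<^bsub>Q'.T k\<^esub> y = \<zero>\<^bsub>Q'.T k\<^esub>" using x y by (intro flatten_inj) simp_all
    then show "x = y" using x y by (metis a_minus_def T'.minus_equality T'.minus_minus T'.a_inv_closed)
  qed
  moreover have "flatten k ` carrier (Q'.T k) = carrier (T (d * k))"
  proof
    show "flatten k ` carrier (Q'.T k) \<subseteq> carrier (T (d * k))" using flatten_closed by (rule image_subsetI)
    show "carrier (T (d * k)) \<subseteq> flatten k ` carrier (Q'.T k)" using flatten_surj by (metis image_eqI subsetI)
  qed
  ultimately show ?thesis using flatten_hom by (simp add: module_iso_def bij_betw_def)
qed

abbreviation "\<phi>' \<equiv> \<lambda>x. \<phi> (flatten n x)"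

lemma phi'_iso: "\<phi>' \<in> module_iso R (Q'.T n) (ring_module R)"
proof -
  have f: "flatten n \<in> module_hom R (Q'.T n) (T m)" "bij_betw (flatten n) (carrier (Q'.T n)) (carrier (T m))"
    using flatten_iso[of n] dn by (simp_all add: module_iso_def)
  have p: "bij_betw \<phi> (carrier (T m)) (carrier (ring_module R))" using phi by (simp add: module_iso_def)
  show ?thesis
    using module_hom_comp[OF f(1) phi_hom] bij_betw_trans[OF f(2) p] by (simp add: module_iso_def o_def)
qed

interpretation E: invertible_tensor_power R "T d" n \<phi>'
  by unfold_locales (rule n_pos, rule phi'_iso)

text \<open>
  Flattening maps the tensor \<open>\<epsilon>\<close> of \<open>Q\<^sup>\<otimes>\<^sup>d\<close> to a tensor with value \<open>1\<close> under \<open>\<phi>\<close>, so it commutes with the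
  removal of a factor \<open>\<epsilon>\<close>.
\<close>

lemma flatten_red: "x \<in> carrier (Q'.T i) \<Longrightarrow> flatten (i mod n) (E.red i x) = red (d * i) (flatten i x)"
proof (induction i arbitrary: x rule: less_induct)
  case (less i)
  show ?case
  proof (cases "i < n")
    case True
    then have "d * i < m" using dn d_pos by auto
    then show ?thesis using True by (simp add: E.red_small red_small)
  next
    case False
    then obtain j where i: "i = n + j" using le_Suc_ex[of n i] by fastforce
    have x: "x \<in> carrier (Q'.T (n + j))" using less.prems i by simp
    have c: "E.ctr (n + j) x \<in> carrier (Q'.T j)" by (rule E.contract_closed[OF x])
    note fc = flatten_closed[OF c]
    have fe: "flatten n E.eps \<in> carrier (T m)" using flatten_closed[OF E.eps_closed] dn by simp
    have fx: "flatten (n + j) x = tp m (d * j) (flatten n E.eps) (flatten j (E.ctr (n + j) x))"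
      using flatten_tp[OF E.eps_closed c] E.eps_contract[OF x] dn by simp
    have "red (m + d * j) (flatten (n + j) x) = red (d * j) (flatten j (E.ctr (n + j) x))"
      unfolding fx using red_tp_phi[OF fe fc] E.phi_eps fc by simp
    also have "\<dots> = flatten (j mod n) (E.red j (E.ctr (n + j) x))"
      by (rule less.IH[symmetric, OF _ c]) (use i n_pos in simp)
    finally show ?thesis unfolding i using dn by (simp add: E.red_step add_mult_distrib2)
  qed
qed

abbreviation "J \<equiv> (\<lambda>k. d * k) ` {..<n}"

lemma J_mem: "k < n \<Longrightarrow> d * k \<in> J"
  by (intro imageI) simp

definition unflatten :: "nat \<Rightarrow> ('q list \<Rightarrow> 'r) set \<Rightarrow> (('q list \<Rightarrow> 'r) set list \<Rightarrow> 'r) set" where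
  "unflatten k = inv_into (carrier (Q'.T k)) (flatten k)"

lemma unflatten_iso: "unflatten k \<in> module_iso R (T (d * k)) (Q'.T k)"
  unfolding unflatten_def by (rule module_iso_inverse[OF flatten_iso]) simp_all

lemma unflatten_flatten: "y \<in> carrier (Q'.T k) \<Longrightarrow> unflatten k (flatten k y) = y"
  using flatten_iso[of k] by (simp add: unflatten_def module_iso_def bij_betw_def)

lemma flatten_unflatten: "x \<in> carrier (T (d * k)) \<Longrightarrow> flatten k (unflatten k x) = x"
  using flatten_iso[of k] by (simp add: unflatten_def module_iso_def bij_betw_def f_inv_into_f)

text \<open>
  The isomorphism of algebras and its inverse, assembled from their homogeneous parts: degree \<open>k\<close> over
  \<open>Q\<^sup>\<otimes>\<^sup>d\<close> corresponds to degree \<open>d k\<close> over \<open>Q\<close>.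
\<close>

definition Flatten where
  "Flatten = ds_lift Q'.T (DS J) (\<lambda>k y. ds_inject T (d * k) (flatten k y))"

definition Unflatten where
  "Unflatten = ds_lift T (Q'.DS {..<n}) (\<lambda>i x. ds_inject Q'.T (i div d) (unflatten (i div d) x))"

lemma Flatten_summand_hom: "k \<in> {..<n} \<Longrightarrow> (\<lambda>y. ds_inject T (d * k) (flatten k y)) \<in> module_hom R (Q'.T k) (DS J)"
  by (rule module_hom_comp[OF flatten_hom inject_hom[OF J_mem]]) simp

lemma Unflatten_summand_hom:
  assumes "i \<in> J"
  shows "(\<lambda>x. ds_inject Q'.T (i div d) (unflatten (i div d) x)) \<in> module_hom R (T i) (Q'.DS {..<n})"
proof -
  obtain k where k: "k < n" "i = d * k" using assms by blast
  have "unflatten k \<in> module_hom R (T (d * k)) (Q'.T k)" using unflatten_iso[of k] by (simp add: module_iso_def)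
  from module_hom_comp[OF this Q'.inject_hom[of k "{..<n}"]] show ?thesis using k d_pos by simp
qed

lemma Flatten_hom: "Flatten \<in> module_hom R (Q'.DS {..<n}) (DS J)"
  unfolding Flatten_def by (rule ds_lift_hom[OF cring_R Q'.module_T module_DS Flatten_summand_hom])

lemma Flatten_inject:
  "k < n \<Longrightarrow> y \<in> carrier (Q'.T k) \<Longrightarrow> Flatten (ds_inject Q'.T k y) = ds_inject T (d * k) (flatten k y)"
  unfolding Flatten_def
  by (rule ds_lift_inject[where J = "{..<n}", OF cring_R Q'.module_T module_DS Flatten_summand_hom]) simp_all

lemma Unflatten_hom: "Unflatten \<in> module_hom R (DS J) (Q'.DS {..<n})"
  unfolding Unflatten_def by (rule ds_lift_hom[OF cring_R module_T Q'.module_DS Unflatten_summand_hom])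

lemma Unflatten_inject:
  assumes "k < n" "x \<in> carrier (T (d * k))"
  shows "Unflatten (ds_inject T (d * k) x) = ds_inject Q'.T k (unflatten k x)"
  unfolding Unflatten_def
  using ds_lift_inject[where J = J and M = T, OF cring_R module_T Q'.module_DS Unflatten_summand_hom J_mem[OF assms(1)] assms(2)]
    d_pos by simp

lemma Flatten_Unflatten:
  assumes "x \<in> carrier (DS J)"
  shows "Flatten (Unflatten x) = x"
proof (rule ds_hom_eq[OF cring_R module_T module_DS module_hom_comp[OF Unflatten_hom Flatten_hom] _ _ assms])
  show "(\<lambda>x. x) \<in> module_hom R (DS J) (DS J)" by (simp add: module_hom_def)
  fix i x assume "i \<in> J" and x: "x \<in> carrier (T i)"
  then obtain k where k: "k < n" "i = d * k" by blast
  have "unflatten k x \<in> carrier (Q'.T k)"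
    using unflatten_iso[of k] x k by (auto simp: module_iso_def intro: module_hom_closed)
  then show "Flatten (Unflatten (ds_inject T i x)) = ds_inject T i x"
    using k x by (simp add: Unflatten_inject Flatten_inject flatten_unflatten)
qed

lemma Unflatten_Flatten:
  assumes "y \<in> carrier (Q'.DS {..<n})"
  shows "Unflatten (Flatten y) = y"
proof (rule ds_hom_eq[OF cring_R Q'.module_T Q'.module_DS module_hom_comp[OF Flatten_hom Unflatten_hom] _ _ assms])
  show "(\<lambda>x. x) \<in> module_hom R (Q'.DS {..<n}) (Q'.DS {..<n})" by (simp add: module_hom_def)
  fix k y assume "k \<in> {..<n}" and y: "y \<in> carrier (Q'.T k)"
  then show "Unflatten (Flatten (ds_inject Q'.T k y)) = ds_inject Q'.T k y"
    by (simp add: Unflatten_inject Flatten_inject unflatten_flatten flatten_closed)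
qed

text \<open>For homogeneous elements this is the compatibility of flattening with tensor products and reduction.\<close>

lemma Flatten_mult:
  assumes x: "x \<in> carrier (Q'.DS {..<n})" and y: "y \<in> carrier (Q'.DS {..<n})"
  shows "Flatten (E.radical_mult x y) = radical_mult (Flatten x) (Flatten y)"
proof -
  have J: "J \<subseteq> {..<m}" using dn d_pos by auto
  note U' = Q'.DS_mono[OF _ subset_UNIV] and U = DS_mono[OF _ subset_UNIV]
  note Fc = module_hom_closed[OF Flatten_hom]
  have Flatten_hom': "Flatten \<in> module_hom R (Q'.DS {..<n}) (DS {..<m})"
  proof (rule module_hom_comp[OF Flatten_hom, where g = "\<lambda>x. x"])
    show "(\<lambda>x. x) \<in> module_hom R (DS J) (DS {..<m})"
      by (rule hom_DS_mono[OF _ J]) (simp add: module_hom_def)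
  qed
  note eqI = ds_hom_eq[OF cring_R Q'.module_T module_DS]
  show ?thesis
  proof (rule eqI[OF module_hom_comp[OF E.radical_mult_hom_left[OF U'[OF y]] Flatten_hom']
        module_hom_comp[OF Flatten_hom radical_mult_hom_left[OF U[OF Fc[OF y]]]] _ x])
    fix i a assume "i \<in> {..<n}" and a: "a \<in> carrier (Q'.T i)"
    then have i: "i < n" by simp
    have ia: "ds_inject Q'.T i a \<in> carrier (Q'.DS {..<n})" using i a by (intro E.inject_closed) simp_all
    show "Flatten (E.radical_mult (ds_inject Q'.T i a) y) = radical_mult (Flatten (ds_inject Q'.T i a)) (Flatten y)"
    proof (rule eqI[OF module_hom_comp[OF E.radical_mult_hom_right[OF U'[OF ia]] Flatten_hom']
        module_hom_comp[OF Flatten_hom radical_mult_hom_right[OF U[OF Fc[OF ia]]]] _ y])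
      fix j b assume "j \<in> {..<n}" and b: "b \<in> carrier (Q'.T j)"
      then have j: "j < n" by simp
      have ab: "Q'.tp i j a b \<in> carrier (Q'.T (i + j))" using a b by simp
      have "Flatten (E.radical_mult (ds_inject Q'.T i a) (ds_inject Q'.T j b)) =
          ds_inject T (d * ((i + j) mod n)) (flatten ((i + j) mod n) (E.red (i + j) (Q'.tp i j a b)))"
        unfolding E.radical_mult_inject[OF a b]
        by (rule Flatten_inject[OF _ E.red_closed[OF ab]]) (use n_pos in simp)
      also have "\<dots> = ds_inject T ((d * i + d * j) mod m) (red (d * i + d * j) (tp (d * i) (d * j) (flatten i a) (flatten j b)))"
        unfolding flatten_red[OF ab] flatten_tp[OF a b] using dn by (simp add: mult_mod_right add_mult_distrib2)
      also have "\<dots> = radical_mult (ds_inject T (d * i) (flatten i a)) (ds_inject T (d * j) (flatten j b))"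
        by (rule radical_mult_inject[symmetric, OF flatten_closed[OF a] flatten_closed[OF b]])
      finally show "Flatten (E.radical_mult (ds_inject Q'.T i a) (ds_inject Q'.T j b)) =
          radical_mult (Flatten (ds_inject Q'.T i a)) (Flatten (ds_inject Q'.T j b))"
        using i j a b by (simp add: Flatten_inject)
    qed
  qed
qed

lemma Flatten_one: "Flatten E.unit_S = unit_S"
  using Flatten_inject[of 0 "Q'.pt []"] flatten_pt[of "[]" 0] n_pos by simp

lemma Unflatten_iso: "Unflatten \<in> algebra_iso R (A J) (radical_ext R (T d) n \<phi>')"
proof -
  let ?B = "E.A {..<n}"
  note Fc = module_hom_closed[OF Flatten_hom] and Uc = module_hom_closed[OF Unflatten_hom]
  have hom: "Unflatten \<in> module_hom R (A J) ?B"
    using Unflatten_hom by (simp add: module_hom_def)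
  have bij: "bij_betw Unflatten (carrier (A J)) (carrier ?B)"
    by (rule bij_betw_byWitness[where f' = Flatten])
      (use Flatten_Unflatten Unflatten_Flatten Fc Uc in auto)
  have "Unflatten \<in> ring_hom (A J) ?B"
  proof (rule ring_hom_memI)
    show "Unflatten x \<in> carrier ?B" if "x \<in> carrier (A J)" for x
      by (rule module_hom_closed[OF hom that])
    show "Unflatten (x \<oplus>\<^bsub>A J\<^esub> y) = Unflatten x \<oplus>\<^bsub>?B\<^esub> Unflatten y"
      if "x \<in> carrier (A J)" "y \<in> carrier (A J)" for x y
      by (rule module_hom_add[OF hom that])
    show "Unflatten (x \<otimes>\<^bsub>A J\<^esub> y) = Unflatten x \<otimes>\<^bsub>?B\<^esub> Unflatten y"
      if "x \<in> carrier (A J)" "y \<in> carrier (A J)" for x y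
    proof -
      have x: "x \<in> carrier (DS J)" and y: "y \<in> carrier (DS J)" using that by simp_all
      have "E.radical_mult (Unflatten x) (Unflatten y) \<in> carrier (Q'.DS {..<n})"
        by (rule module_hom_closed[OF E.radical_mult_hom_right[OF Q'.DS_mono[OF Uc[OF x] subset_UNIV]] Uc[OF y]])
      then have "Unflatten (Flatten (E.radical_mult (Unflatten x) (Unflatten y))) = E.radical_mult (Unflatten x) (Unflatten y)"
        by (rule Unflatten_Flatten)
      then show ?thesis
        using Flatten_mult[OF Uc[OF x] Uc[OF y]] Flatten_Unflatten[OF x] Flatten_Unflatten[OF y] by simp
    qed
    have "E.unit_S \<in> carrier (Q'.DS {..<n})" using n_pos by (intro E.inject_closed) simp_all
    from Unflatten_Flatten[OF this] show "Unflatten \<one>\<^bsub>A J\<^esub> = \<one>\<^bsub>?B\<^esub>" by (simp add: Flatten_one)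
  qed
  then show ?thesis
    using hom bij unfolding E.radical_ext_eq by (simp add: algebra_iso_def ring_iso_def module_iso_def)
qed

lemma I_radical_ext_is_radical_ext:
  "\<exists>\<phi>'. \<phi>' \<in> module_hom R (tensor_power R (T d) n) (ring_module R) \<and>
    algebra_iso R (A J) (radical_ext R (T d) n \<phi>') \<noteq> {}"
  using Unflatten_iso phi'_iso by (intro exI[of _ \<phi>']) (auto simp: module_iso_def)

end

end

section \<open>Saturated parts of radical extensions\<close>

theorem proposition4p9:
  fixes R :: "('r, 'z) ring_scheme"
    and Q :: "('r, 'q, 'x) module_scheme"
    and m :: nat
    and \<phi> :: "('q list \<Rightarrow> 'r) set \<Rightarrow> 'r"
    and I :: "nat set"
  assumes "cring R"
    and "module R Q"
    and "carrier Q \<noteq> {\<zero>\<^bsub>Q\<^esub>}"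
    and "m \<ge> 1"
    and "\<phi> \<in> module_iso R (tensor_power R Q m) (ring_module R)"
    and "I \<subseteq> {0..<m}"
  shows
    "(commutative_subalgebra R (radical_ext R Q m \<phi>) (I_radical_carrier R Q I) \<longleftrightarrow> saturated m I) \<and>
     (saturated m I \<longrightarrow>
        graded_algebra R ((integer_mod_group m)\<lparr>carrier := int ` I\<rparr>) (I_radical_ext R Q m \<phi> I)
          (\<lambda>k. I_radical_carrier R Q {nat k}) \<and>
        fg_projective R (I_radical_ext R Q m \<phi> I) \<and>
        (\<exists>n. has_rank R (I_radical_ext R Q m \<phi> I) n \<and> n dvd m)) \<and>
     (saturated m I \<longrightarrow>
        (\<exists>(Q' :: ('r, ('q list \<Rightarrow> 'r) set) module) (m' :: nat) \<phi>'.
           fg_projective R Q' \<and> has_rank R Q' 1 \<and> m' \<ge> 1 \<and>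
           \<phi>' \<in> module_hom R (tensor_power R Q' m') (ring_module R) \<and>
           algebra_iso R (I_radical_ext R Q m \<phi> I) (radical_ext R Q' m' \<phi>') \<noteq> {}))"
proof -
  interpret Q: module R Q by fact
  interpret S: invertible_tensor_power R Q m \<phi>
    by unfold_locales (fact assms)+
  have I': "I \<subseteq> {..<m}" using assms(6) by (simp add: lessThan_atLeast0)
  have one: "\<one>\<^bsub>R\<^esub> \<noteq> \<zero>\<^bsub>R\<^esub>"
  proof
    assume z: "\<one>\<^bsub>R\<^esub> = \<zero>\<^bsub>R\<^esub>"
    have "x = \<zero>\<^bsub>Q\<^esub>" if "x \<in> carrier Q" for x
      using Q.smult_one[OF that] Q.smult_l_null[OF that] z by simp
    then show False using assms(3) Q.zero_closed by blast
  qed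
  note subalgebra = S.commutative_subalgebra_iff[OF one assms(6)]
  show ?thesis
  proof (intro conjI impI)
    show "commutative_subalgebra R (radical_ext R Q m \<phi>) (I_radical_carrier R Q I) \<longleftrightarrow> saturated m I"
      by (rule subalgebra)
  next
    assume sat: "saturated m I"
    show "graded_algebra R ((integer_mod_group m)\<lparr>carrier := int ` I\<rparr>) (I_radical_ext R Q m \<phi> I)
        (\<lambda>k. I_radical_carrier R Q {nat k})"
      by (rule S.graded_A[OF assms(6) sat])
    show "fg_projective R (I_radical_ext R Q m \<phi> I)" by (rule S.fg_projective_A[OF I'])
    obtain d n where dn: "d * n = m" "n \<ge> 1" "I = (\<lambda>k. d * k) ` {..<n}"
      using saturated_multiples[OF assms(4,6) sat] by blast
    have d: "d \<ge> 1" using dn(1) assms(4) by (cases d) auto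
    have "card I = n" unfolding dn(3) using d by (subst card_image) (auto simp: inj_on_def)
    then have "card I dvd m" using dn(1) by auto
    then show "\<exists>n. has_rank R (I_radical_ext R Q m \<phi> I) n \<and> n dvd m"
      using S.has_rank_A[OF I'] by blast
    have dm: "d \<le> m" using dn(1,2) by (cases n) auto
    obtain \<phi>' where "\<phi>' \<in> module_hom R (tensor_power R (tensor_power R Q d) n) (ring_module R)"
      "algebra_iso R (I_radical_ext R Q m \<phi> I) (radical_ext R (tensor_power R Q d) n \<phi>') \<noteq> {}"
      using S.I_radical_ext_is_radical_ext[OF dn(1)] unfolding dn(3) by blast
    then show "\<exists>(Q' :: ('r, ('q list \<Rightarrow> 'r) set) module) (m' :: nat) \<phi>'.
        fg_projective R Q' \<and> has_rank R Q' 1 \<and> m' \<ge> 1 \<and>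
        \<phi>' \<in> module_hom R (tensor_power R Q' m') (ring_module R) \<and>
        algebra_iso R (I_radical_ext R Q m \<phi> I) (radical_ext R Q' m' \<phi>') \<noteq> {}"
      using S.fg_projective_T[OF dm] S.has_rank_T[OF dm] dn(2) by blast
  qed
qed

end
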